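(* Let $\mathcal{H}$ be a complex Hilbert space and let $B$ and $C$ be linear operators in $\mathcal{H}$ such that $B^2$ is m-accretive, $C$ is accretive, $\mathcal{D}(B^2)\subset\mathcal{D}(C)$, and there exist $\alpha\ge 0$, $0\le\beta<1$, $\delta\ge 0$ with $$\operatorname{Re}\langle B^2x,Cx\rangle\ge -\alpha\|x\|^2-\beta\|B^2x\|^2-\delta\|B^2x\|\,\|x\|\qquad\text{for all }x\in\mathcal{D}(B^2).$$ Let $\Lambda=B^2+C$ with domain $\mathcal{D}(B^2)$, and let $Z_1=B+\Lambda^{1/2}$ with domain $\mathcal{D}(B)\cap\mathcal{D}(\Lambda^{1/2})$. If $\mathcal{D}(\Lambda^{1/2})\subset\mathcal{D}(B)$ and $B$ is accretive, then $Z_1$ is m-$(\pi/4)$-accretive. In particular, $-Z_1$ generates a holomorphic $C_0$-semigroup $\mathcal{T}_1(z)$ of angle $\pi/4$. Further, if $B$ is $\theta$-accretive with $0\le\theta<\pi/2$, then $\mathcal{N}(Z_1)=\mathcal{N}(B)\cap\mathcal{N}(\Lambda^{1/2})$.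
   Context: $\mathcal{N}(T)$ denotes the null space of $T$. A linear operator $T$ in $\mathcal{H}$ is accretive if $\operatorname{Re}\langle Tx,x\rangle\ge 0$ for all $x\in\mathcal{D}(T)$; an accretive operator is m-accretive if it is densely defined and $\mathcal{R}(\lambda+T)=\mathcal{H}$ for some (hence every) $\lambda>0$. For $\omega\in[0,\pi/2)$, $T$ is $\omega$-accretive if $|\operatorname{Im}\langle Tx,x\rangle|\le\tan\omega\,\operatorname{Re}\langle Tx,x\rangle$ for all $x\in\mathcal{D}(T)$, and m-$\omega$-accretive if it is in addition m-accretive. Under the stated hypotheses $\Lambda$ is m-accretive, and $\Lambda^{1/2}$ denotes its unique m-$(\pi/4)$-accretive square root. $B^2$ has its natural domain $\{x\in\mathcal{D}(B): Bx\in\mathcal{D}(B)\}$. A holomorphic $C_0$-semigroup of angle $\phi$ is a $C_0$-semigroup having a holomorphic continuation to the sector $\{|\arg z|<\phi\}$. *)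

theory Defs
  imports "HOL-Analysis.Analysis"
begin

section \<open>Complex Hilbert spaces\<close>

text \<open>
  The inner product is linear in the first argument. The norm, the topology and completeness are
  those of the library class \<open>banach\<close>; \<open>scaleR_scaleC\<close> and \<open>cinner_self\<close> tie them to the complex
  structure, and \<open>cinner_self\<close> also gives positive definiteness.
\<close>

class complex_hilbert = banach +
  fixes scaleC :: "complex \<Rightarrow> 'a \<Rightarrow> 'a" (infixr "*\<^sub>C" 75)
    and cinner :: "'a \<Rightarrow> 'a \<Rightarrow> complex"
  assumes scaleC_add_right: "c *\<^sub>C (x + y) = c *\<^sub>C x + c *\<^sub>C y"
    and scaleC_add_left: "(c + d) *\<^sub>C x = c *\<^sub>C x + d *\<^sub>C x"
    and scaleC_scaleC: "c *\<^sub>C (d *\<^sub>C x) = (c * d) *\<^sub>C x"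
    and scaleR_scaleC: "r *\<^sub>R x = complex_of_real r *\<^sub>C x"
    and cinner_commute: "cinner x y = cnj (cinner y x)"
    and cinner_add_left: "cinner (x + y) z = cinner x z + cinner y z"
    and cinner_scaleC_left: "cinner (c *\<^sub>C x) y = c * cinner x y"
    and cinner_self: "cinner x x = complex_of_real ((norm x)\<^sup>2)"

instantiation complex :: complex_hilbert
begin

definition scaleC_complex :: "complex \<Rightarrow> complex \<Rightarrow> complex"
  where "scaleC_complex c x = c * x"

definition cinner_complex :: "complex \<Rightarrow> complex \<Rightarrow> complex"
  where "cinner_complex x y = x * cnj y"

instance
proof
  fix c d x y z :: complex and r :: real
  show "c *\<^sub>C (x + y) = c *\<^sub>C x + c *\<^sub>C y" "(c + d) *\<^sub>C x = c *\<^sub>C x + d *\<^sub>C x"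
    "c *\<^sub>C (d *\<^sub>C x) = (c * d) *\<^sub>C x" "cinner (c *\<^sub>C x) y = c * cinner x y"
    "cinner (x + y) z = cinner x z + cinner y z"
    by (simp_all add: scaleC_complex_def cinner_complex_def algebra_simps)
  show "r *\<^sub>R x = complex_of_real r *\<^sub>C x"
    by (simp add: scaleC_complex_def scaleR_conv_of_real)
  show "cinner x y = cnj (cinner y x)"
    by (simp add: cinner_complex_def)
  show "cinner x x = complex_of_real ((norm x)\<^sup>2)"
    by (simp only: cinner_complex_def complex_norm_square)
qed

end

section \<open>Unbounded operators\<close>

text \<open>
  An operator in \<open>'a\<close> is a partial function \<open>T :: 'a \<rightharpoonup> 'a\<close> with domain \<open>dom T\<close>, so that equality
  of operators includes equality of domains. The composition \<open>T \<circ>\<^sub>m T\<close> is the square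
  of \<open>T\<close> with its natural domain. The value \<open>T \<cdot> x\<close> is meaningful only for \<open>x \<in> dom T\<close>.
\<close>

definition op_app :: "('a \<rightharpoonup> 'a) \<Rightarrow> 'a \<Rightarrow> 'a" (infixr "\<cdot>" 80)
  where "T \<cdot> x = the (T x)"

definition linear_op :: "('a::complex_hilbert \<rightharpoonup> 'a) \<Rightarrow> bool"
  where "linear_op T \<longleftrightarrow>
    0 \<in> dom T \<and>
    (\<forall>x\<in>dom T. \<forall>y\<in>dom T. x + y \<in> dom T \<and> T \<cdot> (x + y) = T \<cdot> x + T \<cdot> y) \<and>
    (\<forall>c. \<forall>x\<in>dom T. c *\<^sub>C x \<in> dom T \<and> T \<cdot> (c *\<^sub>C x) = c *\<^sub>C (T \<cdot> x))"

text \<open>The domain of the sum is \<open>dom S \<inter> dom T\<close>.\<close>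

definition op_add :: "('a::complex_hilbert \<rightharpoonup> 'a) \<Rightarrow> ('a \<rightharpoonup> 'a) \<Rightarrow> ('a \<rightharpoonup> 'a)"
  where "op_add S T = (\<lambda>x. if x \<in> dom S \<inter> dom T then Some (S \<cdot> x + T \<cdot> x) else None)"

definition op_uminus :: "('a::complex_hilbert \<rightharpoonup> 'a) \<Rightarrow> ('a \<rightharpoonup> 'a)"
  where "op_uminus T = (\<lambda>x. map_option uminus (T x))"

definition null_space :: "('a::complex_hilbert \<rightharpoonup> 'a) \<Rightarrow> 'a set"
  where "null_space T = {x \<in> dom T. T \<cdot> x = 0}"

definition accretive :: "('a::complex_hilbert \<rightharpoonup> 'a) \<Rightarrow> bool"
  where "accretive T \<longleftrightarrow> linear_op T \<and> (\<forall>x\<in>dom T. Re (cinner (T \<cdot> x) x) \<ge> 0)"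

definition m_accretive :: "('a::complex_hilbert \<rightharpoonup> 'a) \<Rightarrow> bool"
  where "m_accretive T \<longleftrightarrow>
    accretive T \<and> closure (dom T) = UNIV \<and>
    (\<exists>l>0. (\<lambda>x. l *\<^sub>R x + T \<cdot> x) ` dom T = UNIV)"

text \<open>
  The next two notions are meant for \<open>0 \<le> \<omega> < \<pi>/2\<close>. For \<open>\<omega> = 0\<close> the first one only says that the
  numerical range is real; for \<open>\<omega> > 0\<close> it implies accretivity.
\<close>

definition angle_accretive :: "real \<Rightarrow> ('a::complex_hilbert \<rightharpoonup> 'a) \<Rightarrow> bool"
  where "angle_accretive \<omega> T \<longleftrightarrow>
    linear_op T \<and>
    (\<forall>x\<in>dom T. \<bar>Im (cinner (T \<cdot> x) x)\<bar> \<le> tan \<omega> * Re (cinner (T \<cdot> x) x))"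

definition m_angle_accretive :: "real \<Rightarrow> ('a::complex_hilbert \<rightharpoonup> 'a) \<Rightarrow> bool"
  where "m_angle_accretive \<omega> T \<longleftrightarrow> angle_accretive \<omega> T \<and> m_accretive T"

text \<open>The square root is meant for m-accretive \<open>T\<close>; for these it exists and is unique.\<close>

definition op_sqrt :: "('a::complex_hilbert \<rightharpoonup> 'a) \<Rightarrow> ('a \<rightharpoonup> 'a)"
  where "op_sqrt T = (THE S. m_angle_accretive (pi / 4) S \<and> S \<circ>\<^sub>m S = T)"

section \<open>Semigroups\<close>

text \<open>
  The type \<open>'a \<Rightarrow>\<^sub>L 'a\<close> consists of the bounded real-linear maps with the operator norm, so
  complex homogeneity is a separate requirement.
\<close>

definition complex_homogeneous :: "('a::complex_hilbert \<Rightarrow>\<^sub>L 'a) \<Rightarrow> bool"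
  where "complex_homogeneous A \<longleftrightarrow>
    (\<forall>c x. blinfun_apply A (c *\<^sub>C x) = c *\<^sub>C blinfun_apply A x)"

definition c0_semigroup :: "(real \<Rightarrow> ('a::complex_hilbert \<Rightarrow>\<^sub>L 'a)) \<Rightarrow> bool"
  where "c0_semigroup T \<longleftrightarrow>
    (\<forall>t\<ge>0. complex_homogeneous (T t)) \<and>
    T 0 = id_blinfun \<and>
    (\<forall>s\<ge>0. \<forall>t\<ge>0. T (s + t) = T s o\<^sub>L T t) \<and>
    (\<forall>x. ((\<lambda>t. blinfun_apply (T t) x) \<longlongrightarrow> x) (at_right 0))"

text \<open>The domain of the generator consists of those \<open>x\<close> for which the limit exists.\<close>

definition generator :: "(real \<Rightarrow> ('a::complex_hilbert \<Rightarrow>\<^sub>L 'a)) \<Rightarrow> ('a \<rightharpoonup> 'a)"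
  where "generator T = (\<lambda>x.
    let q = (\<lambda>h. (blinfun_apply (T h) x - x) /\<^sub>R h)
    in if \<exists>y. (q \<longlongrightarrow> y) (at_right 0) then Some (Lim (at_right 0) q) else None)"

definition sector :: "real \<Rightarrow> complex set"
  where "sector \<phi> = {z. z \<noteq> 0 \<and> \<bar>Arg z\<bar> < \<phi>}"

text \<open>
  Complex differentiability in the operator norm, expressed as Frechet differentiability with a
  complex-linear derivative \<open>h \<mapsto> h T'(z)\<close>.
\<close>

definition op_holomorphic_on :: "(complex \<Rightarrow> ('a::complex_hilbert \<Rightarrow>\<^sub>L 'a)) \<Rightarrow> complex set \<Rightarrow> bool"
  where "op_holomorphic_on T U \<longleftrightarrow>
    (\<forall>z\<in>U. \<exists>T'. (T has_derivative T') (at z) \<and>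
      (\<forall>h x. blinfun_apply (T' h) x = h *\<^sub>C blinfun_apply (T' 1) x))"

text \<open>
  The semigroup on \<open>[0, \<infinity>)\<close> is the restriction of \<open>T\<close> to the nonnegative reals; the values of
  \<open>T\<close> outside the sector and \<open>0\<close> are irrelevant.
\<close>

definition holomorphic_c0_semigroup ::
    "real \<Rightarrow> (complex \<Rightarrow> ('a::complex_hilbert \<Rightarrow>\<^sub>L 'a)) \<Rightarrow> bool"
  where "holomorphic_c0_semigroup \<phi> T \<longleftrightarrow>
    c0_semigroup (\<lambda>t. T (complex_of_real t)) \<and>
    (\<forall>z\<in>sector \<phi>. complex_homogeneous (T z)) \<and>
    op_holomorphic_on T (sector \<phi>)"

definition generates_holomorphic_c0_semigroup ::
    "('a::complex_hilbert \<rightharpoonup> 'a) \<Rightarrow> real \<Rightarrow> (complex \<Rightarrow> ('a \<Rightarrow>\<^sub>L 'a)) \<Rightarrow> bool"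
  where "generates_holomorphic_c0_semigroup A \<phi> T \<longleftrightarrow>
    holomorphic_c0_semigroup \<phi> T \<and> generator (\<lambda>t. T (complex_of_real t)) = A"

end

theory Submission
  imports Defs "HOL-Complex_Analysis.Cauchy_Integral_Formula"
begin

text \<open>
  Write \<open>A\<close> for the square root of \<open>\<Lambda>\<close>. The operator \<open>A + B\<close> is treated as a perturbation of
  \<open>A\<close> by \<open>B\<close>. A perturbation theorem (\<open>m_accretive_perturbation\<close>) says that \<open>A + B\<close> is m-accretive
  as soon as \<open>A\<close> is m-accretive, \<open>B\<close> is accretive and defined on the domain of \<open>A\<close>, and
  \<open>Re \<langle>A x, B x\<rangle>\<close> is bounded below by \<open>- b \<bar>A x\<bar>\<^sup>2\<close>, with \<open>b < 1\<close>, up to lower order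
  terms. The same theorem, applied to \<open>B\<^sup>2\<close> and \<open>C\<close>, shows that \<open>\<Lambda>\<close> is m-accretive, so that \<open>A\<close>
  exists. By uniqueness of accretive square roots, \<open>B\<close> is the square root of \<open>B\<^sup>2\<close>; hence both \<open>A\<close>
  and \<open>B\<close> have numerical ranges in the sector of half-angle \<open>\<pi>/4\<close>, and so has \<open>A + B\<close>.

  What remains is a lower bound for \<open>Re \<langle>A x, B x\<rangle>\<close>. The hypothesis on \<open>C\<close> gives, by completing a
  square, \<open>Re \<langle>A\<^sup>2 x, B\<^sup>2 x\<rangle> \<ge> - c \<bar>x\<bar>\<^sup>2\<close>. The squares are removed one after the other. If \<open>S\<close> is
  sectorial, \<open>G\<close> is accretive and \<open>u t = exp (- t S) x\<close>, then
  \<open>(d/dt) Re \<langle>S u, G u\<rangle> = - Re \<langle>S\<^sup>2 u, G u\<rangle> - Re \<langle>S u, G S u\<rangle> \<le> - Re \<langle>S\<^sup>2 u, G u\<rangle>\<close>,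
  so a lower bound for \<open>Re \<langle>S\<^sup>2 x, G x\<rangle>\<close> implies one for \<open>Re \<langle>S x, G x\<rangle>\<close>: integrate from 0 to 1, where
  the value is controlled by \<open>\<bar>x\<bar>\<^sup>2\<close> because the semigroup is holomorphic
  (\<open>mixed_form_lower_bound\<close>). This is used with \<open>S = A\<close>, \<open>G = B\<^sup>2\<close> and then with \<open>S = B\<close>, \<open>G = A\<close>.

  Two pieces of theory carry this argument. The square root of an m-accretive \<open>T\<close> is constructed
  from the Cayley transform \<open>V = (T - 1) (T + 1)\<^sup>-\<^sup>1\<close>, a contraction, as
  \<open>(1 + V)\<^bsup>1/2\<^esup> (1 - V)\<^bsup>-1/2\<^esup>\<close> with the two roots given by binomial series; the sector condition is
  proved by deforming \<open>V\<close> to 0 (\<open>sqrt_series_angle\<close>). The holomorphic semigroup of a sectorial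
  operator is the limit of the exponentials of its Yosida approximations, with holomorphy in
  operator norm coming from Cauchy's estimates (\<open>S_differentiable\<close>).

  The statement on null spaces follows from the sector condition: \<open>(A + B) x = 0\<close> forces
  \<open>Re \<langle>A x, x\<rangle> = Re \<langle>B x, x\<rangle> = 0\<close>, and a form with values in a pointed sector can vanish at \<open>x\<close> only if
  the operator does (\<open>sectorial_form_eq_0\<close>).
\<close>

section \<open>Complex inner product spaces\<close>

lemma cinner_add_right: "cinner x (y + z) = cinner x y + cinner x (z::'a::complex_hilbert)"
  by (metis cinner_commute cinner_add_left complex_cnj_add)

lemma cinner_scaleC_right: "cinner x (c *\<^sub>C y) = cnj c * cinner x (y::'a::complex_hilbert)"
  by (metis cinner_commute cinner_scaleC_left complex_cnj_mult)

lemma scaleC_one [simp]: "1 *\<^sub>C x = (x::'a::complex_hilbert)"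
  using scaleR_scaleC[of 1 x] by simp

lemma scaleC_zero_right [simp]: "c *\<^sub>C 0 = (0::'a::complex_hilbert)"
  using scaleC_add_right[of c 0 "0::'a"] by simp

lemma scaleC_zero_left [simp]: "0 *\<^sub>C x = (0::'a::complex_hilbert)"
  using scaleR_scaleC[of 0 x] by simp

lemma scaleC_minus_right: "c *\<^sub>C (- x) = - (c *\<^sub>C (x::'a::complex_hilbert))"
  using scaleC_add_right[of c x "- x"] by (simp add: eq_neg_iff_add_eq_0 add.commute)

lemma scaleC_minus_left: "(- c) *\<^sub>C x = - (c *\<^sub>C (x::'a::complex_hilbert))"
  using scaleC_add_left[of "- c" c x] by (simp add: eq_neg_iff_add_eq_0)

lemma scaleC_diff_right: "c *\<^sub>C (x - y) = c *\<^sub>C x - c *\<^sub>C (y::'a::complex_hilbert)"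
  using scaleC_add_right[of c x "- y"] by (simp add: scaleC_minus_right)

lemma scaleC_diff_left: "(c - d) *\<^sub>C x = c *\<^sub>C x - d *\<^sub>C (x::'a::complex_hilbert)"
  using scaleC_add_left[of c "- d" x] by (simp add: scaleC_minus_left)

lemma cinner_zero_left [simp]: "cinner 0 (x::'a::complex_hilbert) = 0"
  using cinner_scaleC_left[of 0 x x] by simp

lemma cinner_zero_right [simp]: "cinner (x::'a::complex_hilbert) 0 = 0"
  using cinner_scaleC_right[of x 0 x] by simp

lemma cinner_minus_left: "cinner (- x) y = - cinner x (y::'a::complex_hilbert)"
  using cinner_add_left[of x "- x" y] by (simp add: eq_neg_iff_add_eq_0 add.commute)

lemma cinner_minus_right: "cinner x (- y) = - cinner x (y::'a::complex_hilbert)"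
  using cinner_add_right[of x y "- y"] by (simp add: eq_neg_iff_add_eq_0 add.commute)

lemma cinner_diff_left: "cinner (x - y) z = cinner x z - cinner y (z::'a::complex_hilbert)"
  using cinner_add_left[of x "- y" z] by (simp add: cinner_minus_left)

lemma cinner_diff_right: "cinner x (y - z) = cinner x y - cinner x (z::'a::complex_hilbert)"
  using cinner_add_right[of x y "- z"] by (simp add: cinner_minus_right)

lemma cinner_scaleR_left: "cinner (r *\<^sub>R x) y = of_real r * cinner x (y::'a::complex_hilbert)"
  by (simp add: scaleR_scaleC cinner_scaleC_left)

lemma cinner_scaleR_right: "cinner x (r *\<^sub>R y) = of_real r * cinner x (y::'a::complex_hilbert)"
  by (simp add: scaleR_scaleC cinner_scaleC_right)

lemmas cinner_simps = cinner_add_left cinner_add_right cinner_diff_left cinner_diff_right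
  cinner_minus_left cinner_minus_right cinner_scaleC_left cinner_scaleC_right
  cinner_scaleR_left cinner_scaleR_right

lemma Re_cinner_self: "Re (cinner x x) = (norm (x::'a::complex_hilbert))\<^sup>2"
  by (simp add: cinner_self)

lemma Re_cinner_commute: "Re (cinner x y) = Re (cinner y (x::'a::complex_hilbert))"
  by (metis cinner_commute complex_cnj(1) cnj.simps(1))

lemma norm_add_squared:
  "(norm (x + y))\<^sup>2 = (norm x)\<^sup>2 + (norm y)\<^sup>2 + 2 * Re (cinner x (y::'a::complex_hilbert))"
  by (simp add: Re_cinner_self [symmetric] cinner_simps Re_cinner_commute[of y x])

lemma norm_diff_squared:
  "(norm (x - y))\<^sup>2 = (norm x)\<^sup>2 + (norm y)\<^sup>2 - 2 * Re (cinner x (y::'a::complex_hilbert))"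
  by (simp add: Re_cinner_self [symmetric] cinner_simps Re_cinner_commute[of y x])

lemma norm_scaleC: "norm (c *\<^sub>C x) = cmod c * norm (x::'a::complex_hilbert)"
proof -
  have "complex_of_real ((norm (c *\<^sub>C x))\<^sup>2) = (c * cnj c) * cinner x x"
    by (simp add: cinner_self[symmetric] cinner_simps mult_ac del: of_real_power)
  also have "\<dots> = complex_of_real ((cmod c * norm x)\<^sup>2)"
    by (simp add: cinner_self power_mult_distrib complex_norm_square [symmetric])
  finally have "(norm (c *\<^sub>C x))\<^sup>2 = (cmod c * norm x)\<^sup>2"
    using of_real_eq_iff by blast
  thus ?thesis by (simp add: power2_eq_iff_nonneg)
qed

lemma Re_cinner_le: "Re (cinner x y) \<le> norm x * norm (y::'a::complex_hilbert)"
proof (cases "norm x = 0 \<or> norm y = 0")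
  case False
  hence *: "norm x > 0" "norm y > 0" by auto
  have "0 \<le> (norm (norm y *\<^sub>R x - norm x *\<^sub>R y))\<^sup>2" by simp
  also have "\<dots> = 2 * (norm x * norm y) * (norm x * norm y - Re (cinner x y))"
    unfolding norm_diff_squared by (simp add: cinner_simps power2_eq_square algebra_simps)
  finally show ?thesis using mult_pos_pos[OF *] by (simp add: zero_le_mult_iff)
qed auto

lemma Cauchy_Schwarz: "cmod (cinner x y) \<le> norm x * norm (y::'a::complex_hilbert)"
proof (cases "cinner x y = 0")
  case False
  define c where "c = cnj (sgn (cinner x y))"
  have "c * cinner x y = cmod (cinner x y)"
    using False complex_norm_square[of "cinner x y"]
    by (simp add: c_def sgn_eq field_simps power2_eq_square)
  hence "cmod (cinner x y) = Re (cinner (c *\<^sub>C x) y)"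
    by (simp add: cinner_simps)
  also have "\<dots> \<le> norm x * norm y"
    using Re_cinner_le[of "c *\<^sub>C x" y] False by (simp add: norm_scaleC c_def norm_sgn)
  finally show ?thesis .
qed simp

lemma Re_cinner_ge: "Re (cinner x y) \<ge> - (norm x * norm (y::'a::complex_hilbert))"
  using Re_cinner_le[of "- x" y] by (simp add: cinner_simps)

lemma bounded_bilinear_cinner:
  "bounded_bilinear (cinner :: 'a::complex_hilbert \<Rightarrow> 'a \<Rightarrow> complex)"
proof
  show "\<exists>K. \<forall>a b::'a. norm (cinner a b) \<le> norm a * norm b * K"
    by (rule exI[of _ 1]) (simp add: Cauchy_Schwarz)
qed (simp_all add: cinner_simps scaleR_conv_of_real)

lemma bounded_bilinear_scaleC:
  "bounded_bilinear (scaleC :: complex \<Rightarrow> 'a \<Rightarrow> 'a::complex_hilbert)"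
proof
  show "\<exists>K. \<forall>a (b::'a). norm (a *\<^sub>C b) \<le> norm a * norm b * K"
    by (rule exI[of _ 1]) (simp add: norm_scaleC)
qed (simp_all add: scaleC_add_left scaleC_add_right scaleC_scaleC
    scaleR_conv_of_real[where 'a = complex] scaleR_scaleC[where 'a = 'a] mult.commute)

lemmas tendsto_cinner = bounded_bilinear.tendsto[OF bounded_bilinear_cinner]
lemmas tendsto_scaleC = bounded_bilinear.tendsto[OF bounded_bilinear_scaleC]

lemma dense_sequence:
  fixes x :: "'a::real_normed_vector"
  assumes "closure D = UNIV"
  obtains v where "\<And>n. v n \<in> D" "v \<longlonglongrightarrow> x"
  using assms closure_sequential[of x D] by auto

text \<open>Approximating \<open>- z\<close> by elements of the dense set gives \<open>- \<bar>z\<bar>\<^sup>2 \<ge> 0\<close>.\<close>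

lemma orthogonal_dense_eq_0:
  fixes z :: "'a::complex_hilbert"
  assumes "closure D = UNIV" "\<And>v. v \<in> D \<Longrightarrow> Re (cinner z v) \<ge> 0"
  shows "z = 0"
proof -
  obtain v where v: "\<And>n. v n \<in> D" "v \<longlonglongrightarrow> - z" using dense_sequence[OF assms(1)] by blast
  have "(\<lambda>n. Re (cinner z (v n))) \<longlonglongrightarrow> Re (cinner z (- z))"
    by (intro tendsto_Re tendsto_cinner tendsto_const v)
  moreover have "0 \<le> Re (cinner z (v n))" for n using assms(2) v(1) by blast
  ultimately have "0 \<le> Re (cinner z (- z))" by (intro LIMSEQ_le_const) auto
  thus ?thesis by (simp add: cinner_simps Re_cinner_self)
qed

text \<open>
  Banach's fixed point theorem for \<open>g \<mapsto> f - K g\<close>; it plays the role of the Neumann series.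
\<close>

lemma contraction_solvable:
  fixes K :: "'a::banach \<Rightarrow> 'a"
  assumes "\<And>x y. norm (K x - K y) \<le> q * norm (x - y)" "0 \<le> q" "q < 1"
  obtains g where "g + K g = f"
proof -
  have "\<exists>!g. f - K g = g"
    using assms by (intro banach_fix_type[of q]) (auto simp: dist_norm norm_minus_commute)
  then obtain g where "f - K g = g" by auto
  thus ?thesis by (intro that[of g]) (metis diff_add_cancel)
qed

section \<open>Accretive operators and their resolvents\<close>

declare domIff [iff del]

lemma dom_square: "dom (T \<circ>\<^sub>m T) = {x \<in> dom T. T \<cdot> x \<in> dom T}"
  by (auto simp: map_comp_def op_app_def domIff split: option.splits)

lemma square_app: "x \<in> dom T \<Longrightarrow> (T \<circ>\<^sub>m T) \<cdot> x = T \<cdot> (T \<cdot> x)"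
  by (auto simp: map_comp_def op_app_def domIff split: option.splits)

lemma dom_op_add [simp]: "dom (op_add S T) = dom S \<inter> dom T"
  by (auto simp: op_add_def dom_def split: if_splits)

lemma op_add_app: "x \<in> dom S \<Longrightarrow> x \<in> dom T \<Longrightarrow> op_add S T \<cdot> x = S \<cdot> x + T \<cdot> x"
  by (simp add: op_add_def op_app_def)

lemma op_eqI:
  assumes "dom S = dom T" "\<And>x. x \<in> dom S \<Longrightarrow> S \<cdot> x = T \<cdot> x"
  shows "S = T"
proof
  fix x show "S x = T x"
    using assms(1) assms(2)[of x] by (metis domIff op_app_def option.expand)
qed

context
  fixes T :: "'a::complex_hilbert \<rightharpoonup> 'a"
  assumes lin: "linear_op T"
begin

lemma linear_op_zero: "0 \<in> dom T" "T \<cdot> 0 = 0"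
proof -
  show *: "0 \<in> dom T" using lin by (simp add: linear_op_def)
  have "T \<cdot> (0 *\<^sub>C 0) = 0 *\<^sub>C (T \<cdot> 0)" using lin * unfolding linear_op_def by blast
  thus "T \<cdot> 0 = 0" by simp
qed

lemma linear_op_add:
  "x \<in> dom T \<Longrightarrow> y \<in> dom T \<Longrightarrow> x + y \<in> dom T"
  "x \<in> dom T \<Longrightarrow> y \<in> dom T \<Longrightarrow> T \<cdot> (x + y) = T \<cdot> x + T \<cdot> y"
  using lin by (auto simp: linear_op_def)

lemma linear_op_scaleC:
  "x \<in> dom T \<Longrightarrow> c *\<^sub>C x \<in> dom T"
  "x \<in> dom T \<Longrightarrow> T \<cdot> (c *\<^sub>C x) = c *\<^sub>C (T \<cdot> x)"
  using lin by (auto simp: linear_op_def)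

lemma linear_op_minus:
  assumes "x \<in> dom T"
  shows "- x \<in> dom T" "T \<cdot> (- x) = - (T \<cdot> x)"
  using linear_op_scaleC[OF assms, of "-1"] by (auto simp: scaleC_minus_left)

lemma linear_op_diff:
  assumes "x \<in> dom T" "y \<in> dom T"
  shows "x - y \<in> dom T" "T \<cdot> (x - y) = T \<cdot> x - T \<cdot> y"
  using linear_op_add[OF assms(1) linear_op_minus(1)[OF assms(2)]]
  by (auto simp: linear_op_minus assms)

lemma linear_op_scaleR:
  "x \<in> dom T \<Longrightarrow> r *\<^sub>R x \<in> dom T"
  "x \<in> dom T \<Longrightarrow> T \<cdot> (r *\<^sub>R x) = r *\<^sub>R (T \<cdot> x)"
  by (auto simp: scaleR_scaleC linear_op_scaleC)

end

lemmas linear_op_intros = linear_op_zero(1) linear_op_add(1) linear_op_scaleC(1)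
  linear_op_minus(1) linear_op_diff(1) linear_op_scaleR(1)

lemmas linear_op_simps = linear_op_zero(2) linear_op_add(2) linear_op_scaleC(2)
  linear_op_minus(2) linear_op_diff(2) linear_op_scaleR(2)

lemma linear_op_op_add:
  assumes "linear_op S" "linear_op T" shows "linear_op (op_add S T)"
  unfolding linear_op_def
  by (auto simp: op_add_app linear_op_simps linear_op_intros assms scaleC_add_right)

lemma accretive_linear: "accretive T \<Longrightarrow> linear_op T"
  by (simp add: accretive_def)

lemma accretiveD: "accretive T \<Longrightarrow> x \<in> dom T \<Longrightarrow> 0 \<le> Re (cinner (T \<cdot> x) x)"
  by (simp add: accretive_def)

lemma m_accretive_accretive: "m_accretive T \<Longrightarrow> accretive T"
  and m_accretive_dense: "m_accretive T \<Longrightarrow> closure (dom T) = UNIV"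
  by (simp_all add: m_accretive_def)

lemma m_accretive_linear: "m_accretive T \<Longrightarrow> linear_op T"
  by (simp add: m_accretive_def accretive_def)

lemma accretive_op_add:
  assumes "accretive S" "accretive T" shows "accretive (op_add S T)"
  using assms unfolding accretive_def
  by (auto simp: linear_op_op_add op_add_app cinner_simps)

lemma accretive_norm_ge:
  assumes "accretive T" "x \<in> dom T"
  shows "Re z * norm x \<le> norm (T \<cdot> x + z *\<^sub>C x)"
proof (cases "x = 0")
  case False
  have "Re z * (norm x)\<^sup>2 \<le> Re (cinner (T \<cdot> x + z *\<^sub>C x) x)"
    using accretiveD[OF assms] by (simp add: cinner_simps cinner_self)
  also have "\<dots> \<le> norm (T \<cdot> x + z *\<^sub>C x) * norm x" by (rule Re_cinner_le)
  finally show ?thesis using False by (simp add: power2_eq_square)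
qed simp

definition shift_onto :: "('a::complex_hilbert \<rightharpoonup> 'a) \<Rightarrow> complex \<Rightarrow> bool"
  where "shift_onto T z \<longleftrightarrow> (\<forall>f. \<exists>x\<in>dom T. T \<cdot> x + z *\<^sub>C x = f)"

text \<open>
  The sign is the one natural for accretive operators: \<open>resolvent T z\<close> is \<open>(T + z)\<^sup>-\<^sup>1\<close>, to be used for
  \<open>Re z > 0\<close>.
\<close>

definition resolvent :: "('a::complex_hilbert \<rightharpoonup> 'a) \<Rightarrow> complex \<Rightarrow> 'a \<Rightarrow> 'a"
  where "resolvent T z f = (SOME x. x \<in> dom T \<and> T \<cdot> x + z *\<^sub>C x = f)"

lemma resolvent:
  assumes "shift_onto T z"
  shows resolvent_dom: "resolvent T z f \<in> dom T"
    and resolvent_eq: "T \<cdot> resolvent T z f + z *\<^sub>C resolvent T z f = f"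
proof -
  have "\<exists>x. x \<in> dom T \<and> T \<cdot> x + z *\<^sub>C x = f" using assms by (auto simp: shift_onto_def)
  from someI_ex[OF this] show "resolvent T z f \<in> dom T"
    "T \<cdot> resolvent T z f + z *\<^sub>C resolvent T z f = f"
    by (auto simp: resolvent_def)
qed

lemma resolvent_app:
  "shift_onto T z \<Longrightarrow> T \<cdot> resolvent T z f = f - z *\<^sub>C resolvent T z f"
  by (metis resolvent_eq add_diff_cancel_right')

lemma shift_injective:
  assumes "accretive T" "Re z > 0" "x \<in> dom T" "y \<in> dom T"
    "T \<cdot> x + z *\<^sub>C x = T \<cdot> y + z *\<^sub>C y"
  shows "x = y"
proof -
  note l = accretive_linear[OF assms(1)]
  have "Re z * norm (x - y) \<le> norm (T \<cdot> (x - y) + z *\<^sub>C (x - y))"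
    by (intro accretive_norm_ge linear_op_diff l assms)
  also have "T \<cdot> (x - y) + z *\<^sub>C (x - y) = (T \<cdot> x + z *\<^sub>C x) - (T \<cdot> y + z *\<^sub>C y)"
    by (simp add: linear_op_diff[OF l] scaleC_diff_right assms(3,4))
  also have "\<dots> = 0" by (simp only: assms(5) diff_self)
  finally show ?thesis using assms(2) by (simp add: mult_le_0_iff)
qed

lemma resolvent_unique:
  assumes "accretive T" "shift_onto T z" "Re z > 0" "x \<in> dom T"
  shows "resolvent T z (T \<cdot> x + z *\<^sub>C x) = x"
  by (intro shift_injective[OF assms(1,3) _ assms(4)] resolvent_dom resolvent_eq assms(2))

lemma
  assumes "accretive T" "shift_onto T z" "Re z > 0"
  shows resolvent_add: "resolvent T z (f + g) = resolvent T z f + resolvent T z g"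
    and resolvent_scaleC: "resolvent T z (c *\<^sub>C f) = c *\<^sub>C resolvent T z f"
    and resolvent_norm: "norm (resolvent T z f) \<le> norm f / Re z"
proof -
  note l = accretive_linear[OF assms(1)]
  note r = resolvent[OF assms(2)]
  have "T \<cdot> (resolvent T z f + resolvent T z g) + z *\<^sub>C (resolvent T z f + resolvent T z g)
      = (T \<cdot> resolvent T z f + z *\<^sub>C resolvent T z f) + (T \<cdot> resolvent T z g + z *\<^sub>C resolvent T z g)"
    by (simp add: linear_op_add[OF l] r(1) scaleC_add_right)
  also have "\<dots> = f + g" by (simp only: r(2))
  finally show "resolvent T z (f + g) = resolvent T z f + resolvent T z g"
    using resolvent_unique[OF assms, of "resolvent T z f + resolvent T z g"]
    by (simp only: linear_op_add[OF l] r(1))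
  have "T \<cdot> (c *\<^sub>C resolvent T z f) + z *\<^sub>C c *\<^sub>C resolvent T z f
      = c *\<^sub>C (T \<cdot> resolvent T z f + z *\<^sub>C resolvent T z f)"
    by (simp add: linear_op_scaleC[OF l] r(1) scaleC_add_right scaleC_scaleC mult.commute)
  also have "\<dots> = c *\<^sub>C f" by (simp only: r(2))
  finally show "resolvent T z (c *\<^sub>C f) = c *\<^sub>C resolvent T z f"
    using resolvent_unique[OF assms, of "c *\<^sub>C resolvent T z f"]
    by (simp only: linear_op_scaleC[OF l] r(1))
  show "norm (resolvent T z f) \<le> norm f / Re z"
    using accretive_norm_ge[OF assms(1) r(1)[of f], of z] r(2)[of f] assms(3)
    by (simp add: field_simps)
qed

lemma resolvent_diff:
  assumes "accretive T" "shift_onto T z" "Re z > 0"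
  shows "resolvent T z (f - g) = resolvent T z f - resolvent T z g"
  using resolvent_add[OF assms, of "f - g" g] by (simp add: algebra_simps)

lemma bounded_linear_resolvent:
  assumes "accretive T" "shift_onto T z" "Re z > 0"
  shows "bounded_linear (resolvent T z)"
  by (rule bounded_linear_intro[where K = "1 / Re z"])
    (use resolvent_norm[OF assms] in
      \<open>auto simp: resolvent_add[OF assms] resolvent_scaleC[OF assms] scaleR_scaleC\<close>)

text \<open>
  \<open>T + w = (1 + (w - z) (T + z)\<^sup>-\<^sup>1) (T + z)\<close>, and the resolvent at \<open>z\<close> has norm at most \<open>1 / Re z\<close>.
\<close>

lemma shift_onto_near:
  assumes "accretive T" "shift_onto T z" "cmod (w - z) < Re z"
  shows "shift_onto T w"
  unfolding shift_onto_def
proof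
  fix f
  have z: "Re z > 0" using assms(3) norm_ge_zero[of "w - z"] by linarith
  define K where "K g = (w - z) *\<^sub>C resolvent T z g" for g
  obtain g where g: "g + K g = f"
  proof (rule contraction_solvable[of K "cmod (w - z) / Re z" f])
    show "norm (K x - K y) \<le> cmod (w - z) / Re z * norm (x - y)" for x y
    proof -
      have "norm (K x - K y) = cmod (w - z) * norm (resolvent T z (x - y))"
        by (simp add: K_def resolvent_diff[OF assms(1,2) z] norm_scaleC flip: scaleC_diff_right)
      also have "\<dots> \<le> cmod (w - z) * (norm (x - y) / Re z)"
        by (intro mult_left_mono resolvent_norm assms z) auto
      finally show ?thesis by simp
    qed
  qed (use z assms(3) in auto)
  have "T \<cdot> resolvent T z g + w *\<^sub>C resolvent T z g
      = T \<cdot> resolvent T z g + z *\<^sub>C resolvent T z g + K g"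
    by (simp add: K_def scaleC_diff_left)
  thus "\<exists>x\<in>dom T. T \<cdot> x + w *\<^sub>C x = f"
    using resolvent[OF assms(2), of g] g by (intro bexI[of _ "resolvent T z g"]) auto
qed

text \<open>
  The segment from \<open>z\<close> to \<open>w\<close> keeps a positive distance \<open>\<rho>\<close> to the imaginary axis, so it can be
  covered by finitely many steps of length less than \<open>\<rho>\<close>.
\<close>

lemma shift_onto_transfer:
  assumes "accretive T" "shift_onto T z" "Re z > 0" "Re w > 0"
  shows "shift_onto T w"
proof -
  define \<rho> where "\<rho> = min (Re z) (Re w)"
  have \<rho>: "\<rho> > 0" using assms by (simp add: \<rho>_def)
  obtain N :: nat where N: "cmod (w - z) / \<rho> < real N" using reals_Archimedean2 by blast
  hence N0: "N > 0"
    using \<rho> by (metis divide_nonneg_pos gr0I norm_ge_zero not_less of_nat_0)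
  define p where "p k = z + of_real (real k / real N) * (w - z)" for k
  have "shift_onto T (p k)" if "k \<le> N" for k
    using that
  proof (induction k)
    case 0 show ?case using assms by (simp add: p_def)
  next
    case (Suc k)
    have "p (Suc k) - p k = of_real (1 / real N) * (w - z)"
      by (simp add: p_def algebra_simps add_divide_distrib)
    hence "cmod (p (Suc k) - p k) = cmod (w - z) / real N"
      using N0 by (simp add: norm_mult norm_divide)
    also have "\<dots> < \<rho>" using N N0 \<rho> by (simp add: field_simps)
    also have "\<rho> \<le> Re (p k)"
    proof -
      define t where "t = real k / real N"
      have t: "0 \<le> t" "t \<le> 1" using Suc.prems N0 by (auto simp: t_def)
      have "\<rho> = (1 - t) * \<rho> + t * \<rho>" by (simp add: algebra_simps)
      also have "\<dots> \<le> (1 - t) * Re z + t * Re w"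
        using t by (intro add_mono mult_left_mono) (auto simp: \<rho>_def)
      also have "\<dots> = Re (p k)" by (simp add: p_def t_def[symmetric] algebra_simps)
      finally show ?thesis .
    qed
    finally show ?case using Suc shift_onto_near[OF assms(1), of "p k" "p (Suc k)"] by simp
  qed
  from this[of N] show ?thesis using N0 by (simp add: p_def)
qed

lemma m_accretive_shift_onto:
  assumes "m_accretive T" "Re z > 0"
  shows "shift_onto T z"
proof -
  obtain l where l: "l > 0" "(\<lambda>x. l *\<^sub>R x + T \<cdot> x) ` dom T = UNIV"
    using assms(1) by (auto simp: m_accretive_def)
  have "shift_onto T (of_real l)"
    unfolding shift_onto_def
  proof
    fix f
    have "f \<in> (\<lambda>x. l *\<^sub>R x + T \<cdot> x) ` dom T" using l(2) by simp
    thus "\<exists>x\<in>dom T. T \<cdot> x + of_real l *\<^sub>C x = f"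
      by (auto simp: scaleR_scaleC add.commute)
  qed
  thus ?thesis
    by (rule shift_onto_transfer[OF m_accretive_accretive[OF assms(1)]]) (use l(1) assms(2) in auto)
qed

lemma m_accretiveI:
  assumes "accretive T" "closure (dom T) = UNIV" "shift_onto T z" "Re z > 0"
  shows "m_accretive T"
proof -
  have s: "shift_onto T 1" using shift_onto_transfer[OF assms(1,3,4), of 1] by simp
  have "(\<lambda>x. 1 *\<^sub>R x + T \<cdot> x) ` dom T = UNIV"
  proof safe
    fix f
    have "f = 1 *\<^sub>R resolvent T 1 f + T \<cdot> resolvent T 1 f"
      using resolvent_eq[OF s, of f] by (simp add: add.commute)
    thus "f \<in> (\<lambda>x. 1 *\<^sub>R x + T \<cdot> x) ` dom T" using resolvent_dom[OF s] by blast
  qed simp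
  thus ?thesis using assms unfolding m_accretive_def by (intro conjI exI[of _ 1]) auto
qed

lemma m_accretive_closed:
  assumes "m_accretive T" "\<And>n. x n \<in> dom T" "x \<longlonglongrightarrow> u" "(\<lambda>n. T \<cdot> x n) \<longlonglongrightarrow> v"
  shows "u \<in> dom T" "T \<cdot> u = v"
proof -
  note a = m_accretive_accretive[OF assms(1)]
  have s: "shift_onto T 1" using m_accretive_shift_onto[OF assms(1), of 1] by simp
  have "(\<lambda>n. resolvent T 1 (T \<cdot> x n + 1 *\<^sub>C x n)) \<longlonglongrightarrow> resolvent T 1 (v + 1 *\<^sub>C u)"
    by (intro bounded_linear.tendsto[OF bounded_linear_resolvent[OF a s]] tendsto_add
        tendsto_scaleC tendsto_const assms(3,4)) simp
  moreover have "resolvent T 1 (T \<cdot> x n + 1 *\<^sub>C x n) = x n" for n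
    by (rule resolvent_unique[OF a s _ assms(2)]) simp
  ultimately have "x \<longlonglongrightarrow> resolvent T 1 (v + u)" by simp
  hence u: "u = resolvent T 1 (v + u)" by (rule LIMSEQ_unique[OF assms(3)])
  show "u \<in> dom T" using u resolvent_dom[OF s] by metis
  show "T \<cdot> u = v" using resolvent_app[OF s, of "v + u"] u[symmetric] by simp
qed

text \<open>
  \<open>T + 1\<close> is injective and already its restriction \<open>S + 1\<close> is onto.
\<close>

lemma m_accretive_maximal:
  assumes "m_accretive S" "accretive T" "dom S \<subseteq> dom T" "\<And>x. x \<in> dom S \<Longrightarrow> T \<cdot> x = S \<cdot> x"
  shows "T = S"
proof (rule op_eqI)
  have s: "shift_onto S 1" using m_accretive_shift_onto[OF assms(1), of 1] by simp
  show "dom T = dom S"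
  proof (rule subset_antisym[OF subsetI assms(3)])
    fix x assume x: "x \<in> dom T"
    define y where "y = resolvent S 1 (T \<cdot> x + 1 *\<^sub>C x)"
    have y: "y \<in> dom S" "S \<cdot> y + 1 *\<^sub>C y = T \<cdot> x + 1 *\<^sub>C x"
      unfolding y_def by (rule resolvent_dom[OF s], rule resolvent_eq[OF s])
    have "y \<in> dom T" using y(1) assms(3) by blast
    moreover have "T \<cdot> x + 1 *\<^sub>C x = T \<cdot> y + 1 *\<^sub>C y"
      by (simp only: assms(4)[OF y(1)] y(2))
    ultimately have "x = y" by (intro shift_injective[OF assms(2) _ x, of 1]) simp_all
    thus "x \<in> dom S" using y by simp
  qed
  thus "\<And>x. x \<in> dom T \<Longrightarrow> T \<cdot> x = S \<cdot> x" using assms(4) by simp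
qed

text \<open>
  The factorisation \<open>(S + z) (S - z) = S\<^sup>2 - z\<^sup>2\<close> transfers the range condition from the square to
  its root: the point \<open>z\<close> must lie in the right half-plane and \<open>- z\<^sup>2\<close> as well, so its argument
  is taken strictly between \<open>\<pi>/4\<close> and \<open>\<pi>/2\<close>.
\<close>

lemma m_accretive_root:
  assumes "accretive S" "m_accretive (S \<circ>\<^sub>m S)"
  shows "m_accretive S"
proof -
  note l = accretive_linear[OF assms(1)]
  define z where "z = Complex 1 2"
  have "Re (- z\<^sup>2) > 0" by (simp add: z_def power2_eq_square)
  hence s: "shift_onto (S \<circ>\<^sub>m S) (- z\<^sup>2)" by (rule m_accretive_shift_onto[OF assms(2)])
  have "shift_onto S z"
    unfolding shift_onto_def
  proof
    fix f
    define x where "x = resolvent (S \<circ>\<^sub>m S) (- z\<^sup>2) f"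
    have x: "x \<in> dom S" "S \<cdot> x \<in> dom S" "S \<cdot> S \<cdot> x + (- z\<^sup>2) *\<^sub>C x = f"
      using resolvent[OF s, of f] unfolding x_def[symmetric] by (auto simp: dom_square square_app)
    show "\<exists>y\<in>dom S. S \<cdot> y + z *\<^sub>C y = f"
    proof
      show "S \<cdot> x - z *\<^sub>C x \<in> dom S" by (intro linear_op_intros l x)
      have "S \<cdot> (S \<cdot> x - z *\<^sub>C x) = S \<cdot> S \<cdot> x - z *\<^sub>C (S \<cdot> x)"
        by (simp only: linear_op_diff(2)[OF l x(2) linear_op_scaleC(1)[OF l x(1)]]
            linear_op_scaleC(2)[OF l x(1)])
      moreover have "z *\<^sub>C (S \<cdot> x - z *\<^sub>C x) = z *\<^sub>C (S \<cdot> x) + (- z\<^sup>2) *\<^sub>C x"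
        by (simp add: scaleC_diff_right scaleC_scaleC scaleC_minus_left power2_eq_square)
      ultimately show "S \<cdot> (S \<cdot> x - z *\<^sub>C x) + z *\<^sub>C (S \<cdot> x - z *\<^sub>C x) = f"
        using x(3) by (simp del: minus_mult_left)
    qed
  qed
  moreover have "closure (dom S) = UNIV"
  proof -
    have "dom (S \<circ>\<^sub>m S) \<subseteq> dom S" by (auto simp: dom_square)
    thus ?thesis using closure_mono m_accretive_dense[OF assms(2)] by blast
  qed
  ultimately show ?thesis by (intro m_accretiveI[OF assms(1), of z]) (simp_all add: z_def)
qed

section \<open>Relative boundedness and perturbation\<close>

text \<open>
  The usual proof by category and successive approximation. An everywhere defined closable operator
  is closed, so the hypothesis is only needed for sequences tending to 0.
\<close>

lemma closed_graph:
  fixes M :: "'a::banach \<Rightarrow> 'b::banach"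
  assumes "linear M"
    and closable: "\<And>x z. x \<longlonglongrightarrow> 0 \<Longrightarrow> (\<lambda>n. M (x n)) \<longlonglongrightarrow> z \<Longrightarrow> z = 0"
  obtains K where "K > 0" "\<And>x. norm (M x) \<le> K * norm x"
proof -
  interpret M: linear M by fact
  define E where "E n = {x. norm (M x) \<le> real n}" for n
  \<comment> \<open>By Baire, the closure of one of the sets \<open>E n\<close> has an interior point.\<close>
  have "\<exists>n. interior (closure (E n)) \<noteq> {}"
  proof (rule ccontr)
    assume "\<not> ?thesis"
    hence "Met_TC.mtopology interior_of \<Union>(range (\<lambda>n. closure (E n))) = {}"
      by (intro Met_TC.metric_Baire_category_alt) (auto simp: complete_UNIV)
    moreover have "\<Union>(range (\<lambda>n. closure (E n))) = UNIV"
    proof safe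
      fix x
      obtain n where "norm (M x) \<le> real n" using real_arch_simple by blast
      thus "x \<in> \<Union>(range (\<lambda>n. closure (E n)))"
        using closure_subset[of "E n"] by (auto simp: E_def)
    qed simp
    ultimately show False by simp
  qed
  then obtain n p e where e: "e > 0" "ball p e \<subseteq> closure (E n)"
    by (meson interior_subset open_contains_ball open_interior subset_trans ex_in_conv)
  define c where "c = 2 * real n"
  \<comment> \<open>Differences of points near \<open>p\<close> approximate all small vectors.\<close>
  have approx: "\<exists>y. norm (x - y) < d \<and> norm (M y) \<le> c" if "norm x < e" "d > 0" for x d
  proof -
    have "p + x \<in> closure (E n)" "p \<in> closure (E n)" using e that by (auto simp: dist_norm subset_iff)
    then obtain u v where uv: "u \<in> E n" "dist u (p + x) < d / 2" "v \<in> E n" "dist v p < d / 2"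
      using \<open>d > 0\<close> unfolding closure_approachable by (meson half_gt_zero)
    have "norm (x - (u - v)) \<le> norm (p + x - u) + norm (v - p)"
      using norm_triangle_ineq[of "p + x - u" "v - p"] by (simp add: algebra_simps)
    hence "norm (x - (u - v)) < d"
      using uv by (simp add: dist_norm norm_minus_commute)
    moreover have "norm (M (u - v)) \<le> c"
      using norm_triangle_ineq4[of "M u" "M v"] uv by (simp add: M.diff E_def c_def)
    ultimately show ?thesis by blast
  qed
  define q where "q k = e * (1/2) ^ k" for k :: nat
  have q0: "q k > 0" for k using e by (simp add: q_def)
  have scaled: "\<exists>y. norm (x - y) < q (Suc k) \<and> norm (M y) \<le> c * (1/2) ^ k"
    if "norm x < q k" for x k
  proof -
    have "norm (2 ^ k *\<^sub>R x) < e" using that by (simp add: q_def power_divide field_simps)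
    then obtain y where y: "norm (2 ^ k *\<^sub>R x - y) < e / 2" "norm (M y) \<le> c"
      using approx e by (metis half_gt_zero)
    have "norm (x - (1/2) ^ k *\<^sub>R y) = norm ((1/2) ^ k *\<^sub>R (2 ^ k *\<^sub>R x - y))"
      by (simp add: scaleR_diff_right power_divide)
    also have "\<dots> = (1/2) ^ k * norm (2 ^ k *\<^sub>R x - y)" by simp
    also have "\<dots> < (1/2) ^ k * (e / 2)" using y by (intro mult_strict_left_mono) auto
    finally have "norm (x - (1/2) ^ k *\<^sub>R y) < q (Suc k)" by (simp add: q_def mult_ac)
    moreover have "norm (M ((1/2) ^ k *\<^sub>R y)) \<le> c * (1/2) ^ k"
      using y(2) by (simp add: M.scaleR power_divide divide_right_mono)
    ultimately show ?thesis by blast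
  qed
  have bound: "norm (M x) \<le> 2 * c" if x: "norm x < e" for x
  proof -
    define f where "f k r = (SOME y. norm (r - y) < q (Suc k) \<and> norm (M y) \<le> c * (1/2) ^ k)" for k r
    define r where "r = rec_nat x (\<lambda>k r. r - f k r)"
    have r_simps: "r 0 = x" "r (Suc k) = r k - f k (r k)" for k by (simp_all add: r_def)
    have f: "norm (r - f k r) < q (Suc k)" "norm (M (f k r)) \<le> c * (1/2) ^ k" if "norm r < q k" for r k
      using someI_ex[OF scaled[OF that]] by (auto simp: f_def)
    have rq: "norm (r k) < q k" for k
      by (induction k) (use x f in \<open>auto simp: r_simps q_def\<close>)
    have "(\<lambda>k. q k) \<longlonglongrightarrow> 0" unfolding q_def by (intro tendsto_mult_right_zero LIMSEQ_power_zero) auto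
    hence r0: "r \<longlonglongrightarrow> 0"
      by (rule Lim_null_comparison[rotated]) (simp add: rq less_imp_le)
    have Mf: "norm (M (f k (r k))) \<le> c * (1/2) ^ k" for k using f rq by blast
    have gs: "summable (\<lambda>k. c * (1/2::real) ^ k)" by (intro summable_mult summable_geometric) auto
    have sm: "summable (\<lambda>k. M (f k (r k)))" by (rule summable_comparison_test'[OF gs]) (use Mf in auto)
    have part: "M (r k) = M x - (\<Sum>i<k. M (f i (r i)))" for k
      by (induction k) (simp_all add: r_simps M.diff)
    have "(\<lambda>k. M (r k)) \<longlonglongrightarrow> M x - (\<Sum>k. M (f k (r k)))"
      unfolding part by (intro tendsto_intros summable_LIMSEQ sm)
    hence "M x = (\<Sum>k. M (f k (r k)))" using closable[OF r0] by fastforce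
    also have "norm \<dots> \<le> (\<Sum>k. c * (1/2) ^ k)"
      by (rule norm_suminf_le[OF Mf gs])
    also have "\<dots> = 2 * c" by (subst suminf_mult) (auto simp: suminf_geometric intro!: summable_geometric)
    finally show ?thesis .
  qed
  show ?thesis
  proof (rule that[of "4 * c / e + 1"])
    have c0: "c \<ge> 0" by (simp add: c_def)
    thus "4 * c / e + 1 > 0" using e by (simp add: add_nonneg_pos)
    fix x
    show "norm (M x) \<le> (4 * c / e + 1) * norm x"
    proof (cases "x = 0")
      case False
      define t where "t = e / (2 * norm x)"
      have t: "t > 0" using e False by (simp add: t_def)
      have "norm (M (t *\<^sub>R x)) \<le> 2 * c" by (rule bound) (use e False in \<open>simp add: t_def\<close>)
      hence "norm (M x) \<le> 2 * c / t" using t by (simp add: M.scaleR field_simps)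
      also have "\<dots> = (4 * c / e) * norm x" using e False by (simp add: t_def)
      also have "\<dots> \<le> (4 * c / e + 1) * norm x" by (intro mult_right_mono) auto
      finally show ?thesis .
    qed (simp add: M.zero)
  qed
qed

text \<open>
  Accretivity of a densely defined operator makes it closable: if \<open>w n\<close> tends to 0 and \<open>C (w n)\<close>
  tends to \<open>z\<close>, then accretivity at \<open>w n + t v\<close> gives \<open>Re \<langle>z + t C v, t v\<rangle> \<ge> 0\<close> for all
  \<open>t > 0\<close>, hence \<open>Re \<langle>z, v\<rangle> \<ge> 0\<close> on a dense set. The closed graph theorem then applies to \<open>C\<close>
  composed with a resolvent.
\<close>

lemma accretive_relatively_bounded:
  fixes A :: "'a::complex_hilbert \<rightharpoonup> 'a"
  assumes A: "m_accretive A" and C: "accretive C" and dom: "dom A \<subseteq> dom C"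
  obtains K where "K > 0" "\<And>x. x \<in> dom A \<Longrightarrow> norm (C \<cdot> x) \<le> K * (norm (A \<cdot> x) + norm x)"
proof -
  note lC = accretive_linear[OF C] and aA = m_accretive_accretive[OF A]
  have s: "shift_onto A 1" using m_accretive_shift_onto[OF A, of 1] by simp
  define R where "R = resolvent A 1"
  have RC: "R f \<in> dom C" for f using resolvent_dom[OF s] dom by (auto simp: R_def)
  interpret R: bounded_linear R unfolding R_def by (rule bounded_linear_resolvent[OF aA s]) simp
  have lin: "linear (\<lambda>f. C \<cdot> R f)"
    by (rule linearI) (simp_all add: R.add R.scaleR linear_op_simps[OF lC] RC)
  obtain K where K: "K > 0" "\<And>f. norm (C \<cdot> R f) \<le> K * norm f"
  proof (rule closed_graph[OF lin])
    fix x :: "nat \<Rightarrow> 'a" and z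
    assume x: "x \<longlonglongrightarrow> 0" and z: "(\<lambda>n. C \<cdot> R (x n)) \<longlonglongrightarrow> z"
    have Rx: "(\<lambda>n. R (x n)) \<longlonglongrightarrow> 0" using R.tendsto[OF x] by (simp add: R.zero)
    show "z = 0"
    proof (rule orthogonal_dense_eq_0[OF m_accretive_dense[OF A]])
      fix v assume "v \<in> dom A"
      hence v: "v \<in> dom C" using dom by auto
      have *: "0 \<le> Re (cinner z v) + t * Re (cinner (C \<cdot> v) v)" if t: "t > 0" for t :: real
      proof -
        have "(\<lambda>n. Re (cinner (C \<cdot> R (x n) + t *\<^sub>R (C \<cdot> v)) (R (x n) + t *\<^sub>R v)))
            \<longlonglongrightarrow> Re (cinner (z + t *\<^sub>R (C \<cdot> v)) (0 + t *\<^sub>R v))"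
          by (intro tendsto_Re tendsto_cinner tendsto_add tendsto_const z Rx)
        moreover have "0 \<le> Re (cinner (C \<cdot> R (x n) + t *\<^sub>R (C \<cdot> v)) (R (x n) + t *\<^sub>R v))" for n
          using accretiveD[OF C, of "R (x n) + t *\<^sub>R v"]
          by (simp add: linear_op_simps[OF lC] linear_op_intros[OF lC] RC v)
        ultimately have "0 \<le> Re (cinner (z + t *\<^sub>R (C \<cdot> v)) (0 + t *\<^sub>R v))"
          by (intro LIMSEQ_le_const) auto
        also have "\<dots> = t * (Re (cinner z v) + t * Re (cinner (C \<cdot> v) v))"
          by (simp add: cinner_simps algebra_simps)
        finally show ?thesis using t by (simp add: zero_le_mult_iff)
      qed
      have "((\<lambda>t. Re (cinner z v) + t * Re (cinner (C \<cdot> v) v)) \<longlongrightarrow>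
          Re (cinner z v) + 0 * Re (cinner (C \<cdot> v) v)) (at_right 0)"
        by (intro tendsto_intros)
      thus "0 \<le> Re (cinner z v)"
        by (intro tendsto_lowerbound[where F = "at_right (0::real)"])
          (use * in \<open>auto simp: eventually_at_right_less intro: eventually_at_right_less[THEN eventually_mono]\<close>)
    qed
  qed blast
  show ?thesis
  proof (rule that[OF K(1)])
    fix x assume x: "x \<in> dom A"
    have "C \<cdot> x = C \<cdot> R (A \<cdot> x + 1 *\<^sub>C x)"
      unfolding R_def by (subst resolvent_unique[OF aA s _ x]) auto
    also have "norm \<dots> \<le> K * norm (A \<cdot> x + 1 *\<^sub>C x)" by (rule K)
    also have "\<dots> \<le> K * (norm (A \<cdot> x) + norm x)"
      using K(1) by (intro mult_left_mono) (auto intro: norm_triangle_ineq)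
    finally show "norm (C \<cdot> x) \<le> K * (norm (A \<cdot> x) + norm x)" .
  qed
qed

lemma quadratic_bound:
  fixes s p n a e :: real
  assumes "e * s\<^sup>2 \<le> s * p + a * n\<^sup>2" "0 < e" "0 \<le> a" "0 \<le> n" "0 \<le> p" "0 \<le> s"
  shows "s \<le> p / e + sqrt (a / e) * n"
proof (rule ccontr)
  assume "\<not> ?thesis"
  hence s: "s > p / e + sqrt (a / e) * n" by simp
  have h: "sqrt (a / e) * n \<ge> 0" "p / e \<ge> 0" using assms by auto
  have "s > sqrt (a / e) * n" "s > 0" using s h by linarith+
  have "s * (s - p / e) > (sqrt (a / e) * n) * (sqrt (a / e) * n)"
    using s h by (intro mult_strict_mono') auto
  also have "(sqrt (a / e) * n) * (sqrt (a / e) * n) = a / e * n\<^sup>2"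
    using assms by (simp add: power2_eq_square algebra_simps)
  finally have "e * (s * (s - p / e)) > e * (a / e * n\<^sup>2)"
    using assms(2) by (intro mult_strict_left_mono)
  moreover have "e * (s * (s - p / e)) = e * s\<^sup>2 - s * p" "e * (a / e * n\<^sup>2) = a * n\<^sup>2"
    using assms(2) by (simp_all add: power2_eq_square algebra_simps)
  ultimately show False using assms(1) by linarith
qed

text \<open>
  The perturbation theorem is proved by continuity in \<open>t\<close> along \<open>A + t C\<close>, \<open>0 \<le> t \<le> 1\<close>. The lower
  bound on \<open>Re \<langle>A x, C x\<rangle>\<close> controls \<open>A x\<close> by \<open>(A + t C) x\<close> and \<open>x\<close> with a constant that does not
  depend on \<open>t\<close>, so that steps of a fixed length are possible.
\<close>

lemma perturbation_estimate:
  fixes A C :: "'a::complex_hilbert \<rightharpoonup> 'a"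
  assumes "0 \<le> a" "0 \<le> b" "b < 1" "0 \<le> d" "0 \<le> t" "t \<le> 1"
    and "Re (cinner (A \<cdot> x) (C \<cdot> x))
        \<ge> - a * (norm x)\<^sup>2 - b * (norm (A \<cdot> x))\<^sup>2 - d * norm (A \<cdot> x) * norm x"
  shows "norm (A \<cdot> x) \<le> (1 / (1 - b) + (d / (1 - b) + sqrt (a / (1 - b))))
    * (norm (A \<cdot> x + t *\<^sub>R (C \<cdot> x)) + norm x)"
proof -
  let ?s = "norm (A \<cdot> x)" and ?p = "norm (A \<cdot> x + t *\<^sub>R (C \<cdot> x))" and ?n = "norm x"
  have "t * (- Re (cinner (A \<cdot> x) (C \<cdot> x))) \<le> t * (a * ?n\<^sup>2 + b * ?s\<^sup>2 + d * ?s * ?n)"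
    using assms by (intro mult_left_mono) auto
  also have "\<dots> \<le> 1 * (a * ?n\<^sup>2 + b * ?s\<^sup>2 + d * ?s * ?n)"
    using assms by (intro mult_right_mono) auto
  finally have 1: "- t * Re (cinner (A \<cdot> x) (C \<cdot> x)) \<le> a * ?n\<^sup>2 + b * ?s\<^sup>2 + d * ?s * ?n" by simp
  have "?s\<^sup>2 + t * Re (cinner (A \<cdot> x) (C \<cdot> x)) = Re (cinner (A \<cdot> x) (A \<cdot> x + t *\<^sub>R (C \<cdot> x)))"
    by (simp add: cinner_simps Re_cinner_self)
  also have "\<dots> \<le> ?s * ?p" by (rule Re_cinner_le)
  finally have "(1 - b) * ?s\<^sup>2 \<le> ?s * (?p + d * ?n) + a * ?n\<^sup>2"
    using 1 by (simp add: algebra_simps)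
  hence "?s \<le> (?p + d * ?n) / (1 - b) + sqrt (a / (1 - b)) * ?n"
    using assms by (intro quadratic_bound) auto
  also have "\<dots> = 1 / (1 - b) * ?p + (d / (1 - b) + sqrt (a / (1 - b))) * ?n"
    by (simp add: add_divide_distrib algebra_simps)
  also have "\<dots> \<le> (1 / (1 - b) + (d / (1 - b) + sqrt (a / (1 - b)))) * (?p + ?n)"
  proof -
    have "k * p + l * n \<le> (k + l) * (p + n)" if "k \<ge> 0" "l \<ge> 0" "p \<ge> 0" "n \<ge> 0" for k l p n :: real
      using that by (simp add: algebra_simps)
    from this[of "1 / (1 - b)" "d / (1 - b) + sqrt (a / (1 - b))" ?p ?n]
    show ?thesis using assms(1-4) by simp
  qed
  finally show ?thesis .
qed

theorem m_accretive_perturbation: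
  fixes A C :: "'a::complex_hilbert \<rightharpoonup> 'a"
  assumes A: "m_accretive A" and C: "accretive C" and dom: "dom A \<subseteq> dom C"
    and c: "0 \<le> a" "0 \<le> b" "b < 1" "0 \<le> d"
    and lower: "\<And>x. x \<in> dom A \<Longrightarrow> Re (cinner (A \<cdot> x) (C \<cdot> x))
        \<ge> - a * (norm x)\<^sup>2 - b * (norm (A \<cdot> x))\<^sup>2 - d * norm (A \<cdot> x) * norm x"
  shows "m_accretive (op_add A C)"
proof -
  note aA = m_accretive_accretive[OF A]
  note lA = accretive_linear[OF aA] and lC = accretive_linear[OF C]
  define S where "S t = (\<lambda>x. if x \<in> dom A then Some (A \<cdot> x + t *\<^sub>R (C \<cdot> x)) else None)" for t :: real
  have domS: "dom (S t) = dom A" for t by (auto simp: S_def domIff split: if_splits)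
  have S: "S t \<cdot> x = A \<cdot> x + t *\<^sub>R (C \<cdot> x)" if "x \<in> dom A" for x t
    using that by (simp add: S_def op_app_def)
  have dC: "x \<in> dom C" if "x \<in> dom A" for x using that dom by auto
  have aS: "accretive (S t)" if "t \<ge> 0" for t
  proof -
    have "linear_op (S t)"
      unfolding linear_op_def domS
      by (auto simp: S dC linear_op_simps[OF lA] linear_op_simps[OF lC] linear_op_intros[OF lA]
          scaleC_add_right scaleR_add_right scaleR_scaleC scaleC_scaleC mult.commute)
    thus ?thesis
      using that accretiveD[OF aA] accretiveD[OF C]
      by (auto simp: accretive_def domS S dC cinner_simps)
  qed
  define K1 where "K1 = 1 / (1 - b) + (d / (1 - b) + sqrt (a / (1 - b)))"
  have K1: "norm (A \<cdot> x) \<le> K1 * (norm (S t \<cdot> x) + norm x)" if "x \<in> dom A" "0 \<le> t" "t \<le> 1" for x t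
    unfolding S[OF that(1)] K1_def by (rule perturbation_estimate[OF c that(2,3) lower[OF that(1)]])
  have K1_nonneg: "K1 \<ge> 0" using c by (simp add: K1_def)
  obtain K2 where K2: "K2 > 0" "\<And>x. x \<in> dom A \<Longrightarrow> norm (C \<cdot> x) \<le> K2 * (norm (A \<cdot> x) + norm x)"
    using accretive_relatively_bounded[OF A C dom] by blast
  define K where "K = K2 * (3 * K1 + 1)"
  have K: "K > 0" using K2(1) K1_nonneg by (simp add: K_def)
  have CR: "norm (C \<cdot> resolvent (S t) 1 g) \<le> K * norm g" if t: "0 \<le> t" "t \<le> 1" "shift_onto (S t) 1" for t g
  proof -
    define x where "x = resolvent (S t) 1 g"
    have x: "x \<in> dom A" "norm x \<le> norm g" "S t \<cdot> x = g - x"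
      using resolvent_dom[OF t(3), of g] resolvent_norm[OF aS[OF t(1)] t(3), of g]
        resolvent_app[OF t(3), of g] by (simp_all add: x_def domS)
    have "norm (S t \<cdot> x) \<le> 2 * norm g" using norm_triangle_ineq4[of g x] x by simp
    hence "norm (A \<cdot> x) \<le> K1 * (3 * norm g)"
      using K1[OF x(1) t(1,2)] x(2) K1_nonneg by (smt (verit) mult_left_mono)
    hence "norm (C \<cdot> x) \<le> K2 * (K1 * (3 * norm g) + norm g)"
      using K2(2)[OF x(1)] x(2) K2(1) by (smt (verit) mult_left_mono)
    thus ?thesis by (simp add: x_def K_def algebra_simps)
  qed
  have step: "shift_onto (S (t + h)) 1" if t: "0 \<le> t" "t \<le> 1" "shift_onto (S t) 1" "0 \<le> h" "h * K \<le> 1 / 2" for t h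
    unfolding shift_onto_def
  proof
    fix f
    let ?R = "resolvent (S t) 1"
    have R: "?R g \<in> dom A" for g using resolvent_dom[OF t(3)] by (simp add: domS)
    obtain g where g: "g + h *\<^sub>R (C \<cdot> ?R g) = f"
    proof (rule contraction_solvable[of "\<lambda>g. h *\<^sub>R (C \<cdot> ?R g)" "1 / 2" f])
      fix x y
      have "norm (h *\<^sub>R (C \<cdot> ?R x) - h *\<^sub>R (C \<cdot> ?R y)) = h * norm (C \<cdot> ?R (x - y))"
        using t(4) by (simp add: resolvent_diff[OF aS[OF t(1)] t(3)] linear_op_diff[OF lC] dC R
            flip: scaleR_diff_right)
      also have "\<dots> \<le> h * (K * norm (x - y))" using t CR by (intro mult_left_mono) auto
      also have "\<dots> \<le> 1 / 2 * norm (x - y)" using mult_right_mono[OF t(5), of "norm (x - y)"] by (simp add: mult.assoc)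
      finally show "norm (h *\<^sub>R (C \<cdot> ?R x) - h *\<^sub>R (C \<cdot> ?R y)) \<le> 1 / 2 * norm (x - y)" .
    qed auto
    have "S (t + h) \<cdot> ?R g + 1 *\<^sub>C ?R g = (S t \<cdot> ?R g + 1 *\<^sub>C ?R g) + h *\<^sub>R (C \<cdot> ?R g)"
      by (simp add: S R scaleR_add_left)
    also have "\<dots> = f" by (simp only: resolvent_eq[OF t(3)] g)
    finally show "\<exists>x\<in>dom (S (t + h)). S (t + h) \<cdot> x + 1 *\<^sub>C x = f" using R by (auto simp: domS)
  qed
  obtain N :: nat where N: "2 * K < real N" using reals_Archimedean2 by blast
  have N0: "real N > 0" using N K by linarith
  have "shift_onto (S (real k / real N)) 1" if "k \<le> N" for k
    using that
  proof (induction k)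
    case 0
    have "S 0 = A" by (rule op_eqI) (auto simp: domS S)
    thus ?case using m_accretive_shift_onto[OF A, of 1] by simp
  next
    case (Suc k)
    have "shift_onto (S (real k / real N + 1 / real N)) 1"
      using Suc N N0 by (intro step) (auto simp: field_simps)
    thus ?case by (simp add: add_divide_distrib add.commute)
  qed
  from this[of N] have "shift_onto (S 1) 1" using N0 by simp
  moreover have "S 1 = op_add A C" using dom by (intro op_eqI) (auto simp: domS S op_add_app)
  moreover have "dom (op_add A C) = dom A" using dom by auto
  ultimately show ?thesis
    using m_accretive_dense[OF A]
    by (intro m_accretiveI[OF accretive_op_add[OF aA C], of 1]) auto
qed

section \<open>The Banach algebra of bounded complex-linear operators\<close>

text \<open>
  On the trivial space the identity operator has norm 0, which is incompatible with the class
  \<open>real_normed_algebra_1\<close>. A second real coordinate, with pointwise operations and the maximum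
  norm, gives the unit norm 1 in all cases.
\<close>

typedef (overloaded) 'a bop =
  "{p :: ('a::complex_hilbert \<Rightarrow>\<^sub>L 'a) \<times> real. complex_homogeneous (fst p)}"
  by (rule exI[of _ 0]) (simp add: complex_homogeneous_def)

setup_lifting type_definition_bop

definition op_of :: "'a::complex_hilbert bop \<Rightarrow> 'a \<Rightarrow>\<^sub>L 'a" where "op_of X = fst (Rep_bop X)"
definition sc_of :: "'a::complex_hilbert bop \<Rightarrow> real" where "sc_of X = snd (Rep_bop X)"

lemma bop_eqI: "op_of X = op_of Y \<Longrightarrow> sc_of X = sc_of Y \<Longrightarrow> X = Y"
  by (simp add: op_of_def sc_of_def Rep_bop_inject[symmetric] prod_eq_iff)

lemma op_of_homogeneous: "complex_homogeneous (op_of X)"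
  using Rep_bop[of X] by (simp add: op_of_def)

instantiation bop :: (complex_hilbert) real_normed_algebra_1
begin

lift_definition zero_bop :: "'a bop" is "(0, 0)" by (simp add: complex_homogeneous_def)
lift_definition one_bop :: "'a bop" is "(id_blinfun, 1)" by (simp add: complex_homogeneous_def)
lift_definition plus_bop :: "'a bop \<Rightarrow> 'a bop \<Rightarrow> 'a bop"
  is "\<lambda>p q. (fst p + fst q, snd p + snd q)"
  by (simp add: complex_homogeneous_def blinfun.add_left scaleC_add_right)
lift_definition minus_bop :: "'a bop \<Rightarrow> 'a bop \<Rightarrow> 'a bop"
  is "\<lambda>p q. (fst p - fst q, snd p - snd q)"
  by (simp add: complex_homogeneous_def blinfun.diff_left scaleC_diff_right)
lift_definition uminus_bop :: "'a bop \<Rightarrow> 'a bop" is "\<lambda>p. (- fst p, - snd p)"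
  by (simp add: complex_homogeneous_def blinfun.minus_left scaleC_minus_right)
lift_definition times_bop :: "'a bop \<Rightarrow> 'a bop \<Rightarrow> 'a bop"
  is "\<lambda>p q. (fst p o\<^sub>L fst q, snd p * snd q)"
  by (simp add: complex_homogeneous_def)
lift_definition scaleR_bop :: "real \<Rightarrow> 'a bop \<Rightarrow> 'a bop" is "\<lambda>r p. (r *\<^sub>R fst p, r * snd p)"
  by (simp add: complex_homogeneous_def blinfun.scaleR_left scaleR_scaleC scaleC_scaleC mult.commute)

definition norm_bop :: "'a bop \<Rightarrow> real" where "norm X = max (norm (op_of X)) \<bar>sc_of X\<bar>"
definition dist_bop :: "'a bop \<Rightarrow> 'a bop \<Rightarrow> real" where "dist_bop X Y = norm (X - Y)"
definition sgn_bop :: "'a bop \<Rightarrow> 'a bop" where "sgn_bop X = scaleR (inverse (norm X)) X"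
definition uniformity_bop :: "('a bop \<times> 'a bop) filter"
  where "uniformity_bop = (INF e\<in>{0<..}. principal {(X, Y). dist X Y < e})"
definition open_bop :: "'a bop set \<Rightarrow> bool"
  where "open_bop U \<longleftrightarrow> (\<forall>x\<in>U. eventually (\<lambda>(x', y). x' = x \<longrightarrow> y \<in> U) uniformity)"

lemma bop_coords [simp]:
  "op_of (0::'a bop) = 0" "op_of (1::'a bop) = id_blinfun"
  "op_of (X + Y) = op_of X + op_of (Y::'a bop)" "op_of (X - Y) = op_of X - op_of (Y::'a bop)"
  "op_of (- X) = - op_of (X::'a bop)" "op_of (X * Y) = op_of X o\<^sub>L op_of (Y::'a bop)"
  "op_of (r *\<^sub>R X) = r *\<^sub>R op_of (X::'a bop)"
  "sc_of (0::'a bop) = 0" "sc_of (1::'a bop) = 1"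
  "sc_of (X + Y) = sc_of X + sc_of (Y::'a bop)" "sc_of (X - Y) = sc_of X - sc_of (Y::'a bop)"
  "sc_of (- X) = - sc_of (X::'a bop)" "sc_of (X * Y) = sc_of X * sc_of (Y::'a bop)"
  "sc_of (r *\<^sub>R X) = r * sc_of (X::'a bop)"
  by (simp_all add: op_of_def sc_of_def zero_bop.rep_eq one_bop.rep_eq plus_bop.rep_eq
      minus_bop.rep_eq uminus_bop.rep_eq times_bop.rep_eq scaleR_bop.rep_eq)

instance
proof
  fix X Y Z :: "'a bop" and r s :: real
  show "norm (X + Y) \<le> norm X + norm Y"
    using norm_triangle_ineq[of "op_of X" "op_of Y"] by (auto simp: norm_bop_def)
  show "norm (X * Y) \<le> norm X * norm Y"
  proof -
    have "norm (op_of X o\<^sub>L op_of Y) \<le> norm (op_of X) * norm (op_of Y)" by (rule norm_blinfun_compose)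
    also have "\<dots> \<le> norm X * norm Y" by (intro mult_mono) (auto simp: norm_bop_def)
    finally have "norm (op_of X o\<^sub>L op_of Y) \<le> norm X * norm Y" .
    moreover have "\<bar>sc_of X * sc_of Y\<bar> \<le> norm X * norm Y"
      unfolding abs_mult by (intro mult_mono) (auto simp: norm_bop_def)
    ultimately show ?thesis by (simp add: norm_bop_def[of "X * Y"])
  qed
  show "norm (1::'a bop) = 1"
    using norm_blinfun_id_le[where 'a = 'a] by (simp add: norm_bop_def)
  show "norm (r *\<^sub>R X) = \<bar>r\<bar> * norm X" by (simp add: norm_bop_def abs_mult max_mult_distrib_left)
  show "(norm X = 0) = (X = 0)"
    by (auto simp: norm_bop_def max_def split: if_splits intro!: bop_eqI)
  show "(0::'a bop) \<noteq> 1" by (metis bop_coords(8,9) zero_neq_one)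
qed (auto simp: dist_bop_def sgn_bop_def uniformity_bop_def open_bop_def
      algebra_simps blinfun.bilinear_simps intro!: bop_eqI blinfun_eqI)

end

instance bop :: (complex_hilbert) banach
proof
  fix X :: "nat \<Rightarrow> 'a bop"
  assume X: "Cauchy X"
  have le: "norm (op_of Y) \<le> norm Y" "\<bar>sc_of Y\<bar> \<le> norm Y" for Y :: "'a bop"
    by (simp_all add: norm_bop_def)
  have "Cauchy (\<lambda>n. op_of (X n))"
    using X unfolding Cauchy_iff by (metis (no_types, lifting) bop_coords(4) le(1) order_le_less_trans)
  then obtain A where A: "(\<lambda>n. op_of (X n)) \<longlonglongrightarrow> A" using Cauchy_convergent_iff convergent_def by blast
  have "Cauchy (\<lambda>n. sc_of (X n))"
    using X unfolding Cauchy_iff real_norm_def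
    by (metis (no_types, lifting) bop_coords(11) le(2) order_le_less_trans)
  then obtain c where c: "(\<lambda>n. sc_of (X n)) \<longlonglongrightarrow> c" using Cauchy_convergent_iff convergent_def by blast
  have "complex_homogeneous A"
    unfolding complex_homogeneous_def
  proof safe
    fix z x
    have "(\<lambda>n. blinfun_apply (op_of (X n)) (z *\<^sub>C x)) \<longlonglongrightarrow> blinfun_apply A (z *\<^sub>C x)"
      by (intro blinfun.tendsto A tendsto_const)
    moreover have "(\<lambda>n. z *\<^sub>C blinfun_apply (op_of (X n)) x) \<longlonglongrightarrow> z *\<^sub>C blinfun_apply A x"
      by (intro tendsto_scaleC blinfun.tendsto A tendsto_const)
    moreover have "blinfun_apply (op_of (X n)) (z *\<^sub>C x) = z *\<^sub>C blinfun_apply (op_of (X n)) x" for n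
      using op_of_homogeneous[of "X n"] by (simp add: complex_homogeneous_def)
    ultimately show "blinfun_apply A (z *\<^sub>C x) = z *\<^sub>C blinfun_apply A x"
      using LIMSEQ_unique by auto
  qed
  then obtain L where L: "op_of L = A" "sc_of L = c"
    by (metis (mono_tags) Abs_bop_inverse fst_conv mem_Collect_eq op_of_def sc_of_def snd_conv)
  have "(\<lambda>n. max (norm (op_of (X n) - A)) \<bar>sc_of (X n) - c\<bar>) \<longlonglongrightarrow> max (norm (A - A)) \<bar>c - c\<bar>"
    by (intro tendsto_max tendsto_norm tendsto_rabs tendsto_diff A c tendsto_const)
  hence "(\<lambda>n. norm (X n - L)) \<longlonglongrightarrow> 0" by (simp add: norm_bop_def L)
  hence "X \<longlonglongrightarrow> L" using LIM_zero_iff tendsto_norm_zero_iff by blast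
  thus "convergent X" by (auto simp: convergent_def)
qed

definition bap :: "'a::complex_hilbert bop \<Rightarrow> 'a \<Rightarrow> 'a" where "bap X x = blinfun_apply (op_of X) x"

lemma bap_simps:
  "bap 0 x = 0" "bap 1 x = x" "bap (X + Y) x = bap X x + bap Y x" "bap (X - Y) x = bap X x - bap Y x"
  "bap (- X) x = - bap X x" "bap (X * Y) x = bap X (bap Y x)" "bap (r *\<^sub>R X) x = r *\<^sub>R bap X x"
  by (simp_all add: bap_def blinfun.bilinear_simps)

lemma bap_right:
  "bap X 0 = 0" "bap X (x + y) = bap X x + bap X y" "bap X (x - y) = bap X x - bap X y"
  "bap X (- x) = - bap X x" "bap X (r *\<^sub>R x) = r *\<^sub>R bap X x"
  by (simp_all add: bap_def blinfun.bilinear_simps)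

lemma bap_scaleC: "bap X (c *\<^sub>C x) = c *\<^sub>C bap X x"
  using op_of_homogeneous[of X] by (simp add: bap_def complex_homogeneous_def)

lemma norm_bap: "norm (bap X x) \<le> norm X * norm x"
proof -
  have "norm (bap X x) \<le> norm (op_of X) * norm x" unfolding bap_def by (rule norm_blinfun)
  also have "\<dots> \<le> norm X * norm x" by (intro mult_right_mono) (auto simp: norm_bop_def)
  finally show ?thesis .
qed

lemma bounded_bilinear_bap: "bounded_bilinear bap"
  by standard (auto simp: bap_simps bap_right norm_bap intro!: exI[of _ 1])

lemmas tendsto_bap = bounded_bilinear.tendsto[OF bounded_bilinear_bap]
lemmas bounded_linear_bap_left = bounded_bilinear.bounded_linear_left[OF bounded_bilinear_bap]
lemmas bounded_linear_bap_right = bounded_bilinear.bounded_linear_right[OF bounded_bilinear_bap]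

lemma bop_exists:
  fixes f :: "'a::complex_hilbert \<Rightarrow> 'a"
  assumes "\<And>x y. f (x + y) = f x + f y" "\<And>c x. f (c *\<^sub>C x) = c *\<^sub>C f x"
    "\<And>x. norm (f x) \<le> K * norm x" "K \<ge> 0"
  obtains X where "\<And>x. bap X x = f x" "norm X \<le> K" "sc_of X = 0"
proof -
  have "bounded_linear f"
    by (rule bounded_linear_intro[where K = K]) (auto simp: assms scaleR_scaleC mult.commute)
  hence b: "blinfun_apply (Blinfun f) = f" by (rule bounded_linear_Blinfun_apply)
  hence "complex_homogeneous (Blinfun f)" using assms(2) by (simp add: complex_homogeneous_def)
  then obtain X where X: "op_of X = Blinfun f" "sc_of X = 0"
    by (metis (mono_tags) Abs_bop_inverse fst_conv mem_Collect_eq op_of_def sc_of_def snd_conv)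
  have "norm (op_of X) \<le> K" using assms(3,4) b X(1) by (intro norm_blinfun_bound) auto
  thus ?thesis using that[of X] X b assms(4) by (simp add: bap_def norm_bop_def)
qed

lemma bop_commuteI: "(\<And>x. bap X (bap Y x) = bap Y (bap X x)) \<Longrightarrow> X * Y = Y * X"
  by (intro bop_eqI blinfun_eqI) (auto simp: bap_def)

text \<open>
  The second coordinate is 0 for every \<open>z\<close>, so that it vanishes for all products with a scalar as
  well.
\<close>

lift_definition bop_scalar :: "complex \<Rightarrow> 'a::complex_hilbert bop" is
  "\<lambda>z. (Blinfun (\<lambda>x. z *\<^sub>C x), 0)"
  by (simp add: complex_homogeneous_def scaleC_scaleC mult.commute
      bounded_linear_Blinfun_apply bounded_bilinear.bounded_linear_right[OF bounded_bilinear_scaleC])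

lemma bap_scalar [simp]: "bap (bop_scalar z) x = z *\<^sub>C x"
  by (simp add: bap_def op_of_def bop_scalar.rep_eq
      bounded_linear_Blinfun_apply bounded_bilinear.bounded_linear_right[OF bounded_bilinear_scaleC])

lemma sc_of_scalar [simp]: "sc_of (bop_scalar z) = 0"
  by (simp add: sc_of_def bop_scalar.rep_eq)

lemma bap_eqI: "(\<And>x. bap X x = bap Y x) \<Longrightarrow> sc_of X = sc_of Y \<Longrightarrow> X = Y"
  by (intro bop_eqI blinfun_eqI) (auto simp: bap_def)

lemma bop_scalar_add: "bop_scalar (z + w) = bop_scalar z + bop_scalar w"
  by (rule bap_eqI) (auto simp: bap_simps scaleC_add_left)

lemma bop_scalar_scaleR: "bop_scalar (r *\<^sub>R z) = r *\<^sub>R bop_scalar z"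
  by (rule bap_eqI) (auto simp: bap_simps scaleR_scaleC scaleC_scaleC scaleC_complex_def)

section \<open>The binomial series for the square root\<close>

text \<open>
  Absolute convergence on the boundary of the unit disc is what allows the series to be applied to
  contractions, and not only to operators of norm less than 1.
\<close>

lemma sum_abs_binomial_half_le: "(\<Sum>k<n. \<bar>(1/2::real) gchoose k\<bar>) \<le> 2"
proof -
  define c where "c k = \<bar>(1/2::real) gchoose k\<bar>" for k
  have rec: "real (2 * n + 2) * c (Suc n) = \<bar>2 * real n - 1\<bar> * c n" for n
  proof -
    have "(1/2 - real n) * ((1/2::real) gchoose n) = real (Suc n) * (1/2 gchoose Suc n)"
      using gbinomial_mult_1[of "1/2::real" n] by (simp add: algebra_simps)
    hence "\<bar>1/2 - real n\<bar> * c n = real (Suc n) * c (Suc n)"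
      unfolding c_def by (metis abs_mult abs_of_nat)
    moreover have "\<bar>2 * real n - 1\<bar> = 2 * \<bar>1/2 - real n\<bar>" unfolding abs_if by (auto simp: field_simps)
    moreover have "real (2 * n + 2) * c (Suc n) = 2 * (real (Suc n) * c (Suc n))"
      by (simp add: algebra_simps)
    ultimately show ?thesis by (simp only: mult.assoc)
  qed
  \<comment> \<open>By the recursion, \<open>c (Suc n)\<close> is the difference of \<open>\<bar>2 k - 1\<bar> c k\<close> at \<open>k = n\<close> and at \<open>k = n + 1\<close>, so
    that the sums telescope.\<close>
  have "(\<Sum>k<Suc n. c k) = 2 - \<bar>2 * real n - 1\<bar> * c n" for n
  proof (induction n)
    case 0 show ?case by (simp add: c_def)
  next
    case (Suc n)
    have "(\<Sum>k<Suc (Suc n). c k) = 2 - real (2 * n + 2) * c (Suc n) + c (Suc n)"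
      unfolding sum.lessThan_Suc[of c "Suc n"] Suc rec ..
    thus ?case by (simp add: algebra_simps)
  qed
  hence "(\<Sum>k<Suc n. c k) \<le> 2" for n by (simp add: c_def)
  hence "(\<Sum>k<n. c k) \<le> 2" for n by (cases n) (auto simp del: sum.lessThan_Suc)
  thus ?thesis by (simp add: c_def)
qed

lemma summable_abs_binomial_half: "summable (\<lambda>k. \<bar>(1/2::real) gchoose k\<bar>)"
  by (rule summableI_nonneg_bounded[OF _ sum_abs_binomial_half_le]) simp

definition sqrt_series :: "'a::{real_normed_algebra_1, banach} \<Rightarrow> 'a"
  where "sqrt_series X = (\<Sum>k. ((1/2) gchoose k) *\<^sub>R X ^ k)"

lemma norm_sqrt_series_term:
  fixes X :: "'a::{real_normed_algebra_1, banach}"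
  assumes "norm X \<le> 1"
  shows "norm (((1/2) gchoose k) *\<^sub>R X ^ k) \<le> \<bar>(1/2::real) gchoose k\<bar>"
proof -
  have "norm (X ^ k) \<le> 1" using norm_power_ineq[of X k] power_le_one[OF _ assms, of k] by simp
  thus ?thesis by (simp add: mult_left_le)
qed

lemma summable_sqrt_series:
  fixes X :: "'a::{real_normed_algebra_1, banach}"
  assumes "norm X \<le> 1"
  shows "summable (\<lambda>k. norm (((1/2) gchoose k) *\<^sub>R X ^ k))"
    "summable (\<lambda>k. ((1/2) gchoose k) *\<^sub>R X ^ k)"
proof -
  show *: "summable (\<lambda>k. norm (((1/2) gchoose k) *\<^sub>R X ^ k))"
    by (rule summable_comparison_test'[OF summable_abs_binomial_half, of 0])
      (use norm_sqrt_series_term[OF assms] in simp)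
  show "summable (\<lambda>k. ((1/2) gchoose k) *\<^sub>R X ^ k)" by (rule summable_norm_cancel[OF *])
qed

lemma norm_sqrt_series:
  fixes X :: "'a::{real_normed_algebra_1, banach}"
  assumes "norm X \<le> 1"
  shows "norm (sqrt_series X) \<le> 2"
proof -
  have "norm (sqrt_series X) \<le> (\<Sum>k. \<bar>(1/2::real) gchoose k\<bar>)"
    unfolding sqrt_series_def
    by (rule norm_suminf_le[OF norm_sqrt_series_term[OF assms] summable_abs_binomial_half])
  also have "\<dots> \<le> 2" by (rule suminf_le_const[OF summable_abs_binomial_half sum_abs_binomial_half_le])
  finally show ?thesis .
qed

lemma sqrt_series_squared:
  fixes X :: "'a::{real_normed_algebra_1, banach}"
  assumes "norm X \<le> 1"
  shows "sqrt_series X * sqrt_series X = 1 + X"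
proof -
  have "sqrt_series X * sqrt_series X
      = (\<Sum>k. \<Sum>i\<le>k. (((1/2) gchoose i) *\<^sub>R X ^ i) * (((1/2) gchoose (k - i)) *\<^sub>R X ^ (k - i)))"
    unfolding sqrt_series_def by (rule Cauchy_product) (rule summable_sqrt_series[OF assms])+
  also have "\<dots> = (\<Sum>k. ((1::real) gchoose k) *\<^sub>R X ^ k)"
  proof (rule suminf_cong)
    fix k
    have "(\<Sum>i\<le>k. (((1/2) gchoose i) *\<^sub>R X ^ i) * (((1/2) gchoose (k - i)) *\<^sub>R X ^ (k - i)))
        = (\<Sum>i\<le>k. ((1/2::real) gchoose i) * ((1/2) gchoose (k - i))) *\<^sub>R X ^ k"
      unfolding scaleR_sum_left by (rule sum.cong) (auto simp: power_add[symmetric])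
    also have "(\<Sum>i\<le>k. ((1/2::real) gchoose i) * ((1/2) gchoose (k - i))) = 1 gchoose k"
      using gbinomial_Vandermonde[of "1/2::real" "1/2" k] by (simp add: atLeast0AtMost)
    finally show "(\<Sum>i\<le>k. (((1/2) gchoose i) *\<^sub>R X ^ i) * (((1/2) gchoose (k - i)) *\<^sub>R X ^ (k - i)))
        = ((1::real) gchoose k) *\<^sub>R X ^ k" .
  qed
  also have "\<dots> = (\<Sum>k\<in>{0, 1}. ((1::real) gchoose k) *\<^sub>R X ^ k)"
  proof (rule suminf_finite)
    fix k :: nat assume "k \<notin> {0, 1}"
    hence "(1::nat) choose k = 0" by (intro binomial_eq_0) auto
    hence "(1::real) gchoose k = 0"
      using binomial_gbinomial[of 1 k, where 'a = real] by (metis of_nat_0 of_nat_1)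
    thus "((1::real) gchoose k) *\<^sub>R X ^ k = 0" by simp
  qed simp
  also have "\<dots> = 1 + X" by simp
  finally show ?thesis .
qed

lemma sqrt_series_commute:
  fixes X Y :: "'a::{real_normed_algebra_1, banach}"
  assumes "norm X \<le> 1" "X * Y = Y * X"
  shows "sqrt_series X * Y = Y * sqrt_series X"
proof -
  have "X ^ k * Y = Y * X ^ k" for k by (rule power_commuting_commutes[OF assms(2)])
  thus ?thesis
    unfolding sqrt_series_def
    by (simp add: suminf_mult[OF summable_sqrt_series(2)[OF assms(1)], symmetric]
        suminf_mult2[OF summable_sqrt_series(2)[OF assms(1)]])
qed

lemma sqrt_series_0 [simp]: "sqrt_series 0 = 1"
proof -
  have "sqrt_series (0::'a) = (\<Sum>k\<in>{0}. ((1/2) gchoose k) *\<^sub>R 0 ^ k)"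
    unfolding sqrt_series_def by (rule suminf_finite) (auto simp: power_0_left)
  thus ?thesis by simp
qed

lemma continuous_on_sqrt_series:
  fixes X :: "'a::{real_normed_algebra_1, banach}"
  assumes "norm X \<le> 1"
  shows "continuous_on {0..1} (\<lambda>r. sqrt_series (r *\<^sub>R X))"
proof (rule uniform_limit_theorem)
  have "norm (((1/2) gchoose k) *\<^sub>R (r *\<^sub>R X) ^ k) \<le> \<bar>(1/2::real) gchoose k\<bar>" if "r \<in> {0..1}" for r k
    by (rule norm_sqrt_series_term) (use that assms in \<open>auto intro: mult_le_one\<close>)
  thus "uniform_limit {0..1} (\<lambda>n r. \<Sum>k<n. ((1/2) gchoose k) *\<^sub>R (r *\<^sub>R X) ^ k)
      (\<lambda>r. sqrt_series (r *\<^sub>R X)) sequentially"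
    unfolding sqrt_series_def by (rule Weierstrass_m_test[OF _ summable_abs_binomial_half])
  show "\<forall>\<^sub>F n in sequentially. continuous_on {0..1} (\<lambda>r. \<Sum>k<n. ((1/2) gchoose k) *\<^sub>R (r *\<^sub>R X) ^ k)"
    by (intro always_eventually allI continuous_intros)
qed simp

section \<open>The numerical range of the square root of a Cayley transform\<close>

abbreviation root_form :: "complex \<Rightarrow> 'a::complex_hilbert bop \<Rightarrow> 'a bop \<Rightarrow> 'a \<Rightarrow> real"
  where "root_form z Q P a \<equiv> Re (z * cinner (bap Q a) (bap P a))"

text \<open>
  Write \<open>F\<close> for \<open>root_form z Q P\<close>. For \<open>\<bar>z\<bar> = 1\<close> and \<open>Re z\<^sup>2 = 0\<close>, expanding at \<open>a = Q c + z P c\<close> gives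
  the identity \<open>F a = F (Q c) + F (P c) + \<bar>c\<bar>\<^sup>2 - \<bar>V c\<bar>\<^sup>2\<close>. The last difference is strictly positive
  when \<open>V\<close> is a strict contraction, so a bound \<open>F \<ge> - m\<close> improves itself, provided that \<open>m\<close> is small
  compared to \<open>1 - \<bar>V\<bar>\<^sup>2\<close>. The conjugate of \<open>z\<close> enters through
  \<open>\<bar>a\<bar>\<^sup>2 = \<bar>Q c\<bar>\<^sup>2 + \<bar>P c\<bar>\<^sup>2 + 2 Re (cnj z \<langle>Q c, P c\<rangle>)\<close>.
\<close>

lemma angle_improvement:
  fixes V P Q :: "'a::complex_hilbert bop"
  assumes V: "norm V \<le> q" "q < 1" and PP: "P * P = 1 - V" and QQ: "Q * Q = 1 + V"
    and PQ: "P * Q = Q * P" and n: "norm P \<le> 2" "norm Q \<le> 2"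
    and z: "cmod z = 1" "Re (z\<^sup>2) = 0" and m: "m \<ge> 0" "2 * m\<^sup>2 \<le> 1 - q\<^sup>2"
    and low: "\<And>a. - m * (norm a)\<^sup>2 \<le> root_form z Q P a"
    and low': "\<And>a. - m * (norm a)\<^sup>2 \<le> root_form (cnj z) Q P a"
  shows "- (m - (1 - q\<^sup>2 - 2 * m\<^sup>2) / 16) * (norm a)\<^sup>2 \<le> root_form z Q P a"
proof -
  have PP': "bap P (bap P x) = x - bap V x" and QQ': "bap Q (bap Q x) = x + bap V x"
    and PQ': "bap P (bap Q x) = bap Q (bap P x)" for x
    by (simp_all add: bap_simps PP QQ PQ flip: bap_simps(6))
  have zz: "z * cnj z = 1" using z(1) by (simp add: complex_norm_square[symmetric])
  have q0: "q \<ge> 0" using V(1) norm_ge_zero[of V] by linarith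
  obtain s where s: "z\<^sup>2 = Complex 0 s" using z(2) by (metis complex.collapse)
  have "cmod (z\<^sup>2) = 1" using z(1) by (simp add: norm_power)
  hence "\<bar>s\<bar> = 1" by (simp add: s cmod_def)
  hence s2: "s\<^sup>2 = 1" by (metis power2_abs one_power2)
  define w where "w = (1 + z\<^sup>2) / (1 - z\<^sup>2)"
  have nz: "1 - z\<^sup>2 \<noteq> 0" by (simp add: s complex_eq_iff)
  have "cmod (1 + z\<^sup>2) = cmod (1 - z\<^sup>2)" by (simp add: s cmod_def)
  hence w: "cmod w = 1" using nz by (simp add: w_def norm_divide)
  \<comment> \<open>\<open>(Q + z P) (Q - z P) = (1 - z\<^sup>2) (1 + w V)\<close> with \<open>\<bar>w\<bar> = 1\<close>, so \<open>Q + z P\<close> is onto.\<close>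
  obtain d where d: "d + w *\<^sub>C bap V d = inverse (1 - z\<^sup>2) *\<^sub>C a"
  proof (rule contraction_solvable[of "\<lambda>d. w *\<^sub>C bap V d" q])
    show "norm (w *\<^sub>C bap V x - w *\<^sub>C bap V y) \<le> q * norm (x - y)" for x y
    proof -
      have "norm (w *\<^sub>C bap V x - w *\<^sub>C bap V y) = norm (bap V (x - y))"
        by (simp add: norm_scaleC w bap_right flip: scaleC_diff_right)
      also have "\<dots> \<le> norm V * norm (x - y)" by (rule norm_bap)
      also have "\<dots> \<le> q * norm (x - y)" by (intro mult_right_mono V) simp
      finally show ?thesis .
    qed
  qed (use q0 V in auto)
  define c where "c = bap Q d - z *\<^sub>C bap P d"
  define X where "X = bap Q c"
  define Y where "Y = bap P c"
  have a: "a = X + z *\<^sub>C Y"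
  proof -
    have "X + z *\<^sub>C Y = (d + bap V d) - (z * z) *\<^sub>C (d - bap V d)"
      by (simp add: X_def Y_def c_def bap_right bap_scaleC QQ' PP' PQ' scaleC_diff_right scaleC_scaleC)
    also have "\<dots> = (1 - z\<^sup>2) *\<^sub>C d + (1 + z\<^sup>2) *\<^sub>C bap V d"
      by (simp add: scaleC_diff_right scaleC_diff_left scaleC_add_left power2_eq_square algebra_simps)
    also have "(1 + z\<^sup>2) = (1 - z\<^sup>2) * w" using nz by (simp add: w_def)
    also have "(1 - z\<^sup>2) *\<^sub>C d + ((1 - z\<^sup>2) * w) *\<^sub>C bap V d = (1 - z\<^sup>2) *\<^sub>C (d + w *\<^sub>C bap V d)"
      by (simp add: scaleC_add_right scaleC_scaleC)
    also have "\<dots> = a" using nz by (simp add: d scaleC_scaleC)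
    finally show ?thesis by simp
  qed
  define W where "W = bap P X"
  have W: "bap Q Y = W" by (simp add: W_def X_def Y_def PQ')
  have QX: "bap Q X = c + bap V c" and PY: "bap P Y = c - bap V c"
    by (simp_all add: X_def Y_def QQ' PP')
  have "z * cinner (bap Q a) (bap P a)
      = z * cinner (bap Q X) (bap P X) + (z * cnj z) * cinner (bap Q X) (bap P Y)
        + z\<^sup>2 * cinner W W + (z * cnj z) * (z * cinner (bap Q Y) (bap P Y))"
    by (simp add: a bap_right bap_scaleC cinner_simps W W_def[symmetric] power2_eq_square algebra_simps)
  hence "root_form z Q P a = root_form z Q P X
      + root_form z Q P Y + Re (cinner (c + bap V c) (c - bap V c))"
    using z(2) by (simp add: zz cinner_self QX PY del: of_real_power)
  also have "\<dots> \<ge> - m * ((norm X)\<^sup>2 + (norm Y)\<^sup>2) + (1 - q\<^sup>2) * (norm c)\<^sup>2"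
  proof -
    have "Re (cinner (c + bap V c) (c - bap V c)) = (norm c)\<^sup>2 - (norm (bap V c))\<^sup>2"
      by (simp add: cinner_simps Re_cinner_self Re_cinner_commute[of "bap V c" c])
    moreover have "norm (bap V c) \<le> q * norm c"
      using norm_bap[of V c] mult_right_mono[OF V(1) norm_ge_zero[of c]] by linarith
    hence "(norm (bap V c))\<^sup>2 \<le> q\<^sup>2 * (norm c)\<^sup>2"
      by (metis norm_ge_zero power_mono power_mult_distrib)
    ultimately show ?thesis using low[of X] low[of Y] by (simp add: algebra_simps)
  qed
  finally have 1: "root_form z Q P a
      \<ge> - m * ((norm X)\<^sup>2 + (norm Y)\<^sup>2) + (1 - q\<^sup>2) * (norm c)\<^sup>2" .
  have "(norm a)\<^sup>2 = (norm X)\<^sup>2 + (norm Y)\<^sup>2 + 2 * root_form (cnj z) Q P c"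
    by (simp add: a norm_add_squared norm_scaleC z(1) cinner_simps X_def Y_def)
  hence "(norm X)\<^sup>2 + (norm Y)\<^sup>2 \<le> (norm a)\<^sup>2 + 2 * m * (norm c)\<^sup>2" using low'[of c] by simp
  hence "m * ((norm X)\<^sup>2 + (norm Y)\<^sup>2) \<le> m * ((norm a)\<^sup>2 + 2 * m * (norm c)\<^sup>2)"
    by (rule mult_left_mono[OF _ m(1)])
  hence 2: "root_form z Q P a \<ge> - m * (norm a)\<^sup>2 + (1 - q\<^sup>2 - 2 * m\<^sup>2) * (norm c)\<^sup>2"
    using 1 by (simp add: algebra_simps power2_eq_square)
  have "norm a \<le> norm X + norm Y" using norm_triangle_ineq[of X "z *\<^sub>C Y"] by (simp add: a norm_scaleC z(1))
  also have "\<dots> \<le> 2 * norm c + 2 * norm c"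
    using norm_bap[of Q c] norm_bap[of P c] mult_right_mono[OF n(1) norm_ge_zero[of c]]
      mult_right_mono[OF n(2) norm_ge_zero[of c]] by (simp add: X_def Y_def)
  finally have "(norm a)\<^sup>2 \<le> (4 * norm c)\<^sup>2" by (intro power_mono) auto
  hence "(norm a)\<^sup>2 / 16 \<le> (norm c)\<^sup>2" by (simp add: power_mult_distrib)
  hence "(1 - q\<^sup>2 - 2 * m\<^sup>2) * ((norm a)\<^sup>2 / 16) \<le> (1 - q\<^sup>2 - 2 * m\<^sup>2) * (norm c)\<^sup>2"
    using m(2) by (intro mult_left_mono) auto
  moreover have "- (m - k / 16) * A = - m * A + k * (A / 16)" for k A :: real
    by (simp add: algebra_simps)
  ultimately show ?thesis using 2 by simp
qed

text \<open>
  Each improvement lowers \<open>m\<close> by at least the fixed amount \<open>e\<close>. The best constant therefore cannot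
  be small and positive: it is 0 or bounded away from 0.
\<close>

lemma angle_gap:
  fixes V P Q :: "'a::complex_hilbert bop"
  assumes V: "norm V \<le> q" "q < 1" and PP: "P * P = 1 - V" and QQ: "Q * Q = 1 + V"
    and PQ: "P * Q = Q * P" and n: "norm P \<le> 2" "norm Q \<le> 2"
    and z: "cmod z = 1" "Re (z\<^sup>2) = 0" and m: "m \<ge> 0" "2 * m\<^sup>2 < 1 - q\<^sup>2"
    and low: "\<And>a. - m * (norm a)\<^sup>2 \<le> root_form z Q P a"
    and low': "\<And>a. - m * (norm a)\<^sup>2 \<le> root_form (cnj z) Q P a"
  shows "0 \<le> root_form z Q P a" "0 \<le> root_form (cnj z) Q P a"
proof -
  define e where "e = (1 - q\<^sup>2 - 2 * m\<^sup>2) / 16"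
  have e: "e > 0" using m by (simp add: e_def)
  define G where "G k \<longleftrightarrow> (\<forall>a. - k * (norm a)\<^sup>2 \<le> root_form z Q P a \<and>
      - k * (norm a)\<^sup>2 \<le> root_form (cnj z) Q P a)" for k
  have mono: "G l" if "G k" "k \<le> l" for k l
  proof -
    have "- l * (norm a)\<^sup>2 \<le> - k * (norm a)\<^sup>2" for a :: 'a using that(2) by (simp add: mult_right_mono)
    thus ?thesis using that(1) unfolding G_def by (meson order_trans)
  qed
  have "G (max 0 (m - real k * e))" for k
  proof (induction k)
    case 0 show ?case using low low' m(1) by (simp add: G_def)
  next
    case (Suc k)
    define l where "l = max 0 (m - real k * e)"
    have l: "0 \<le> l" "l \<le> m" using m(1) e by (auto simp: l_def)
    have lm: "l\<^sup>2 \<le> m\<^sup>2" using l by (simp add: power_mono)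
    have Gl: "G l" using Suc by (simp add: l_def)
    have "G (l - (1 - q\<^sup>2 - 2 * l\<^sup>2) / 16)"
      unfolding G_def
    proof (intro allI conjI)
      fix a
      note ai = angle_improvement[OF V PP QQ PQ n _ _ l(1)]
      show "- (l - (1 - q\<^sup>2 - 2 * l\<^sup>2) / 16) * (norm a)\<^sup>2 \<le> root_form z Q P a"
        using Gl lm m(2) z by (intro ai) (auto simp: G_def)
      show "- (l - (1 - q\<^sup>2 - 2 * l\<^sup>2) / 16) * (norm a)\<^sup>2 \<le> root_form (cnj z) Q P a"
        using Gl lm m(2) z by (intro ai) (auto simp: G_def simp flip: complex_cnj_power)
    qed
    moreover have "l - (1 - q\<^sup>2 - 2 * l\<^sup>2) / 16 \<le> l - e" using lm by (simp add: e_def)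
    ultimately have "G (l - e)" by (rule mono)
    thus ?case by (rule mono) (use e in \<open>auto simp: l_def algebra_simps\<close>)
  qed
  moreover obtain k :: nat where "m / e < real k" using reals_Archimedean2 by blast
  hence "max 0 (m - real k * e) = 0" using e by (simp add: field_simps max_def)
  ultimately have "G 0" by metis
  thus "0 \<le> root_form z Q P a" "0 \<le> root_form (cnj z) Q P a"
    by (auto simp: G_def)
qed

text \<open>
  Deformation along \<open>s V\<close> with \<open>0 \<le> s \<le> r < 1\<close>. At \<open>s = 0\<close> both roots are the identity and the claim is
  \<open>Re z \<ge> 0\<close>. In a short step the form can become negative only by a small amount, which
  \<open>angle_gap\<close> excludes.
\<close>

lemma sqrt_series_angle_strict:
  fixes V :: "'a::complex_hilbert bop"
  assumes V: "norm V \<le> 1" and r: "0 \<le> r" "r < 1"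
    and z: "cmod z = 1" "Re (z\<^sup>2) = 0" "Re z \<ge> 0"
  shows "0 \<le> root_form z (sqrt_series (r *\<^sub>R V)) (sqrt_series (r *\<^sub>R (- V))) a"
proof -
  define Q where "Q s = sqrt_series (s *\<^sub>R V)" for s
  define P where "P s = sqrt_series (s *\<^sub>R (- V))" for s
  define G where "G s \<longleftrightarrow> (\<forall>a. 0 \<le> root_form z (Q s) (P s) a \<and>
    0 \<le> root_form (cnj z) (Q s) (P s) a)" for s
  have nV: "norm (s *\<^sub>R V) \<le> 1" "norm (s *\<^sub>R (- V)) \<le> 1" if "s \<in> {0..1}" for s
    using that V by (auto intro: mult_le_one)
  have nPQ: "norm (P s) \<le> 2" "norm (Q s) \<le> 2" if "s \<in> {0..1}" for s
    unfolding P_def Q_def by (intro norm_sqrt_series nV that)+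
  have unif: "uniformly_continuous_on {0..1} Q" "uniformly_continuous_on {0..1} P"
    unfolding P_def Q_def
    by (intro compact_uniformly_continuous continuous_on_sqrt_series compact_Icc; simp add: V)+
  define e where "e = (1 - r\<^sup>2) / 32"
  have r2: "0 \<le> r\<^sup>2" "r\<^sup>2 < 1" using r by (simp_all add: abs_square_less_1)
  have e: "e > 0" "e \<le> 1 / 32" using r2 by (auto simp: e_def)
  have small: "2 * (4 * e)\<^sup>2 < 1 - r\<^sup>2"
  proof -
    have "2 * (4 * e)\<^sup>2 = 32 * (e * e)" by (simp add: power2_eq_square)
    also have "\<dots> \<le> 32 * (e * (1 / 32))" using e by (intro mult_left_mono) auto
    also have "\<dots> < 32 * e" using e by simp
    also have "\<dots> = 1 - r\<^sup>2" by (simp add: e_def)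
    finally show ?thesis .
  qed
  obtain d1 where d1: "d1 > 0" "\<And>s t. s \<in> {0..1} \<Longrightarrow> t \<in> {0..1} \<Longrightarrow> dist t s < d1 \<Longrightarrow> dist (Q t) (Q s) < e"
    using unif(1) e(1) unfolding uniformly_continuous_on_def by metis
  obtain d2 where d2: "d2 > 0" "\<And>s t. s \<in> {0..1} \<Longrightarrow> t \<in> {0..1} \<Longrightarrow> dist t s < d2 \<Longrightarrow> dist (P t) (P s) < e"
    using unif(2) e(1) unfolding uniformly_continuous_on_def by metis
  obtain N :: nat where N: "1 / min d1 d2 < real N" using reals_Archimedean2 by blast
  have d0: "min d1 d2 > 0" using d1 d2 by simp
  have N0: "real N > 0" using N d0 by (metis less_trans zero_less_divide_1_iff)
  have perturb: "\<bar>root_form u (Q t) (P t) a - root_form u (Q s) (P s) a\<bar>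
      \<le> 4 * e * (norm a)\<^sup>2"
    if "s \<in> {0..1}" "t \<in> {0..1}" "dist t s < d1" "dist t s < d2" "cmod u = 1" for s t u a
  proof -
    have "cinner (bap (Q t) a) (bap (P t) a) - cinner (bap (Q s) a) (bap (P s) a)
        = cinner (bap (Q t - Q s) a) (bap (P t) a) + cinner (bap (Q s) a) (bap (P t - P s) a)"
      by (simp add: bap_simps cinner_simps)
    hence "cmod (u * cinner (bap (Q t) a) (bap (P t) a) - u * cinner (bap (Q s) a) (bap (P s) a))
        \<le> cmod (cinner (bap (Q t - Q s) a) (bap (P t) a)) + cmod (cinner (bap (Q s) a) (bap (P t - P s) a))"
      using that(5) norm_triangle_ineq by (simp add: norm_mult flip: right_diff_distrib)
    also have "\<dots> \<le> norm (bap (Q t - Q s) a) * norm (bap (P t) a)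
        + norm (bap (Q s) a) * norm (bap (P t - P s) a)"
      by (intro add_mono Cauchy_Schwarz)
    also have "\<dots> \<le> (e * norm a) * (2 * norm a) + (2 * norm a) * (e * norm a)"
    proof (intro add_mono mult_mono)
      show "norm (bap (Q t - Q s) a) \<le> e * norm a"
        using norm_bap[of "Q t - Q s" a] mult_right_mono[OF less_imp_le[OF d1(2)[OF that(1,2,3)]] norm_ge_zero[of a]]
        by (simp add: dist_norm)
      show "norm (bap (P t - P s) a) \<le> e * norm a"
        using norm_bap[of "P t - P s" a] mult_right_mono[OF less_imp_le[OF d2(2)[OF that(1,2,4)]] norm_ge_zero[of a]]
        by (simp add: dist_norm)
      show "norm (bap (P t) a) \<le> 2 * norm a"
        using norm_bap[of "P t" a] mult_right_mono[OF nPQ(1)[OF that(2)] norm_ge_zero[of a]] by simp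
      show "norm (bap (Q s) a) \<le> 2 * norm a"
        using norm_bap[of "Q s" a] mult_right_mono[OF nPQ(2)[OF that(1)] norm_ge_zero[of a]] by simp
    qed (use e in auto)
    finally show ?thesis
      using abs_Re_le_cmod[of "u * cinner (bap (Q t) a) (bap (P t) a) - u * cinner (bap (Q s) a) (bap (P s) a)"]
      by (simp add: power2_eq_square)
  qed
  have "G (real k / real N * r)" if "k \<le> N" for k
    using that
  proof (induction k)
    case 0
    have "bap (1::'a bop) a = a" for a by (simp add: bap_simps)
    thus ?case using z(3) by (simp add: G_def P_def Q_def cinner_self)
  next
    case (Suc k)
    define s where "s = real k / real N * r"
    define t where "t = real (Suc k) / real N * r"
    have st: "s \<in> {0..1}" "t \<in> {0..1}" "t \<le> r" "0 \<le> t"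
    proof -
      have "real k / real N \<le> 1" "real (Suc k) / real N \<le> 1" using Suc.prems N0 by auto
      hence "s \<le> r" "t \<le> r" unfolding s_def t_def using r by (intro mult_left_le_one_le; simp)+
      thus "s \<in> {0..1}" "t \<in> {0..1}" "t \<le> r" "0 \<le> t" using r by (auto simp: s_def t_def)
    qed
    have "t - s = r / real N" using N0 by (simp add: s_def t_def field_simps)
    hence "dist t s \<le> 1 / real N" using r N0 by (simp add: dist_real_def divide_right_mono)
    also have "\<dots> < min d1 d2" using N N0 d0
      by (simp only: pos_divide_less_eq mult.commute)
    finally have st': "dist t s < d1" "dist t s < d2" by auto
    have Gs: "G s" using Suc by (simp add: s_def)
    have low: "- (4 * e) * (norm a)\<^sup>2 \<le> root_form u (Q t) (P t) a"
      if "u = z \<or> u = cnj z" for u a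
    proof -
      have "cmod u = 1" using that z(1) by auto
      moreover have "0 \<le> root_form u (Q s) (P s) a"
        using that Gs unfolding G_def by blast
      ultimately show ?thesis using perturb[OF st(1,2) st', of u a] by linarith
    qed
    have gap: "0 \<le> root_form z (Q t) (P t) a"
      "0 \<le> root_form (cnj z) (Q t) (P t) a" for a
    proof -
      have *: "norm (t *\<^sub>R V) \<le> r" "P t * P t = 1 - t *\<^sub>R V" "Q t * Q t = 1 + t *\<^sub>R V"
        "P t * Q t = Q t * P t"
      proof -
        show "norm (t *\<^sub>R V) \<le> r" using st V by (simp add: mult_le_cancel_left1 mult_mono'[of t r "norm V" 1, simplified])
        show "P t * P t = 1 - t *\<^sub>R V" "Q t * Q t = 1 + t *\<^sub>R V"
          using sqrt_series_squared[OF nV(2)[OF st(2)]] sqrt_series_squared[OF nV(1)[OF st(2)]]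
          by (simp_all add: P_def Q_def)
        show "P t * Q t = Q t * P t"
          unfolding P_def Q_def
          by (rule sqrt_series_commute[OF nV(2)[OF st(2)] sqrt_series_commute[OF nV(1)[OF st(2)], symmetric]]) simp
      qed
      note gap = angle_gap[OF *(1) r(2) *(2-4) nPQ[OF st(2)] z(1,2) _ small low low]
      show "0 \<le> root_form z (Q t) (P t) a"
        by (rule gap(1)) (use e in auto)
      show "0 \<le> root_form (cnj z) (Q t) (P t) a"
        by (rule gap(2)) (use e in auto)
    qed
    thus ?case by (simp add: G_def t_def)
  qed
  from this[of N] have "G r" using N0 by simp
  thus ?thesis by (simp add: G_def P_def Q_def)
qed

lemma sqrt_series_angle:
  fixes V :: "'a::complex_hilbert bop"
  assumes V: "norm V \<le> 1" and z: "cmod z = 1" "Re (z\<^sup>2) = 0" "Re z \<ge> 0"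
  shows "0 \<le> root_form z (sqrt_series V) (sqrt_series (- V)) a"
proof -
  define r where "r n = 1 - inverse (real (Suc n))" for n
  have r: "0 \<le> r n" "r n < 1" for n by (auto simp: r_def field_simps)
  have r1: "r \<longlonglongrightarrow> 1"
    unfolding r_def using tendsto_diff[OF tendsto_const LIMSEQ_inverse_real_of_nat, of 1] by simp
  have lim: "(\<lambda>n. sqrt_series (r n *\<^sub>R X)) \<longlonglongrightarrow> sqrt_series X" if "norm X \<le> 1" for X :: "'a bop"
    using continuous_on_tendsto_compose[OF continuous_on_sqrt_series[OF that] r1] r
    by (auto simp: less_imp_le intro: always_eventually)
  have "(\<lambda>n. root_form z (sqrt_series (r n *\<^sub>R V)) (sqrt_series (r n *\<^sub>R (- V))) a)
      \<longlonglongrightarrow> root_form z (sqrt_series V) (sqrt_series (- V)) a"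
    using V by (intro tendsto_Re tendsto_mult tendsto_cinner tendsto_bap tendsto_const lim) auto
  thus ?thesis
    using sqrt_series_angle_strict[OF V r z] by (intro LIMSEQ_le_const) auto
qed

text \<open>
  The sector of half-angle \<open>\<pi>/4\<close> is the intersection of the half-planes \<open>Re (z w) \<ge> 0\<close> for the two
  eighth roots of unity \<open>z = exp (\<plusminus> i \<pi>/4)\<close>.
\<close>

lemma sqrt_series_sector:
  fixes V :: "'a::complex_hilbert bop"
  assumes V: "norm V \<le> 1"
  shows "\<bar>Im (cinner (bap (sqrt_series V) a) (bap (sqrt_series (- V)) a))\<bar>
    \<le> Re (cinner (bap (sqrt_series V) a) (bap (sqrt_series (- V)) a))"
proof -
  let ?N = "cinner (bap (sqrt_series V) a) (bap (sqrt_series (- V)) a)"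
  define s :: real where "s = sqrt 2 / 2"
  have s: "s * s = 1 / 2" "s > 0" by (simp_all add: s_def)
  have "0 \<le> Re (Complex s t * ?N)" if "t = s \<or> t = - s" for t
    by (rule sqrt_series_angle[OF V]) (use s that in \<open>auto simp: cmod_def power2_eq_square\<close>)
  from this[of s] this[of "-s"] have "0 \<le> s * (Re ?N - Im ?N)" "0 \<le> s * (Re ?N + Im ?N)"
    by (simp_all add: algebra_simps)
  thus ?thesis using s(2) by (simp add: zero_le_mult_iff abs_le_iff)
qed

section \<open>Square roots of m-accretive operators\<close>

lemma quadratic_nonneg_linear_term:
  fixes a b :: real
  assumes "\<And>s. 0 \<le> s * a + s\<^sup>2 * b"
  shows "a = 0"
proof (rule ccontr)
  assume "a \<noteq> 0"
  define k where "k = \<bar>b\<bar> + 1"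
  have k: "k > 0" "b < k" by (simp_all add: k_def)
  have "0 \<le> (- a / k) * a + (- a / k)\<^sup>2 * b" by (rule assms)
  also have "\<dots> = a\<^sup>2 / k\<^sup>2 * (b - k)" using k by (simp add: field_simps power2_eq_square)
  also have "\<dots> < 0" using k \<open>a \<noteq> 0\<close> by (intro mult_pos_neg) auto
  finally show False by simp
qed

lemma angle_accretive_pi4:
  "angle_accretive (pi / 4) S \<longleftrightarrow>
    linear_op S \<and> (\<forall>x\<in>dom S. \<bar>Im (cinner (S \<cdot> x) x)\<bar> \<le> Re (cinner (S \<cdot> x) x))"
  by (simp add: angle_accretive_def tan_45)

lemma angle_accretive_pi4_accretive: "angle_accretive (pi / 4) S \<Longrightarrow> accretive S"
  by (force simp: angle_accretive_pi4 accretive_def)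

text \<open>
  The sector containing the numerical range is pointed, so the linear term in \<open>\<langle>S (y + s c v), y + s c v\<rangle>\<close> has to vanish for all
  complex \<open>c\<close>.
\<close>

lemma sectorial_form_eq_0:
  assumes S: "angle_accretive (pi / 4) S" "closure (dom S) = UNIV"
    and y: "y \<in> dom S" "Re (cinner (S \<cdot> y) y) = 0"
  shows "S \<cdot> y = 0"
proof -
  have l: "linear_op S" and sec: "\<And>x. x \<in> dom S \<Longrightarrow> \<bar>Im (cinner (S \<cdot> x) x)\<bar> \<le> Re (cinner (S \<cdot> x) x)"
    using S(1) by (auto simp: angle_accretive_pi4)
  have y0: "cinner (S \<cdot> y) y = 0" using sec[OF y(1)] y(2) by (simp add: complex_eq_iff)
  have "cinner (S \<cdot> y) v = 0" if v: "v \<in> dom S" for v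
  proof -
    have L: "cnj c * cinner (S \<cdot> y) v + c * cinner (S \<cdot> v) y = 0" (is "?L = 0") for c
    proof -
      define M where "M = (c * cnj c) * cinner (S \<cdot> v) v"
      have *: "\<bar>s * Im ?L + s\<^sup>2 * Im M\<bar> \<le> s * Re ?L + s\<^sup>2 * Re M" for s :: real
      proof -
        have "cinner (S \<cdot> (y + (of_real s * c) *\<^sub>C v)) (y + (of_real s * c) *\<^sub>C v)
            = of_real s * ?L + of_real (s\<^sup>2) * M"
          by (simp add: linear_op_simps[OF l] linear_op_intros[OF l] y v cinner_simps y0 M_def
              power2_eq_square algebra_simps)
        moreover have "y + (of_real s * c) *\<^sub>C v \<in> dom S" by (intro linear_op_intros[OF l] y v)
        ultimately show ?thesis using sec[of "y + (of_real s * c) *\<^sub>C v"] by simp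
      qed
      have "0 \<le> s * (Re ?L) + s\<^sup>2 * Re M" for s using *[of s] abs_ge_zero order_trans by blast
      hence 1: "Re ?L = 0" by (rule quadratic_nonneg_linear_term)
      have "0 \<le> s * (Re ?L - Im ?L) + s\<^sup>2 * (Re M - Im M)" for s
        using abs_le_D1[OF *[of s]] by (simp only: right_diff_distrib)
      hence "Re ?L - Im ?L = 0" by (rule quadratic_nonneg_linear_term)
      thus ?thesis using 1 by (simp only: complex_eq_iff) simp
    qed
    from L[of 1] L[of \<i>] show ?thesis by (simp add: complex_eq_iff)
  qed
  thus ?thesis using orthogonal_dense_eq_0[OF S(2)] by simp
qed

text \<open>
  Since \<open>S y = 0\<close>, the form at \<open>x + c y\<close> is affine in \<open>c\<close>; its real part is bounded below, so it is
  constant.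
\<close>

lemma accretive_null_orthogonal_range:
  assumes S: "accretive S" and y: "y \<in> dom S" "S \<cdot> y = 0" and x: "x \<in> dom S"
  shows "cinner (S \<cdot> x) y = 0"
proof -
  note l = accretive_linear[OF S]
  define g where "g = cinner (S \<cdot> x) y"
  have *: "0 \<le> Re (cinner (S \<cdot> x) x) - t * (cmod g)\<^sup>2" for t :: real
  proof -
    have "cinner (S \<cdot> (x + (- of_real t * g) *\<^sub>C y)) (x + (- of_real t * g) *\<^sub>C y)
        = cinner (S \<cdot> x) x - of_real t * (cnj g * g)"
      by (simp add: linear_op_simps[OF l] linear_op_intros[OF l] x y cinner_simps g_def algebra_simps)
    moreover have "x + (- of_real t * g) *\<^sub>C y \<in> dom S" by (intro linear_op_intros[OF l] x y)
    moreover have "cnj g * g = of_real ((cmod g)\<^sup>2)" by (simp only: complex_norm_square mult.commute)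
    ultimately show ?thesis
      using accretiveD[OF S, of "x + (- of_real t * g) *\<^sub>C y"] by (simp del: of_real_power)
  qed
  have "g = 0"
  proof (rule ccontr)
    assume "g \<noteq> 0"
    thus False using *[of "(Re (cinner (S \<cdot> x) x) + 1) / (cmod g)\<^sup>2"] by simp
  qed
  thus ?thesis by (simp add: g_def)
qed

definition commutes_with :: "('a::complex_hilbert \<rightharpoonup> 'a) \<Rightarrow> 'a bop \<Rightarrow> bool"
  where "commutes_with S X \<longleftrightarrow> (\<forall>x\<in>dom S. bap X x \<in> dom S \<and> S \<cdot> bap X x = bap X (S \<cdot> x))"

lemma commutes_withD:
  assumes "commutes_with S X" "x \<in> dom S"
  shows "bap X x \<in> dom S" "S \<cdot> bap X x = bap X (S \<cdot> x)"
  using assms by (auto simp: commutes_with_def)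

text \<open>
  The commutation relation passes to limits because \<open>S\<close> is closed.
\<close>

lemma commutes_with_limit:
  assumes "m_accretive S" "\<And>n. commutes_with S (X n)" "X \<longlonglongrightarrow> L"
  shows "commutes_with S L"
  unfolding commutes_with_def
proof
  fix x assume x: "x \<in> dom S"
  have *: "(\<lambda>n. bap (X n) x) \<longlonglongrightarrow> bap L x" "(\<lambda>n. S \<cdot> bap (X n) x) \<longlonglongrightarrow> bap L (S \<cdot> x)"
    by (auto simp: commutes_withD[OF assms(2) x] intro!: tendsto_bap assms(3))
  show "bap L x \<in> dom S \<and> S \<cdot> bap L x = bap L (S \<cdot> x)"
    using m_accretive_closed[OF assms(1) _ *] commutes_withD(1)[OF assms(2) x] by blast
qed

lemma commutes_with_sqrt_series:
  assumes S: "m_accretive S" and X: "commutes_with S X" "norm X \<le> 1"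
  shows "commutes_with S (sqrt_series X)"
proof (rule commutes_with_limit[OF S])
  note l = m_accretive_linear[OF S]
  have pow: "commutes_with S (X ^ k)" for k
    by (induction k) (use X(1) in \<open>auto simp: commutes_with_def bap_simps\<close>)
  show "commutes_with S (\<Sum>k<n. ((1/2) gchoose k) *\<^sub>R X ^ k)" for n
  proof (induction n)
    case 0 show ?case by (simp add: commutes_with_def bap_simps linear_op_zero[OF l])
  next
    case (Suc n)
    thus ?case using pow[of n]
      by (auto simp: commutes_with_def bap_simps linear_op_simps[OF l] linear_op_intros[OF l])
  qed
  show "(\<lambda>n. \<Sum>k<n. ((1/2) gchoose k) *\<^sub>R X ^ k) \<longlonglongrightarrow> sqrt_series X"
    unfolding sqrt_series_def by (rule summable_LIMSEQ[OF summable_sqrt_series(2)[OF X(2)]])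
qed

text \<open>
  At \<open>f = T x + x\<close> the value is \<open>T x - x\<close>, and \<open>\<bar>T x - x\<bar> \<le> \<bar>T x + x\<bar>\<close> is accretivity.
\<close>

lemma cayley_transform_exists:
  assumes T: "m_accretive T"
  obtains V where "norm V \<le> 1" "\<And>f. bap V f = f - 2 *\<^sub>R resolvent T 1 f"
proof -
  note a = m_accretive_accretive[OF T]
  have s: "shift_onto T 1" using m_accretive_shift_onto[OF T, of 1] by simp
  note r = resolvent_add[OF a s] resolvent_scaleC[OF a s]
  show ?thesis
  proof (rule bop_exists[of "\<lambda>f. f - 2 *\<^sub>R resolvent T 1 f" 1])
    fix f
    define x where "x = resolvent T 1 f"
    have x: "x \<in> dom T" and f: "f = T \<cdot> x + x"
      using resolvent[OF s, of f] by (simp_all add: x_def)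
    have "f - 2 *\<^sub>R x = T \<cdot> x - x" by (simp add: f scaleR_2)
    moreover have "(norm (T \<cdot> x - x))\<^sup>2 \<le> (norm (T \<cdot> x + x))\<^sup>2"
      using accretiveD[OF a x] by (simp add: norm_add_squared norm_diff_squared)
    ultimately show "norm (f - 2 *\<^sub>R resolvent T 1 f) \<le> 1 * norm f"
      by (simp add: x_def[symmetric] f[symmetric])
  qed (auto simp: r scaleC_diff_right scaleC_add_right scaleR_scaleC scaleC_scaleC mult.commute algebra_simps intro: that)
qed

locale m_accretive_operator =
  fixes T :: "'a::complex_hilbert \<rightharpoonup> 'a"
  assumes m_accretive: "m_accretive T"
begin

text \<open>The Cayley transform \<open>(T - 1) (T + 1)\<^sup>-\<^sup>1 = 1 - 2 (T + 1)\<^sup>-\<^sup>1\<close>.\<close>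

definition V :: "'a bop"
  where "V = (SOME V. norm V \<le> 1 \<and> (\<forall>f. bap V f = f - 2 *\<^sub>R resolvent T 1 f))"
definition Q :: "'a bop" where "Q = sqrt_series V"
definition P :: "'a bop" where "P = sqrt_series (- V)"

lemma V: "norm V \<le> 1" "bap V f = f - 2 *\<^sub>R resolvent T 1 f"
proof -
  have "\<exists>V. norm V \<le> 1 \<and> (\<forall>f. bap V f = f - 2 *\<^sub>R resolvent T 1 f)"
    using cayley_transform_exists[OF m_accretive] by metis
  from someI_ex[OF this] show "norm V \<le> 1" "bap V f = f - 2 *\<^sub>R resolvent T 1 f"
    by (auto simp: V_def)
qed

lemma shift_onto: "shift_onto T 1"
  using m_accretive_shift_onto[OF m_accretive, of 1] by simp

lemma accretive: "accretive T"
  by (rule m_accretive_accretive[OF m_accretive])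

lemma PP: "bap P (bap P x) = 2 *\<^sub>R resolvent T 1 x"
proof -
  have "P * P = 1 - V" using sqrt_series_squared[of "- V"] V(1) by (simp add: P_def)
  thus ?thesis by (simp add: V bap_simps flip: bap_simps(6))
qed

lemma QQ: "bap Q (bap Q x) = 2 *\<^sub>R (T \<cdot> resolvent T 1 x)"
proof -
  have "Q * Q = 1 + V" using sqrt_series_squared[of V] V(1) by (simp add: Q_def)
  hence "bap Q (bap Q x) = x + (x - 2 *\<^sub>R resolvent T 1 x)"
    by (simp add: V bap_simps flip: bap_simps(6))
  thus ?thesis by (simp add: resolvent_app[OF shift_onto] scaleR_2 scaleR_diff_right)
qed

lemma PQ: "bap P (bap Q x) = bap Q (bap P x)"
proof -
  have "P * Q = Q * P"
    unfolding P_def Q_def using V(1)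
    by (intro sqrt_series_commute sqrt_series_commute[symmetric]) auto
  thus ?thesis by (metis bap_simps(6))
qed

lemma P_eq_0: "bap P x = 0 \<Longrightarrow> x = 0"
proof -
  assume "bap P x = 0"
  hence "resolvent T 1 x = 0" using PP[of x] by (simp add: bap_right)
  thus "x = 0" using resolvent_eq[OF shift_onto, of x] linear_op_zero[OF accretive_linear[OF accretive]] by simp
qed

lemma inj_P: "inj (bap P)"
  by (rule injI) (metis P_eq_0 bap_right(3) eq_iff_diff_eq_0)

lemma dom_T: "x \<in> dom T \<longleftrightarrow> (\<exists>c. x = bap P (bap P c))"
proof
  assume x: "x \<in> dom T"
  have r: "resolvent T 1 (T \<cdot> x + 1 *\<^sub>C x) = x"
    by (rule resolvent_unique[OF accretive shift_onto _ x]) simp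
  have "bap P (bap P ((1/2) *\<^sub>R (T \<cdot> x + 1 *\<^sub>C x))) = (1/2) *\<^sub>R (2 *\<^sub>R x)"
    by (simp only: bap_right(5) PP r)
  thus "\<exists>c. x = bap P (bap P c)" by (metis scaleR_half_double scaleR_2)
qed (auto simp: PP resolvent_dom[OF shift_onto] linear_op_scaleR[OF accretive_linear[OF accretive]])

lemma T_PP: "T \<cdot> bap P (bap P c) = bap Q (bap Q c)"
  by (simp add: PP QQ resolvent_dom[OF shift_onto] linear_op_scaleR[OF accretive_linear[OF accretive]])

text \<open>Formally this is \<open>(1 + V)\<^bsup>1/2\<^esup> (1 - V)\<^bsup>-1/2\<^esup>\<close>.\<close>

definition root :: "'a \<rightharpoonup> 'a"
  where "root = (\<lambda>x. if x \<in> range (bap P) then Some (bap Q (inv (bap P) x)) else None)"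

lemma dom_root: "dom root = range (bap P)"
  by (auto simp: root_def domIff split: if_splits)

lemma P_dom_root [simp]: "bap P a \<in> dom root"
  by (simp add: dom_root)

lemma root_P [simp]: "root \<cdot> bap P a = bap Q a"
  by (simp add: root_def op_app_def inv_f_f[OF inj_P])

lemma linear_root: "linear_op root"
  unfolding linear_op_def dom_root
proof (intro conjI ballI allI; clarify?)
  show "0 \<in> range (bap P)" by (metis bap_right(1) rangeI)
  fix a b c
  show "bap P a + bap P b \<in> range (bap P)" by (simp flip: bap_right(2))
  show "root \<cdot> (bap P a + bap P b) = root \<cdot> bap P a + root \<cdot> bap P b"
    unfolding bap_right(2)[of P, symmetric] root_P bap_right(2)[of Q] ..
  show "c *\<^sub>C bap P a \<in> range (bap P)" by (simp flip: bap_scaleC)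
  show "root \<cdot> (c *\<^sub>C bap P a) = c *\<^sub>C root \<cdot> bap P a"
    unfolding bap_scaleC[of P, symmetric] root_P bap_scaleC[of Q] ..
qed

lemma angle_root: "angle_accretive (pi / 4) root"
  using sqrt_series_sector[OF V(1)]
  by (auto simp: angle_accretive_pi4 linear_root dom_root P_def[symmetric] Q_def[symmetric])

lemma square_root: "root \<circ>\<^sub>m root = T"
proof (rule op_eqI)
  show dom: "dom (root \<circ>\<^sub>m root) = dom T"
  proof safe
    fix x assume "x \<in> dom (root \<circ>\<^sub>m root)"
    then obtain a b where ab: "x = bap P a" "bap Q a = bap P b"
      by (auto simp: dom_square dom_root)
    \<comment> \<open>\<open>P\<^sup>2 + Q\<^sup>2 = 2\<close> puts \<open>a\<close> into the range of \<open>P\<close>.\<close>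
    have "2 *\<^sub>R a = bap P (bap P a) + bap Q (bap Q a)"
      using resolvent_eq[OF shift_onto, of a] by (simp add: PP QQ add.commute flip: scaleR_add_right)
    also have "\<dots> = bap P (bap P a + bap Q b)" by (simp add: ab PQ bap_right)
    finally have "bap P ((1/2) *\<^sub>R (bap P a + bap Q b)) = (1/2) *\<^sub>R (2 *\<^sub>R a)"
      by (simp only: bap_right(5))
    then obtain w where "a = bap P w" by (metis scaleR_half_double scaleR_2)
    thus "x \<in> dom T" by (auto simp: dom_T ab(1))
  next
    fix x assume "x \<in> dom T"
    thus "x \<in> dom (root \<circ>\<^sub>m root)" by (auto simp: dom_T dom_square simp flip: PQ)
  qed
  fix x assume "x \<in> dom (root \<circ>\<^sub>m root)"
  then obtain c where "x = bap P (bap P c)" using dom by (auto simp: dom_T)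
  thus "(root \<circ>\<^sub>m root) \<cdot> x = T \<cdot> x" by (simp add: square_app T_PP flip: PQ)
qed

lemma root_m_accretive: "m_accretive root"
  using m_accretive_root[of root] angle_accretive_pi4_accretive[OF angle_root] m_accretive
  by (simp add: square_root)

lemma m_angle_root: "m_angle_accretive (pi / 4) root"
  by (simp add: m_angle_accretive_def angle_root root_m_accretive)

text \<open>
  Another accretive root \<open>S\<close> of \<open>T\<close> commutes with the resolvent of \<open>T\<close>, hence with \<open>V\<close>, \<open>P\<close>
  and \<open>Q\<close>. For \<open>p\<close> in a suitable core, \<open>y = S p - root p\<close> then satisfies \<open>S y + root y = 0\<close>.
  Taking the inner product with \<open>y\<close>, accretivity and the sector condition give \<open>S y = root y = 0\<close>,
  and null vectors of an accretive operator are orthogonal to its range, so that \<open>y = 0\<close>.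
\<close>

lemma root_unique:
  assumes S: "accretive S" "S \<circ>\<^sub>m S = T"
  shows "S = root"
proof -
  have mS: "m_accretive S" using m_accretive_root[of S] S m_accretive by simp
  note l = accretive_linear[OF S(1)]
  have domT: "x \<in> dom T \<longleftrightarrow> x \<in> dom S \<and> S \<cdot> x \<in> dom S" for x
    using dom_square[of S] by (simp add: S)
  have T: "T \<cdot> x = S \<cdot> S \<cdot> x" if "x \<in> dom T" for x
    using square_app[of x S] that domT by (simp add: S)
  have comV: "commutes_with S V"
    unfolding commutes_with_def
  proof
    fix x assume x: "x \<in> dom S"
    define y where "y = resolvent T 1 x"
    have y: "y \<in> dom T" "T \<cdot> y = x - y"
      using resolvent_dom[OF shift_onto] resolvent_app[OF shift_onto] by (simp_all add: y_def)
    hence y': "y \<in> dom S" "S \<cdot> y \<in> dom S" "S \<cdot> S \<cdot> y = x - y" using T domT by auto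
    have Sy: "S \<cdot> y \<in> dom T" using y' x by (simp add: domT linear_op_intros[OF l])
    have "T \<cdot> (S \<cdot> y) + 1 *\<^sub>C (S \<cdot> y) = S \<cdot> x"
      using y' x by (simp add: T[OF Sy] linear_op_simps[OF l])
    hence "S \<cdot> y = resolvent T 1 (S \<cdot> x)"
      using resolvent_unique[OF accretive shift_onto _ Sy] by simp
    thus "bap V x \<in> dom S \<and> S \<cdot> bap V x = bap V (S \<cdot> x)"
      using x y'(1) by (simp add: V y_def[symmetric] linear_op_simps[OF l] linear_op_intros[OF l])
  qed
  hence comV': "commutes_with S (- V)"
    by (auto simp: commutes_with_def bap_simps linear_op_simps[OF l] linear_op_intros[OF l])
  have comP: "commutes_with S P" and comQ: "commutes_with S Q"
    unfolding P_def Q_def by (intro commutes_with_sqrt_series mS comV comV'; simp add: V)+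
  have core: "S \<cdot> bap P (bap P c) = bap Q (bap P c)" if "c \<in> dom T" for c
  proof -
    have c: "c \<in> dom S" using that domT by auto
    define p where "p = bap P (bap P c)"
    have p: "p \<in> dom T" "p \<in> dom S" "S \<cdot> p \<in> dom S" using domT by (auto simp: p_def dom_T)
    note P = commutes_withD[OF comP] and Q = commutes_withD[OF comQ]
    have Sp: "S \<cdot> p = bap P (bap P (S \<cdot> c))" by (simp add: p_def P c)
    have rp: "root \<cdot> p = bap Q (bap P c)" by (simp add: p_def)
    define y where "y = S \<cdot> p - root \<cdot> p"
    have yS: "y \<in> dom S" unfolding y_def rp by (intro linear_op_intros[OF l] p Q P c)
    have yr: "y \<in> dom root" unfolding y_def rp Sp by (intro linear_op_intros[OF linear_root]) (auto simp flip: PQ)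
    have "S \<cdot> y = T \<cdot> p - bap Q (bap P (S \<cdot> c))"
      unfolding y_def rp using T[OF p(1)] p by (simp add: linear_op_simps[OF l] Q P c)
    moreover have "root \<cdot> y = bap Q (bap P (S \<cdot> c)) - T \<cdot> p"
      unfolding y_def rp Sp
      by (subst linear_op_diff(2)[OF linear_root]) (auto simp: p_def T_PP simp flip: PQ)
    ultimately have sum: "S \<cdot> y = - (root \<cdot> y)" by simp
    have "Re (cinner (S \<cdot> y) y) = - Re (cinner (root \<cdot> y) y)" by (simp add: sum cinner_simps)
    hence "Re (cinner (root \<cdot> y) y) = 0"
      using accretiveD[OF S(1) yS] accretiveD[OF angle_accretive_pi4_accretive[OF angle_root] yr] by simp
    hence r0: "root \<cdot> y = 0"
      by (rule sectorial_form_eq_0[OF angle_root m_accretive_dense[OF root_m_accretive] yr])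
    hence s0: "S \<cdot> y = 0" by (simp add: sum)
    have "cinner (S \<cdot> p) y = 0" by (rule accretive_null_orthogonal_range[OF S(1) yS s0 p(2)])
    moreover have "cinner (root \<cdot> p) y = 0"
      by (rule accretive_null_orthogonal_range[OF angle_accretive_pi4_accretive[OF angle_root] yr r0])
        (simp add: p_def)
    ultimately have "cinner y y = 0" by (simp add: y_def cinner_diff_left)
    hence "y = 0" by (simp add: cinner_self)
    thus ?thesis by (simp add: y_def rp p_def[symmetric])
  qed
  have ext: "x \<in> dom S \<and> S \<cdot> x = root \<cdot> x" if x: "x \<in> dom root" for x
  proof -
    obtain a where a: "x = bap P a" using x by (auto simp: dom_root)
    \<comment> \<open>\<open>P\<close> maps the dense domain of \<open>T\<close> onto a dense set.\<close>
    have "\<exists>c\<in>dom T. dist (bap P c) a < e" if e: "e > 0" for e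
    proof -
      have "a \<in> closure (range (bap P))"
        using m_accretive_dense[OF root_m_accretive] by (simp add: dom_root)
      then obtain b where b: "dist (bap P b) a < e / 2"
        using e unfolding closure_approachable by (metis half_gt_zero rangeE)
      define n where "n = norm P + 1"
      have n: "n > 0" by (simp add: n_def add_nonneg_pos)
      have "b \<in> closure (dom T)" using m_accretive_dense[OF m_accretive] by simp
      then obtain c where c: "c \<in> dom T" "dist c b < e / (2 * n)"
        using e n unfolding closure_approachable by (metis divide_pos_pos mult_pos_pos zero_less_numeral)
      have "dist (bap P c) (bap P b) \<le> norm P * dist c b"
        using norm_bap[of P "c - b"] by (simp add: dist_norm bap_right)
      also have "\<dots> \<le> n * dist c b" by (intro mult_right_mono) (auto simp: n_def)
      also have "\<dots> < e / 2" using c(2) n by (simp add: field_simps)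
      finally show ?thesis
        using c(1) b dist_triangle_half_l[of "bap P c" "bap P b" e a] by (auto simp: dist_commute)
    qed
    hence "a \<in> closure (bap P ` dom T)" unfolding closure_approachable by blast
    then obtain v where v: "\<And>n. v n \<in> bap P ` dom T" "v \<longlonglongrightarrow> a"
      unfolding closure_sequential by blast
    have *: "bap P (v n) \<in> dom S" "S \<cdot> bap P (v n) = bap Q (v n)" for n
    proof -
      obtain c where c: "c \<in> dom T" "v n = bap P c" using v(1)[of n] by blast
      have "bap P (bap P c) \<in> dom T" by (auto simp: dom_T)
      thus "bap P (v n) \<in> dom S" "S \<cdot> bap P (v n) = bap Q (v n)"
        using core[OF c(1)] domT by (auto simp: c(2))
    qed
    have lims: "(\<lambda>n. bap P (v n)) \<longlonglongrightarrow> x" "(\<lambda>n. S \<cdot> bap P (v n)) \<longlonglongrightarrow> root \<cdot> x"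
      unfolding * a root_P by (intro tendsto_bap tendsto_const v)+
    thus ?thesis using m_accretive_closed[OF mS *(1) lims] by blast
  qed
  show ?thesis
    by (rule m_accretive_maximal[OF root_m_accretive S(1)]) (use ext in auto)
qed

lemma op_sqrt_eq_root: "op_sqrt T = root"
  unfolding op_sqrt_def
proof (rule the_equality)
  show "m_angle_accretive (pi / 4) root \<and> root \<circ>\<^sub>m root = T"
    by (simp add: m_angle_root square_root)
  show "S = root" if "m_angle_accretive (pi / 4) S \<and> S \<circ>\<^sub>m S = T" for S
    using that by (intro root_unique) (auto simp: m_angle_accretive_def m_accretive_accretive)
qed

end

theorem op_sqrt:
  assumes "m_accretive T"
  shows m_angle_accretive_op_sqrt: "m_angle_accretive (pi / 4) (op_sqrt T)"
    and op_sqrt_square: "op_sqrt T \<circ>\<^sub>m op_sqrt T = T"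
    and op_sqrt_unique: "accretive S \<Longrightarrow> S \<circ>\<^sub>m S = T \<Longrightarrow> S = op_sqrt T"
proof -
  interpret m_accretive_operator T by unfold_locales (rule assms)
  show "m_angle_accretive (pi / 4) (op_sqrt T)" "op_sqrt T \<circ>\<^sub>m op_sqrt T = T"
    "accretive S \<Longrightarrow> S \<circ>\<^sub>m S = T \<Longrightarrow> S = op_sqrt T"
    using m_angle_root square_root root_unique by (simp_all add: op_sqrt_eq_root)
qed

section \<open>Exponentials of dissipative bounded operators\<close>

lemma bap_exp_has_vector_derivative:
  "((\<lambda>t. bap (exp (t *\<^sub>R X)) x) has_vector_derivative bap (exp (t *\<^sub>R X)) (bap X x)) (at t within S)"
  using bounded_linear.has_vector_derivative[OF bounded_linear_bap_left
      exp_scaleR_has_vector_derivative_right[of X t S], of x]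
  by (simp add: bap_simps)

text \<open>
  The derivative of \<open>\<bar>exp (t X) x\<bar>\<^sup>2\<close> is twice the real part of the form of \<open>X\<close> at \<open>exp (t X) x\<close>.
\<close>

lemma norm_exp_dissipative:
  fixes X :: "'a::complex_hilbert bop"
  assumes X: "\<And>u. Re (cinner (bap X u) u) \<le> 0"
  shows "norm (bap (exp X) x) \<le> norm x"
proof -
  define u where "u t = bap (exp (t *\<^sub>R X)) x" for t :: real
  have u': "(u has_vector_derivative bap X (u t)) (at t)" for t
  proof -
    have "bap (exp (t *\<^sub>R X)) (bap X x) = bap X (u t)"
      unfolding u_def by (metis bap_simps(6) exp_times_scaleR_commute)
    thus ?thesis
      using bap_exp_has_vector_derivative[of X x t UNIV] unfolding u_def by simp
  qed
  have "((\<lambda>t. Re (cinner (u t) (u t))) has_real_derivative 2 * Re (cinner (bap X (u t)) (u t))) (at t)" for t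
  proof -
    have "((\<lambda>t. cinner (u t) (u t)) has_vector_derivative
        (cinner (u t) (bap X (u t)) + cinner (bap X (u t)) (u t))) (at t)"
      by (rule bounded_bilinear.has_vector_derivative[OF bounded_bilinear_cinner u' u'])
    hence "((\<lambda>t. Re (cinner (u t) (u t))) has_vector_derivative
        Re (cinner (u t) (bap X (u t)) + cinner (bap X (u t)) (u t))) (at t)"
      by (rule bounded_linear.has_vector_derivative[OF bounded_linear_Re])
    thus ?thesis
      by (simp add: has_real_derivative_iff_has_vector_derivative Re_cinner_commute[of "u t"])
  qed
  hence "Re (cinner (u 1) (u 1)) \<le> Re (cinner (u 0) (u 0))"
    by (intro DERIV_nonpos_imp_nonincreasing[of 0 1]) (use X in fastforce)+
  hence "(norm (u 1))\<^sup>2 \<le> (norm (u 0))\<^sup>2" by (simp add: Re_cinner_self)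
  thus ?thesis by (simp add: u_def bap_simps power2_le_iff_abs_le)
qed

lemma norm_diff_le_of_derivative:
  fixes f :: "real \<Rightarrow> 'a::real_normed_vector"
  assumes "0 \<le> h" "\<And>t. (f has_vector_derivative f' t) (at t)"
    "\<And>t. 0 < t \<Longrightarrow> t < h \<Longrightarrow> norm (f' t) \<le> B"
  shows "norm (f h - f 0) \<le> h * B"
proof (cases "h = 0")
  case False
  have "norm (f h - f 0) \<le> h * B - 0 * B"
  proof (rule differentiable_bound_general[where f' = f' and \<phi>' = "\<lambda>_. B"])
    show "continuous_on {0..h} f"
      using assms(2) by (intro continuous_at_imp_continuous_on ballI has_vector_derivative_continuous)
    show "((\<lambda>t. t * B) has_vector_derivative B) (at t)" for t :: real
      by (auto intro!: derivative_eq_intros)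
  qed (use assms False in \<open>auto intro!: continuous_intros\<close>)
  thus ?thesis by simp
qed simp

text \<open>
  The segment from \<open>Z\<close> to \<open>X\<close> consists of dissipative operators, and along it the derivative of the
  exponential is \<open>exp (Z + t (X - Z)) (X - Z)\<close>.
\<close>

lemma norm_exp_diff_le:
  fixes X Z :: "'a::complex_hilbert bop"
  assumes X: "\<And>u. Re (cinner (bap X u) u) \<le> 0" and Z: "\<And>u. Re (cinner (bap Z u) u) \<le> 0"
    and XZ: "X * Z = Z * X"
  shows "norm (bap (exp X) x - bap (exp Z) x) \<le> norm (bap X x - bap Z x)"
proof -
  define f where "f t = bap (exp Z) (bap (exp (t *\<^sub>R (X - Z))) x)" for t :: real
  have "norm (f 1 - f 0) \<le> 1 * norm (bap X x - bap Z x)"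
  proof (rule norm_diff_le_of_derivative)
    show "(f has_vector_derivative bap (exp Z) (bap (exp (t *\<^sub>R (X - Z))) (bap (X - Z) x))) (at t)" for t
      unfolding f_def
      by (rule bounded_linear.has_vector_derivative[OF bounded_linear_bap_right bap_exp_has_vector_derivative])
    fix t :: real assume t: "0 < t" "t < 1"
    have "Z * (t *\<^sub>R (X - Z)) = (t *\<^sub>R (X - Z)) * Z" using XZ by (simp add: algebra_simps)
    hence "exp Z * exp (t *\<^sub>R (X - Z)) = exp (Z + t *\<^sub>R (X - Z))" by (simp add: exp_add_commuting)
    moreover have "norm (bap (exp (Z + t *\<^sub>R (X - Z))) v) \<le> norm v" for v
    proof (rule norm_exp_dissipative)
      fix u
      have "Re (cinner (bap (Z + t *\<^sub>R (X - Z)) u) u)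
          = t * Re (cinner (bap X u) u) + (1 - t) * Re (cinner (bap Z u) u)"
        by (simp add: bap_simps cinner_simps algebra_simps)
      also have "\<dots> \<le> 0" using t X Z by (intro add_nonpos_nonpos mult_nonneg_nonpos) auto
      finally show "Re (cinner (bap (Z + t *\<^sub>R (X - Z)) u) u) \<le> 0" .
    qed
    ultimately show "norm (bap (exp Z) (bap (exp (t *\<^sub>R (X - Z))) (bap (X - Z) x))) \<le> norm (bap X x - bap Z x)"
      by (metis bap_simps(4) bap_simps(6))
  qed simp
  moreover have "f 1 = bap (exp X) x"
  proof -
    have "exp Z * exp (X - Z) = exp (Z + (X - Z))"
      using XZ by (intro exp_add_commuting[symmetric]) (simp add: algebra_simps)
    thus ?thesis by (simp add: f_def flip: bap_simps(6))
  qed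
  moreover have "f 0 = bap (exp Z) x" by (simp add: f_def bap_simps)
  ultimately show ?thesis by simp
qed

text \<open>
  The exponential series is an everywhere convergent power series in \<open>z\<close>.
\<close>

lemma holomorphic_exp_matrix_coefficient:
  fixes X :: "'a::complex_hilbert bop"
  shows "(\<lambda>z. cinner (bap (exp (bop_scalar z * X)) x) y) holomorphic_on UNIV"
proof -
  define g where "g z = cinner (bap (exp (bop_scalar z * X)) x) y" for z
  have pow: "bap ((bop_scalar z * X) ^ k) v = z ^ k *\<^sub>C bap (X ^ k) v" for z k v
    by (induction k arbitrary: v) (simp_all add: bap_simps bap_scaleC scaleC_scaleC mult.commute)
  have "(\<lambda>k. (cinner (bap (X ^ k) x) y / fact k) * (w - 0) ^ k) sums g w" for w
  proof -
    have "bounded_linear (\<lambda>Y. cinner (bap Y x) y)"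
      by (rule bounded_linear_compose[OF bounded_bilinear.bounded_linear_left[OF bounded_bilinear_cinner]
            bounded_linear_bap_left])
    from bounded_linear.sums[OF this exp_converges[of "bop_scalar w * X"]]
    show ?thesis
      by (simp add: g_def pow bap_simps cinner_simps field_simps)
  qed
  hence "g holomorphic_on ball 0 r" for r
    by (intro power_series_holomorphic[where a = "\<lambda>k. cinner (bap (X ^ k) x) y / fact k"])
  hence "g field_differentiable at z" for z
    using holomorphic_on_imp_differentiable_at[of g "ball 0 (norm z + 1)" z] by simp
  thus ?thesis by (simp add: g_def[abs_def] holomorphic_on_def field_differentiable_at_within)
qed

text \<open>Cauchy's estimate for the second derivative and Taylor's formula.\<close>

lemma holomorphic_linear_remainder:
  fixes g :: "complex \<Rightarrow> complex"
  assumes g: "g holomorphic_on UNIV" and d: "d > 0"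
    and M: "\<And>w. w \<in> ball z d \<Longrightarrow> cmod (g w) \<le> M" and h: "cmod h < d / 2"
  shows "cmod (g (z + h) - g z - h * deriv g z) \<le> 32 * M / d\<^sup>2 * (cmod h)\<^sup>2"
proof -
  have hol: "(deriv ^^ i) g holomorphic_on UNIV" for i
    by (rule holomorphic_higher_deriv[OF g]) simp
  have "cmod ((deriv ^^ 0) g (z + h) - (\<Sum>i\<le>1. (deriv ^^ i) g z * ((z + h) - z) ^ i / fact i))
      \<le> (32 * M / d\<^sup>2) * cmod ((z + h) - z) ^ Suc 1 / fact 1"
  proof (rule complex_Taylor[of "ball z (d / 2)"])
    fix i :: nat and x assume "x \<in> ball z (d / 2)"
    have "((deriv ^^ i) g has_field_derivative deriv ((deriv ^^ i) g) x) (at x)"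
      by (rule holomorphic_derivI[OF hol]) auto
    thus "((deriv ^^ i) g has_field_derivative (deriv ^^ Suc i) g x) (at x within ball z (d / 2))"
      by (simp add: has_field_derivative_at_within)
  next
    fix x assume x: "x \<in> ball z (d / 2)"
    have "cmod ((deriv ^^ 2) g x) \<le> fact 2 * M / (d / 4)\<^sup>2"
    proof (rule Cauchy_inequality)
      show "g holomorphic_on ball x (d / 4)" "continuous_on (cball x (d / 4)) g"
        using g holomorphic_on_imp_continuous_on holomorphic_on_subset by blast+
      show "cmod (g w) \<le> M" if "cmod (x - w) = d / 4" for w
      proof (rule M)
        have "dist z w \<le> dist z x + dist x w" by (rule dist_triangle)
        thus "w \<in> ball z d" using x that d by (simp add: dist_norm)
      qed
    qed (use d in simp)
    thus "cmod ((deriv ^^ Suc 1) g x) \<le> 32 * M / d\<^sup>2"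
      by (simp add: numeral_2_eq_2 power_divide field_simps)
  qed (use d h in \<open>auto simp: dist_norm\<close>)
  thus ?thesis by (simp add: numeral_2_eq_2 algebra_simps)
qed

section \<open>Holomorphic semigroups generated by sectorial operators\<close>

lemma resolvent_commute:
  assumes T: "m_accretive T" and s: "Re z > 0" "Re w > 0"
  shows "resolvent T z (resolvent T w x) = resolvent T w (resolvent T z x)"
proof -
  note a = m_accretive_accretive[OF T] and l = m_accretive_linear[OF T]
  note sz = m_accretive_shift_onto[OF T s(1)] and sw = m_accretive_shift_onto[OF T s(2)]
  define v where "v = resolvent T z (resolvent T w x)"
  define u where "u = T \<cdot> v + w *\<^sub>C v"
  have v: "v \<in> dom T" "T \<cdot> v = resolvent T w x - z *\<^sub>C v"
    unfolding v_def by (rule resolvent_dom[OF sz], rule resolvent_app[OF sz])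
  have r: "resolvent T w x \<in> dom T" "T \<cdot> resolvent T w x + w *\<^sub>C resolvent T w x = x"
    by (rule resolvent_dom[OF sw], rule resolvent_eq[OF sw])
  have Tv: "T \<cdot> v \<in> dom T" unfolding v(2) by (intro linear_op_intros[OF l] r v)
  have u: "u \<in> dom T" unfolding u_def by (intro linear_op_intros[OF l] Tv v)
  have "T \<cdot> u + z *\<^sub>C u = T \<cdot> (T \<cdot> v + z *\<^sub>C v) + w *\<^sub>C (T \<cdot> v + z *\<^sub>C v)"
    unfolding u_def
    by (simp add: linear_op_simps[OF l] linear_op_intros[OF l] v(1) Tv scaleC_add_right scaleC_scaleC mult.commute)
  also have "T \<cdot> v + z *\<^sub>C v = resolvent T w x" by (simp add: v(2))
  finally have "T \<cdot> u + z *\<^sub>C u = x" by (simp only: r(2))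
  hence "u = resolvent T z x" using resolvent_unique[OF a sz s(1) u] by metis
  thus ?thesis using resolvent_unique[OF a sw s(2) v(1)] by (simp add: u_def v_def)
qed

lemma convergent_dense:
  fixes L :: "nat \<Rightarrow> 'a::banach \<Rightarrow> 'a"
  assumes D: "closure D = UNIV" and L: "\<And>n x y. norm (L n x - L n y) \<le> norm (x - y)"
    and conv: "\<And>x. x \<in> D \<Longrightarrow> Cauchy (\<lambda>n. L n x)"
  shows "convergent (\<lambda>n. L n x)"
proof (rule Cauchy_convergent, rule metric_CauchyI)
  fix e :: real assume e: "e > 0"
  obtain v where v: "v \<in> D" "dist v x < e / 3"
    using D e closure_approachable[of x D] by (metis UNIV_I divide_pos_pos zero_less_numeral)
  obtain N where N: "\<And>m n. m \<ge> N \<Longrightarrow> n \<ge> N \<Longrightarrow> dist (L m v) (L n v) < e / 3"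
    using conv[OF v(1)] e unfolding Cauchy_def by (metis divide_pos_pos zero_less_numeral)
  have "dist (L m x) (L n x) < e" if "m \<ge> N" "n \<ge> N" for m n
  proof -
    have "dist (L m x) (L m v) < e / 3" "dist (L n v) (L n x) < e / 3"
      using L[of m x v] L[of n v x] v(2) by (simp_all add: dist_norm norm_minus_commute)
    thus ?thesis using N[OF that] dist_triangle[of "L m x" "L n x" "L m v"]
        dist_triangle[of "L m v" "L n x" "L n v"] by linarith
  qed
  thus "\<exists>N. \<forall>m\<ge>N. \<forall>n\<ge>N. dist (L m x) (L n x) < e" by blast
qed

lemma yosida_exists:
  fixes T :: "'a::complex_hilbert \<rightharpoonup> 'a"
  assumes T: "m_accretive T" and r: "r > 0"
  obtains Y where "\<And>x. bap Y x = r *\<^sub>R (T \<cdot> resolvent T (of_real r) x)" "sc_of Y = 0"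
proof -
  note a = m_accretive_accretive[OF T]
  have r': "Re (of_real r) > 0" using r by simp
  have s: "shift_onto T (of_real r)" by (rule m_accretive_shift_onto[OF T r'])
  have eq: "r *\<^sub>R (T \<cdot> resolvent T (of_real r) x) = r *\<^sub>R (x - r *\<^sub>R resolvent T (of_real r) x)" for x
    by (simp add: resolvent_app[OF s] scaleR_scaleC)
  define f where "f x = r *\<^sub>R (x - r *\<^sub>R resolvent T (of_real r) x)" for x
  have add: "f (x + y) = f x + f y" for x y
    unfolding f_def resolvent_add[OF a s r'] by (simp add: algebra_simps)
  have hom: "f (c *\<^sub>C x) = c *\<^sub>C f x" for c x
    unfolding f_def resolvent_scaleC[OF a s r']
    by (simp add: scaleR_scaleC scaleC_scaleC scaleC_diff_right mult_ac)
  have bound: "norm (f x) \<le> 2 * r * norm x" for x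
  proof -
    have "norm (x - r *\<^sub>R resolvent T (of_real r) x) \<le> norm x + r * norm (resolvent T (of_real r) x)"
      using norm_triangle_ineq4[of x "r *\<^sub>R resolvent T (of_real r) x"] r by simp
    also have "\<dots> \<le> norm x + r * (norm x / r)"
      using resolvent_norm[OF a s r', of x] r by (intro add_left_mono mult_left_mono) auto
    also have "\<dots> = 2 * norm x" using r by simp
    finally show ?thesis using r by (simp add: f_def)
  qed
  have "2 * r \<ge> 0" using r by simp
  from bop_exists[OF add hom bound this] obtain Y where "\<And>x. bap Y x = f x" "sc_of Y = 0" by blast
  thus ?thesis using that[of Y] unfolding eq f_def by blast
qed

lemma dom_op_uminus [simp]: "dom (op_uminus T) = dom T"
  by (auto simp: op_uminus_def domIff)

lemma op_uminus_app: "x \<in> dom T \<Longrightarrow> op_uminus T \<cdot> x = - (T \<cdot> x)"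
  by (auto simp: op_uminus_def op_app_def domIff)

lemma generator_eq:
  "generator U x = (if \<exists>y. ((\<lambda>h. (blinfun_apply (U h) x - x) /\<^sub>R h) \<longlongrightarrow> y) (at_right 0)
    then Some (Lim (at_right 0) (\<lambda>h. (blinfun_apply (U h) x - x) /\<^sub>R h)) else None)"
  by (simp only: generator_def Let_def)

lemma generatorI:
  assumes "((\<lambda>h. (blinfun_apply (U h) x - x) /\<^sub>R h) \<longlongrightarrow> y) (at_right 0)"
  shows "x \<in> dom (generator U)" "generator U \<cdot> x = y"
proof -
  have "generator U x = Some y"
    unfolding generator_eq tendsto_Lim[OF trivial_limit_at_right_real assms]
    by (rule if_P) (rule exI, rule assms)
  thus "x \<in> dom (generator U)" "generator U \<cdot> x = y" by (simp_all add: domIff op_app_def)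
qed

lemma generatorD:
  assumes "x \<in> dom (generator U)"
  shows "((\<lambda>h. (blinfun_apply (U h) x - x) /\<^sub>R h) \<longlongrightarrow> generator U \<cdot> x) (at_right 0)"
proof -
  have "\<exists>y. ((\<lambda>h. (blinfun_apply (U h) x - x) /\<^sub>R h) \<longlongrightarrow> y) (at_right 0)"
    using assms unfolding domIff generator_eq by meson
  then obtain y where y: "((\<lambda>h. (blinfun_apply (U h) x - x) /\<^sub>R h) \<longlongrightarrow> y) (at_right 0)" ..
  show ?thesis unfolding generatorI(2)[OF y] by (rule y)
qed

lemma sector_pi4:
  assumes "z \<in> sector (pi / 4)"
  shows "\<bar>Im z\<bar> < Re z"
proof -
  have z: "z \<noteq> 0" and a: "\<bar>Arg z\<bar> < pi / 4" using assms by (auto simp: sector_def)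
  have zeq: "z = of_real (cmod z) * cis (Arg z)"
    using rcis_cmod_Arg[of z] by (simp add: rcis_def)
  have ri: "Re z = cmod z * cos (Arg z)" "Im z = cmod z * sin (Arg z)"
    using arg_cong[OF zeq, of Re] arg_cong[OF zeq, of Im] by simp_all
  have "sin \<bar>Arg z\<bar> < sin (pi / 4)" using a by (intro sin_monotone_2pi) auto
  also have "\<dots> = cos (pi / 4)" by (simp add: sin_45 cos_45)
  also have "\<dots> < cos \<bar>Arg z\<bar>" using a by (intro cos_monotone_0_pi) auto
  finally have "sin \<bar>Arg z\<bar> < cos (Arg z)" by simp
  moreover have "sin \<bar>Arg z\<bar> = \<bar>sin (Arg z)\<bar>"
    using a sin_ge_zero[of "\<bar>Arg z\<bar>"] by (auto simp: abs_if split: if_splits)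
  ultimately show ?thesis using z by (simp add: ri abs_mult)
qed

lemma norm_bop_le:
  assumes "sc_of X = 0" "\<And>x. norm (bap X x) \<le> K * norm x" "K \<ge> 0"
  shows "norm X \<le> K"
  using norm_blinfun_bound[of K "op_of X"] assms by (simp add: norm_bop_def bap_def)

lemma norm_op_of_scalar_times: "norm (op_of (bop_scalar h * X)) \<le> norm X * cmod h"
proof (rule norm_blinfun_bound)
  fix x
  have "norm (bap (bop_scalar h * X) x) = cmod h * norm (bap X x)" by (simp add: bap_simps norm_scaleC)
  also have "\<dots> \<le> cmod h * (norm X * norm x)" by (intro mult_left_mono norm_bap) simp
  finally show "norm (blinfun_apply (op_of (bop_scalar h * X)) x) \<le> norm X * cmod h * norm x"
    by (simp add: bap_def mult_ac)
qed simp

locale sectorial_operator =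
  fixes T :: "'a::complex_hilbert \<rightharpoonup> 'a"
  assumes m_sectorial: "m_angle_accretive (pi / 4) T"
begin

lemma m_accretive: "m_accretive T"
  using m_sectorial by (simp add: m_angle_accretive_def)

lemma accretive: "accretive T"
  by (rule m_accretive_accretive[OF m_accretive])

lemma linear: "linear_op T"
  by (rule accretive_linear[OF accretive])

lemma dense: "closure (dom T) = UNIV"
  by (rule m_accretive_dense[OF m_accretive])

lemma sector_T: "x \<in> dom T \<Longrightarrow> \<bar>Im (cinner (T \<cdot> x) x)\<bar> \<le> Re (cinner (T \<cdot> x) x)"
  using m_sectorial by (simp add: m_angle_accretive_def angle_accretive_pi4)

text \<open>
  The parameter of the resolvents and of the Yosida approximations \<open>Y n\<close> is \<open>Suc n\<close>, which is positive
  for all \<open>n\<close>.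
\<close>

definition R :: "nat \<Rightarrow> 'a \<Rightarrow> 'a" where "R n = resolvent T (of_real (real (Suc n)))"

definition Y :: "nat \<Rightarrow> 'a bop"
  where "Y n = (SOME Y. sc_of Y = 0 \<and> (\<forall>x. bap Y x = real (Suc n) *\<^sub>R (T \<cdot> R n x)))"

lemma Re_Suc: "Re (of_real (real (Suc n))) > 0" by simp

lemma shift_R: "shift_onto T (of_real (real (Suc n)))"
  by (rule m_accretive_shift_onto[OF m_accretive Re_Suc])

lemma R_dom: "R n x \<in> dom T"
  unfolding R_def by (rule resolvent_dom[OF shift_R])

lemma R_app: "T \<cdot> R n x = x - real (Suc n) *\<^sub>R R n x"
  unfolding R_def scaleR_scaleC by (rule resolvent_app[OF shift_R])

lemma Y_T: "bap (Y n) x = real (Suc n) *\<^sub>R (T \<cdot> R n x)"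
  and sc_of_Y [simp]: "sc_of (Y n) = 0"
proof -
  have "\<exists>Y. sc_of Y = 0 \<and> (\<forall>x. bap Y x = real (Suc n) *\<^sub>R (T \<cdot> R n x))"
    using yosida_exists[OF m_accretive, of "real (Suc n)"] unfolding R_def by (metis of_nat_0_less_iff zero_less_Suc)
  from someI_ex[OF this] show "bap (Y n) x = real (Suc n) *\<^sub>R (T \<cdot> R n x)" "sc_of (Y n) = 0"
    by (simp_all add: Y_def)
qed

lemma Y_R: "bap (Y n) x = real (Suc n) *\<^sub>R (x - real (Suc n) *\<^sub>R R n x)"
  unfolding Y_T R_app ..

lemma R_T: "x \<in> dom T \<Longrightarrow> R n (T \<cdot> x) = T \<cdot> R n x"
proof -
  assume x: "x \<in> dom T"
  have "R n (T \<cdot> x + of_real (real (Suc n)) *\<^sub>C x) = x"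
    unfolding R_def by (rule resolvent_unique[OF accretive shift_R Re_Suc x])
  hence "R n (T \<cdot> x) + of_real (real (Suc n)) *\<^sub>C R n x = x"
    unfolding R_def resolvent_add[OF accretive shift_R Re_Suc] resolvent_scaleC[OF accretive shift_R Re_Suc] .
  thus ?thesis by (simp add: R_app scaleR_scaleC eq_diff_eq)
qed

lemma norm_R: "real (Suc n) * norm (R n x) \<le> norm x"
  using resolvent_norm[OF accretive shift_R Re_Suc, of n x] by (simp add: R_def field_simps)

lemma R_commute: "R n (R m x) = R m (R n x)"
  unfolding R_def by (rule resolvent_commute[OF m_accretive Re_Suc Re_Suc])

lemma R_linear: "R n (x - y) = R n x - R n y" "R n (r *\<^sub>R x) = r *\<^sub>R R n x"
  unfolding R_def scaleR_scaleC
  by (rule resolvent_diff[OF accretive shift_R Re_Suc], rule resolvent_scaleC[OF accretive shift_R Re_Suc])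

lemma Y_commute: "Y n * Y m = Y m * Y n"
proof (rule bop_commuteI)
  fix x
  show "bap (Y n) (bap (Y m) x) = bap (Y m) (bap (Y n) x)"
    unfolding Y_R R_linear R_commute[of n m] by (simp add: algebra_simps)
qed

text \<open>
  With \<open>x = T y + r y\<close> the form of \<open>Y n\<close> at \<open>x\<close> is \<open>r \<bar>T y\<bar>\<^sup>2 + r\<^sup>2 \<langle>T y, y\<rangle>\<close>, a point of the same sector.
\<close>

lemma Y_sector: "\<bar>Im (cinner (bap (Y n) x) x)\<bar> \<le> Re (cinner (bap (Y n) x) x)"
proof -
  define y where "y = R n x"
  define r where "r = real (Suc n)"
  have x: "x = T \<cdot> y + r *\<^sub>R y" by (simp add: y_def r_def R_app)
  have "bap (Y n) x = r *\<^sub>R (T \<cdot> y)" by (simp add: Y_T y_def r_def)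
  hence N: "cinner (bap (Y n) x) x = of_real (r * (norm (T \<cdot> y))\<^sup>2) + of_real (r * r) * cinner (T \<cdot> y) y"
    by (simp add: x cinner_simps cinner_self algebra_simps)
  have r: "r > 0" by (simp add: r_def)
  have "\<bar>r * r * Im (cinner (T \<cdot> y) y)\<bar> \<le> r * r * Re (cinner (T \<cdot> y) y)"
    using sector_T[OF R_dom, of n x] r by (simp add: y_def abs_mult mult_left_mono)
  thus ?thesis using r unfolding N by (simp add: add_nonneg_nonneg add_increasing)
qed

lemma Y_dom: "x \<in> dom T \<Longrightarrow> norm (bap (Y n) x) \<le> norm (T \<cdot> x)"
  using norm_R[of n "T \<cdot> x"] by (simp add: Y_T R_T flip: R_T)

lemma Y_tendsto: "x \<in> dom T \<Longrightarrow> (\<lambda>n. bap (Y n) x) \<longlonglongrightarrow> T \<cdot> x"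
proof -
  have D: "(\<lambda>n. real (Suc n) *\<^sub>R R n v) \<longlonglongrightarrow> v" for v
  proof -
    have *: "norm (real (Suc n) *\<^sub>R R n x - real (Suc n) *\<^sub>R R n y) \<le> norm (x - y)" for n x y
      using norm_R[of n "x - y"] by (simp add: R_linear flip: scaleR_diff_right)
    have "(\<lambda>n. real (Suc n) *\<^sub>R R n w) \<longlonglongrightarrow> w" if w: "w \<in> dom T" for w
    proof -
      have "norm (real (Suc n) *\<^sub>R R n w - w) \<le> norm (T \<cdot> w) * inverse (real (Suc n))" for n
      proof -
        have eq: "real (Suc n) *\<^sub>R R n w - w = - R n (T \<cdot> w)"
          by (simp only: R_T[OF w] R_app minus_diff_eq)
        have "norm (real (Suc n) *\<^sub>R R n w - w) = norm (R n (T \<cdot> w))"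
          by (simp only: eq norm_minus_cancel)
        also have "\<dots> \<le> norm (T \<cdot> w) * inverse (real (Suc n))"
          unfolding R_def using resolvent_norm[OF accretive shift_R Re_Suc, of n "T \<cdot> w"]
          by (simp only: Re_complex_of_real divide_inverse)
        finally show ?thesis .
      qed
      note bound = this
      have "(\<lambda>n. norm (T \<cdot> w) * inverse (real (Suc n))) \<longlonglongrightarrow> 0"
        by (rule tendsto_mult_right_zero[OF LIMSEQ_inverse_real_of_nat])
      hence "(\<lambda>n. real (Suc n) *\<^sub>R R n w - w) \<longlonglongrightarrow> 0"
        by (rule Lim_null_comparison[OF always_eventually[OF allI[OF bound]]])
      thus ?thesis by (rule LIM_zero_cancel)
    qed
    note lim = this
    show ?thesis
    proof (rule metric_LIMSEQ_I)
      fix e :: real assume e: "e > 0"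
      obtain w where w: "w \<in> dom T" "dist w v < e / 3"
        using dense e closure_approachable[of v "dom T"] by (metis UNIV_I divide_pos_pos zero_less_numeral)
      obtain N where N: "\<And>n. n \<ge> N \<Longrightarrow> dist (real (Suc n) *\<^sub>R R n w) w < e / 3"
        using lim[OF w(1)] e unfolding lim_sequentially by (metis divide_pos_pos zero_less_numeral)
      have "dist (real (Suc n) *\<^sub>R R n v) v < e" if "n \<ge> N" for n
      proof -
        have "dist (real (Suc n) *\<^sub>R R n v) (real (Suc n) *\<^sub>R R n w) < e / 3"
          using *[of n v w] w(2) by (simp only: dist_norm norm_minus_commute)
        thus ?thesis using N[OF that] w(2) dist_triangle[of "real (Suc n) *\<^sub>R R n v" v "real (Suc n) *\<^sub>R R n w"]
            dist_triangle[of "real (Suc n) *\<^sub>R R n w" v w] by linarith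
      qed
      thus "\<exists>N. \<forall>n\<ge>N. dist (real (Suc n) *\<^sub>R R n v) v < e" by blast
    qed
  qed
  assume x: "x \<in> dom T"
  show ?thesis using D[of "T \<cdot> x"] by (simp add: Y_T R_T[OF x])
qed

definition E :: "nat \<Rightarrow> complex \<Rightarrow> 'a bop" where "E n z = exp (bop_scalar z * (- Y n))"

text \<open>
  Multiplication by \<open>z\<close> in the sector rotates the numerical range of \<open>Y n\<close>, which lies in a sector of the
  same angle, by at most \<open>\<pi>/4\<close>, hence not beyond the imaginary axis.
\<close>

lemma dissipative_Y:
  assumes "\<bar>Im z\<bar> \<le> Re z"
  shows "Re (cinner (bap (bop_scalar z * (- Y n)) u) u) \<le> 0"
proof -
  have "\<bar>Im z * Im (cinner (bap (Y n) u) u)\<bar> \<le> Re z * Re (cinner (bap (Y n) u) u)"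
    unfolding abs_mult using assms Y_sector[of n u] by (intro mult_mono) auto
  thus ?thesis by (simp add: bap_simps cinner_simps)
qed

lemma scalar_Y_commute:
  "(bop_scalar z * (- Y n)) * (bop_scalar w * (- Y m)) = (bop_scalar w * (- Y m)) * (bop_scalar z * (- Y n))"
proof (rule bop_commuteI)
  fix x
  have "bap (Y n) (bap (Y m) x) = bap (Y m) (bap (Y n) x)" by (metis Y_commute bap_simps(6))
  thus "bap (bop_scalar z * (- Y n)) (bap (bop_scalar w * (- Y m)) x) = bap (bop_scalar w * (- Y m)) (bap (bop_scalar z * (- Y n)) x)"
    by (simp add: bap_simps bap_right bap_scaleC scaleC_minus_right scaleC_scaleC mult.commute)
qed

lemma norm_E: "\<bar>Im z\<bar> \<le> Re z \<Longrightarrow> norm (bap (E n z) x) \<le> norm x"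
  unfolding E_def by (intro norm_exp_dissipative dissipative_Y)

lemma E_add: "E n (z + w) = E n z * E n w"
  unfolding E_def bop_scalar_add distrib_right
  by (rule exp_add_commuting[OF scalar_Y_commute])

lemma E_diff: "\<bar>Im z\<bar> \<le> Re z \<Longrightarrow> norm (bap (E n z) x - bap (E m z) x) \<le> cmod z * norm (bap (Y n) x - bap (Y m) x)"
proof -
  assume z: "\<bar>Im z\<bar> \<le> Re z"
  have "norm (bap (E n z) x - bap (E m z) x)
      \<le> norm (bap (bop_scalar z * (- Y n)) x - bap (bop_scalar z * (- Y m)) x)"
    unfolding E_def by (intro norm_exp_diff_le dissipative_Y z scalar_Y_commute)
  also have "\<dots> = norm (z *\<^sub>C (bap (Y m) x - bap (Y n) x))"
    by (simp add: bap_simps scaleC_diff_right scaleC_minus_right)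
  finally show ?thesis by (simp add: norm_scaleC norm_minus_commute)
qed

lemma E_identity: "\<bar>Im z\<bar> \<le> Re z \<Longrightarrow> x \<in> dom T \<Longrightarrow> norm (bap (E n z) x - x) \<le> cmod z * norm (T \<cdot> x)"
proof -
  assume z: "\<bar>Im z\<bar> \<le> Re z" and x: "x \<in> dom T"
  have "norm (bap (E n z) x - bap (exp 0) x) \<le> norm (bap (bop_scalar z * (- Y n)) x - bap 0 x)"
    unfolding E_def by (intro norm_exp_diff_le dissipative_Y z) (auto simp: bap_simps)
  also have "\<dots> = cmod z * norm (bap (Y n) x)"
    by (simp add: bap_simps norm_scaleC scaleC_minus_right)
  also have "\<dots> \<le> cmod z * norm (T \<cdot> x)" by (intro mult_left_mono Y_dom x) simp
  finally show ?thesis by (simp add: bap_simps)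
qed

lemma convergent_E: "\<bar>Im z\<bar> \<le> Re z \<Longrightarrow> convergent (\<lambda>n. bap (E n z) x)"
proof (rule convergent_dense[OF dense])
  assume z: "\<bar>Im z\<bar> \<le> Re z"
  show "norm (bap (E n z) x - bap (E n z) y) \<le> norm (x - y)" for n x y
    using norm_E[OF z, of n "x - y"] by (simp add: bap_right)
  fix x assume x: "x \<in> dom T"
  have Y: "Cauchy (\<lambda>n. bap (Y n) x)" by (rule LIMSEQ_imp_Cauchy[OF Y_tendsto[OF x]])
  show "Cauchy (\<lambda>n. bap (E n z) x)"
  proof (rule CauchyI)
    fix e :: real assume e: "e > 0"
    have k: "cmod z + 1 > 0" by (simp add: add_nonneg_pos)
    obtain N where N: "\<And>m n. m \<ge> N \<Longrightarrow> n \<ge> N \<Longrightarrow> norm (bap (Y m) x - bap (Y n) x) < e / (cmod z + 1)"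
      using CauchyD[OF Y divide_pos_pos[OF e k]] by blast
    have "norm (bap (E m z) x - bap (E n z) x) < e" if "m \<ge> N" "n \<ge> N" for m n
    proof -
      have "norm (bap (E m z) x - bap (E n z) x) \<le> (cmod z + 1) * norm (bap (Y m) x - bap (Y n) x)"
        by (rule order_trans[OF E_diff[OF z]]) (simp add: mult_right_mono)
      also have "\<dots> < e" using N[OF that] k by (simp add: field_simps)
      finally show ?thesis .
    qed
    thus "\<exists>N. \<forall>m\<ge>N. \<forall>n\<ge>N. norm (bap (E m z) x - bap (E n z) x) < e" by blast
  qed
qed

text \<open>The strong limit of \<open>E n z\<close>, which exists for \<open>z\<close> in the closed sector.\<close>

definition S :: "complex \<Rightarrow> 'a bop"
  where "S z = (SOME U. \<forall>x. (\<lambda>n. bap (E n z) x) \<longlonglongrightarrow> bap U x)"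

lemma S_lim:
  assumes z: "\<bar>Im z\<bar> \<le> Re z"
  shows "(\<lambda>n. bap (E n z) x) \<longlonglongrightarrow> bap (S z) x"
proof -
  define f where "f x = lim (\<lambda>n. bap (E n z) x)" for x
  have f: "(\<lambda>n. bap (E n z) x) \<longlonglongrightarrow> f x" for x
    unfolding f_def using convergent_E[OF z] by (simp add: convergent_LIMSEQ_iff)
  have add: "f (x + y) = f x + f y" for x y
    using tendsto_add[OF f[of x] f[of y]] f[of "x + y"] by (auto simp: bap_right intro: LIMSEQ_unique)
  have hom: "f (c *\<^sub>C x) = c *\<^sub>C f x" for c x
    using tendsto_scaleC[OF tendsto_const f[of x], of c] f[of "c *\<^sub>C x"]
    by (auto simp: bap_scaleC intro: LIMSEQ_unique)
  have bound: "norm (f x) \<le> 1 * norm x" for x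
    using norm_E[OF z] by (intro LIMSEQ_le_const2[OF tendsto_norm[OF f]]) auto
  from bop_exists[OF add hom bound zero_le_one]
  obtain U where U: "\<And>x. bap U x = f x" by blast
  have "\<forall>x. (\<lambda>n. bap (E n z) x) \<longlonglongrightarrow> bap U x" unfolding U using f by blast
  hence "\<exists>U. \<forall>x. (\<lambda>n. bap (E n z) x) \<longlonglongrightarrow> bap U x" by (rule exI)
  from someI_ex[OF this] show ?thesis by (simp add: S_def)
qed

lemma norm_S: "\<bar>Im z\<bar> \<le> Re z \<Longrightarrow> norm (bap (S z) x) \<le> norm x"
  using norm_E by (intro LIMSEQ_le_const2[OF tendsto_norm[OF S_lim]]) auto

lemma S_add:
  assumes z: "\<bar>Im z\<bar> \<le> Re z" and w: "\<bar>Im w\<bar> \<le> Re w"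
  shows "bap (S (z + w)) x = bap (S z) (bap (S w) x)"
proof -
  have zw: "\<bar>Im (z + w)\<bar> \<le> Re (z + w)" using z w by simp
  have "(\<lambda>n. bap (E n z) (bap (E n w) x) - bap (E n z) (bap (S w) x)) \<longlonglongrightarrow> 0"
  proof (rule Lim_null_comparison[OF always_eventually])
    show "\<forall>n. norm (bap (E n z) (bap (E n w) x) - bap (E n z) (bap (S w) x)) \<le> norm (bap (E n w) x - bap (S w) x)"
      using norm_E[OF z] by (metis bap_right(3))
    show "(\<lambda>n. norm (bap (E n w) x - bap (S w) x)) \<longlonglongrightarrow> 0"
      using S_lim[OF w] by (intro tendsto_norm_zero LIM_zero)
  qed
  from tendsto_add[OF this S_lim[OF z, of "bap (S w) x"]]
  have "(\<lambda>n. bap (E n (z + w)) x) \<longlonglongrightarrow> bap (S z) (bap (S w) x)" by (simp add: E_add bap_simps)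
  thus ?thesis using S_lim[OF zw] LIMSEQ_unique by blast
qed

lemma S_0: "bap (S 0) x = x"
proof -
  have "bop_scalar 0 = (0 :: 'a bop)" by (rule bap_eqI) (auto simp: bap_simps)
  hence "bap (E n 0) x = x" for n by (simp add: E_def bap_simps)
  thus ?thesis using S_lim[of 0 x] LIMSEQ_unique[OF _ tendsto_const] by fastforce
qed

lemma S_identity: "\<bar>Im z\<bar> \<le> Re z \<Longrightarrow> x \<in> dom T \<Longrightarrow> norm (bap (S z) x - x) \<le> cmod z * norm (T \<cdot> x)"
  by (rule LIMSEQ_le_const2[OF tendsto_norm[OF tendsto_diff[OF S_lim tendsto_const]]])
    (auto simp: E_identity)

abbreviation U :: "real \<Rightarrow> 'a \<Rightarrow> 'a" where "U t \<equiv> bap (S (of_real t))"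

lemma S_at_0: "((\<lambda>t. U t x) \<longlongrightarrow> x) (at_right 0)"
proof (rule tendstoI)
  fix e :: real assume e: "e > 0"
  obtain v where v: "v \<in> dom T" "dist v x < e / 3"
    using dense e closure_approachable[of x "dom T"] by (metis UNIV_I divide_pos_pos zero_less_numeral)
  have "((\<lambda>t. t * norm (T \<cdot> v)) \<longlongrightarrow> 0 * norm (T \<cdot> v)) (at_right 0)" by (intro tendsto_intros)
  hence "\<forall>\<^sub>F t in at_right 0. t * norm (T \<cdot> v) < e / 3" using e by (intro order_tendstoD) auto
  moreover have "\<forall>\<^sub>F t in at_right 0. (0::real) < t" by (rule eventually_at_right_less)
  ultimately show "\<forall>\<^sub>F t in at_right 0. dist (U t x) x < e"
  proof eventually_elim
    case (elim t)
    have "norm (U t (x - v)) \<le> norm (x - v)" using elim by (intro norm_S) simp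
    moreover have "norm (U t v - v) \<le> t * norm (T \<cdot> v)"
      using S_identity[of "of_real t" v] elim v by simp
    moreover have "U t x - x = U t (x - v) + (U t v - v) + (v - x)"
      by (simp add: bap_right)
    ultimately have "norm (U t x - x) \<le> norm (x - v) + t * norm (T \<cdot> v) + norm (v - x)"
      using norm_triangle_ineq[of "U t (x - v) + (U t v - v)" "v - x"]
        norm_triangle_ineq[of "U t (x - v)" "U t v - v"] by simp
    thus ?case using elim v(2) by (simp add: dist_norm norm_minus_commute)
  qed
qed

text \<open>
  The difference quotient at 0 is compared with \<open>- T x\<close> through a vector \<open>v\<close> in the domain close
  to \<open>T x\<close>; this gives a rate which is uniform in the approximation.
\<close>

lemma S_quotient:
  assumes h: "0 \<le> h" and x: "x \<in> dom T" and v: "v \<in> dom T"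
  shows "norm (U h x - x + h *\<^sub>R (T \<cdot> x)) \<le> h * (2 * norm (T \<cdot> x - v) + h * norm (T \<cdot> v))"
proof -
  have hz: "\<bar>Im (of_real h)\<bar> \<le> Re (of_real h)" using h by simp
  have "norm (bap (E n (of_real h)) x - x + h *\<^sub>R (T \<cdot> x))
      \<le> h * (norm (T \<cdot> x - bap (Y n) x) + (2 * norm (T \<cdot> x - v) + h * norm (T \<cdot> v)))" for n
  proof -
    have Et: "E n (of_real t) = exp (t *\<^sub>R (- Y n))" for t
    proof -
      have "bop_scalar (of_real t) * (- Y n) = t *\<^sub>R (- Y n)"
        by (rule bap_eqI) (simp_all add: bap_simps scaleR_scaleC)
      thus ?thesis by (simp only: E_def)
    qed
    define f where "f t = bap (exp (t *\<^sub>R (- Y n))) x + t *\<^sub>R (T \<cdot> x)" for t :: real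
    have "norm (f h - f 0) \<le> h * (norm (T \<cdot> x - bap (Y n) x) + (2 * norm (T \<cdot> x - v) + h * norm (T \<cdot> v)))"
    proof (rule norm_diff_le_of_derivative[OF h])
      show "(f has_vector_derivative bap (exp (t *\<^sub>R (- Y n))) (bap (- Y n) x) + T \<cdot> x) (at t)" for t
        unfolding f_def
        by (intro has_vector_derivative_add bap_exp_has_vector_derivative) (auto intro!: derivative_eq_intros)
      fix t assume t: "0 < t" "t < h"
      let ?E = "bap (E n (of_real t))"
      have tz: "\<bar>Im (of_real t)\<bar> \<le> Re (of_real t)" using t by simp
      have "bap (exp (t *\<^sub>R (- Y n))) (bap (- Y n) x) + T \<cdot> x
          = ?E (T \<cdot> x - bap (Y n) x) - ?E (T \<cdot> x - v) - (?E v - v) + (T \<cdot> x - v)"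
        by (simp add: bap_right bap_simps Et)
      also have "norm \<dots> \<le> norm (?E (T \<cdot> x - bap (Y n) x)) + norm (?E (T \<cdot> x - v)) + norm (?E v - v) + norm (T \<cdot> x - v)"
        by (smt (verit) norm_triangle_ineq norm_triangle_ineq4)
      also have "\<dots> \<le> norm (T \<cdot> x - bap (Y n) x) + norm (T \<cdot> x - v) + h * norm (T \<cdot> v) + norm (T \<cdot> x - v)"
      proof (intro add_mono norm_E[OF tz] order_refl)
        have "norm (?E v - v) \<le> t * norm (T \<cdot> v)" using E_identity[OF tz v, of n] t by simp
        also have "\<dots> \<le> h * norm (T \<cdot> v)" using t by (intro mult_right_mono) auto
        finally show "norm (?E v - v) \<le> h * norm (T \<cdot> v)" .
      qed
      finally show "norm (bap (exp (t *\<^sub>R (- Y n))) (bap (- Y n) x) + T \<cdot> x)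
          \<le> norm (T \<cdot> x - bap (Y n) x) + (2 * norm (T \<cdot> x - v) + h * norm (T \<cdot> v))" by simp
    qed
    thus ?thesis by (simp add: f_def Et bap_simps algebra_simps)
  qed
  moreover have "(\<lambda>n. h * (norm (T \<cdot> x - bap (Y n) x) + (2 * norm (T \<cdot> x - v) + h * norm (T \<cdot> v))))
      \<longlonglongrightarrow> h * (norm (T \<cdot> x - T \<cdot> x) + (2 * norm (T \<cdot> x - v) + h * norm (T \<cdot> v)))"
    by (intro tendsto_intros Y_tendsto x)
  moreover have "(\<lambda>n. norm (bap (E n (of_real h)) x - x + h *\<^sub>R (T \<cdot> x)))
      \<longlonglongrightarrow> norm (U h x - x + h *\<^sub>R (T \<cdot> x))"
    by (intro tendsto_norm tendsto_add tendsto_diff tendsto_const S_lim[OF hz])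
  ultimately show ?thesis
    using LIMSEQ_le[of _ _ _ "h * (norm (T \<cdot> x - T \<cdot> x) + (2 * norm (T \<cdot> x - v) + h * norm (T \<cdot> v)))"] by fastforce
qed

lemma S_derivative_0:
  assumes x: "x \<in> dom T"
  shows "((\<lambda>h. (U h x - x) /\<^sub>R h) \<longlongrightarrow> - (T \<cdot> x)) (at_right 0)"
proof (rule tendstoI)
  fix e :: real assume e: "e > 0"
  obtain v where v: "v \<in> dom T" "dist v (T \<cdot> x) < e / 4"
    using dense e closure_approachable[of "T \<cdot> x" "dom T"] by (metis UNIV_I divide_pos_pos zero_less_numeral)
  have "((\<lambda>t. t * norm (T \<cdot> v)) \<longlongrightarrow> 0 * norm (T \<cdot> v)) (at_right 0)" by (intro tendsto_intros)
  hence "\<forall>\<^sub>F t in at_right 0. t * norm (T \<cdot> v) < e / 2" using e by (intro order_tendstoD) auto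
  moreover have "\<forall>\<^sub>F t in at_right 0. (0::real) < t" by (rule eventually_at_right_less)
  ultimately show "\<forall>\<^sub>F h in at_right 0. dist ((U h x - x) /\<^sub>R h) (- (T \<cdot> x)) < e"
  proof eventually_elim
    case (elim h)
    have h: "h > 0" "h \<noteq> 0" using elim by auto
    have "(U h x - x) /\<^sub>R h - - (T \<cdot> x) = (U h x - x + h *\<^sub>R (T \<cdot> x)) /\<^sub>R h"
      by (simp only: scaleR_add_right scaleR_scaleR left_inverse[OF h(2)] scaleR_one diff_minus_eq_add)
    hence "dist ((U h x - x) /\<^sub>R h) (- (T \<cdot> x)) = norm ((U h x - x + h *\<^sub>R (T \<cdot> x)) /\<^sub>R h)"
      by (simp only: dist_norm)
    also have "\<dots> = norm (U h x - x + h *\<^sub>R (T \<cdot> x)) / h"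
      using h(1) by (simp only: norm_scaleR abs_inverse abs_of_pos divide_inverse mult.commute)
    also have "\<dots> \<le> h * (2 * norm (T \<cdot> x - v) + h * norm (T \<cdot> v)) / h"
      using h(1) by (intro divide_right_mono S_quotient x v(1)) auto
    also have "\<dots> = 2 * norm (T \<cdot> x - v) + h * norm (T \<cdot> v)" using h(2) by (rule nonzero_mult_div_cancel_left)
    also have "\<dots> < e" using elim v(2) by (simp add: dist_norm norm_minus_commute)
    finally show ?case .
  qed
qed

definition G :: "'a \<rightharpoonup> 'a" where "G = generator (\<lambda>t. op_of (S (of_real t)))"

lemma G_I:
  assumes "((\<lambda>h. (U h x - x) /\<^sub>R h) \<longlongrightarrow> y) (at_right 0)"
  shows "x \<in> dom G" "G \<cdot> x = y"
  using generatorI[of "\<lambda>t. op_of (S (of_real t))" x y] assms by (simp_all add: G_def bap_def)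

lemma G_D: "x \<in> dom G \<Longrightarrow> ((\<lambda>h. (U h x - x) /\<^sub>R h) \<longlongrightarrow> G \<cdot> x) (at_right 0)"
  using generatorD[of x "\<lambda>t. op_of (S (of_real t))"] by (simp add: G_def bap_def)

text \<open>
  The negative generator of a contraction semigroup is accretive. It extends \<open>T\<close>, which has no proper
  accretive extension.
\<close>

lemma G_eq: "G = op_uminus T"
proof -
  have add: "x + y \<in> dom G" "G \<cdot> (x + y) = G \<cdot> x + G \<cdot> y" if "x \<in> dom G" "y \<in> dom G" for x y
  proof -
    have "((\<lambda>h. (U h (x + y) - (x + y)) /\<^sub>R h) \<longlongrightarrow> G \<cdot> x + G \<cdot> y) (at_right 0)"
      using tendsto_add[OF G_D[OF that(1)] G_D[OF that(2)]]
      by (simp only: bap_right(2) add_diff_add scaleR_add_right[symmetric])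
    from G_I[OF this] show "x + y \<in> dom G" "G \<cdot> (x + y) = G \<cdot> x + G \<cdot> y" .
  qed
  have scale: "c *\<^sub>C x \<in> dom G" "G \<cdot> (c *\<^sub>C x) = c *\<^sub>C (G \<cdot> x)" if "x \<in> dom G" for c x
  proof -
    have "((\<lambda>h. c *\<^sub>C ((U h x - x) /\<^sub>R h)) \<longlongrightarrow> c *\<^sub>C (G \<cdot> x)) (at_right 0)"
      by (intro tendsto_scaleC tendsto_const G_D that)
    moreover have "c *\<^sub>C ((U h x - x) /\<^sub>R h) = (U h (c *\<^sub>C x) - c *\<^sub>C x) /\<^sub>R h" for h
      by (simp only: bap_scaleC scaleR_scaleC scaleC_scaleC scaleC_diff_right mult.commute)
    ultimately have "((\<lambda>h. (U h (c *\<^sub>C x) - c *\<^sub>C x) /\<^sub>R h) \<longlongrightarrow> c *\<^sub>C (G \<cdot> x)) (at_right 0)"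
      by (simp only:)
    from G_I[OF this] show "c *\<^sub>C x \<in> dom G" "G \<cdot> (c *\<^sub>C x) = c *\<^sub>C (G \<cdot> x)" .
  qed
  have T_G: "x \<in> dom G" "G \<cdot> x = - (T \<cdot> x)" if "x \<in> dom T" for x
    using G_I[OF S_derivative_0[OF that]] .
  have "0 \<in> dom G" using T_G linear_op_zero[OF linear] by auto
  hence "linear_op (op_uminus G)"
    by (auto simp: linear_op_def op_uminus_app add scale scaleC_minus_right)
  moreover have "Re (cinner (op_uminus G \<cdot> x) x) \<ge> 0" if x: "x \<in> dom G" for x
  proof -
    have lim: "((\<lambda>h. Re (cinner ((U h x - x) /\<^sub>R h) x)) \<longlongrightarrow> Re (cinner (G \<cdot> x) x)) (at_right 0)"
      by (intro tendsto_Re tendsto_cinner tendsto_const G_D x)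
    have "Re (cinner ((U h x - x) /\<^sub>R h) x) \<le> 0" if h: "h > 0" for h
    proof -
      have "Re (cinner (U h x) x) \<le> norm (U h x) * norm x" by (rule Re_cinner_le)
      also have "\<dots> \<le> norm x * norm x" using h by (intro mult_right_mono norm_S) auto
      finally have "Re (cinner (U h x - x) x) \<le> 0"
        by (simp add: cinner_simps Re_cinner_self power2_eq_square)
      moreover have "Re (cinner ((U h x - x) /\<^sub>R h) x)
          = inverse h * Re (cinner (U h x - x) x)"
        by (simp only: cinner_scaleR_left times_complex.sel Re_complex_of_real Im_complex_of_real
            mult_zero_left diff_zero)
      ultimately show ?thesis using h by (simp only: mult_nonneg_nonpos positive_imp_inverse_positive less_imp_le)
    qed
    hence "\<forall>\<^sub>F h in at_right 0. Re (cinner ((U h x - x) /\<^sub>R h) x) \<le> 0"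
      using eventually_at_right_less[of "0::real"] by (rule eventually_mono[rotated])
    hence "Re (cinner (G \<cdot> x) x) \<le> 0"
      by (intro tendsto_upperbound[OF lim]) auto
    thus ?thesis using x by (simp add: op_uminus_app cinner_simps)
  qed
  ultimately have "accretive (op_uminus G)" by (simp add: accretive_def)
  hence eq: "op_uminus G = T"
    by (rule m_accretive_maximal[OF m_accretive]) (use T_G in \<open>auto simp: op_uminus_app\<close>)
  show ?thesis
  proof (rule op_eqI)
    show dom: "dom G = dom (op_uminus T)" using arg_cong[OF eq, of dom] by simp
    fix x assume x: "x \<in> dom G"
    have "T \<cdot> x = - (G \<cdot> x)" using op_uminus_app[OF x] by (simp only: eq)
    thus "G \<cdot> x = op_uminus T \<cdot> x" using x dom by (simp add: op_uminus_app)
  qed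
qed

text \<open>
  The contraction bound on the whole sector gives, through Cauchy's estimate, difference
  quotients in operator norm which are Cauchy uniformly in the approximation.
\<close>

lemma S_differentiable:
  assumes z: "\<bar>Im z\<bar> < Re z"
  obtains L K where "((\<lambda>w. op_of (S w)) has_derivative (\<lambda>h. op_of (bop_scalar h * L))) (at z)"
    "\<forall>\<^sub>F h in at 0. \<forall>x. norm ((1 / h) *\<^sub>C (bap (S (z + h)) x - bap (S z) x) - bap L x) \<le> K * cmod h * norm x"
proof -
  have "open {w. \<bar>Im w\<bar> < Re w}" by (intro open_Collect_less continuous_intros)
  then obtain d where d: "d > 0" "ball z d \<subseteq> {w. \<bar>Im w\<bar> < Re w}"
    using z by (meson mem_Collect_eq open_contains_ball)
  have in_sector: "\<bar>Im (z + h)\<bar> \<le> Re (z + h)" if "cmod h < d" for h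
  proof -
    have "z + h \<in> ball z d" using that by (simp add: dist_norm)
    thus ?thesis using d(2) by force
  qed
  define K where "K = 32 / d\<^sup>2"
  have K: "K > 0" using d by (simp add: K_def)
  define D where "D h = bop_scalar (1 / h) * (S (z + h) - S z)" for h
  have bap_D: "bap (D h) x = (1 / h) *\<^sub>C (bap (S (z + h)) x - bap (S z) x)" for h x
    by (simp add: D_def bap_simps)
  have DD: "norm (D h - D k) \<le> K * (cmod h + cmod k)"
    if h: "h \<noteq> 0" "cmod h < d / 2" and k: "k \<noteq> 0" "cmod k < d / 2" for h k
  proof (rule norm_bop_le)
    fix x
    define w where "w n = (1 / h) *\<^sub>C (bap (E n (z + h)) x - bap (E n z) x)
        - (1 / k) *\<^sub>C (bap (E n (z + k)) x - bap (E n z) x)" for n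
    have wn: "norm (w n) \<le> K * (cmod h + cmod k) * norm x" for n
    proof -
      define g where "g \<zeta> = cinner (bap (E n \<zeta>) x) (w n)" for \<zeta>
      have hol: "g holomorphic_on UNIV"
        unfolding g_def E_def by (rule holomorphic_exp_matrix_coefficient)
      have M: "cmod (g \<zeta>) \<le> norm x * norm (w n)" if "\<zeta> \<in> ball z d" for \<zeta>
      proof -
        have "cmod (g \<zeta>) \<le> norm (bap (E n \<zeta>) x) * norm (w n)" unfolding g_def by (rule Cauchy_Schwarz)
        also have "\<dots> \<le> norm x * norm (w n)"
          using d(2) that by (intro mult_right_mono norm_E) (auto simp: subset_iff less_imp_le)
        finally show ?thesis .
      qed
      have rem: "cmod ((g (z + h) - g z) / h - deriv g z) \<le> K * (norm x * norm (w n)) * cmod h"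
        if h: "h \<noteq> 0" "cmod h < d / 2" for h
      proof -
        have "(g (z + h) - g z) / h - deriv g z = (g (z + h) - g z - h * deriv g z) / h"
          using h(1) by (simp add: diff_divide_distrib)
        hence "cmod ((g (z + h) - g z) / h - deriv g z) = cmod (g (z + h) - g z - h * deriv g z) / cmod h"
          by (simp only: norm_divide)
        also have "\<dots> \<le> 32 * (norm x * norm (w n)) / d\<^sup>2 * (cmod h)\<^sup>2 / cmod h"
          by (intro divide_right_mono holomorphic_linear_remainder[OF hol d(1) M h(2)]) auto
        also have "\<dots> = K * (norm x * norm (w n)) * cmod h" using h by (simp add: K_def power2_eq_square)
        finally show ?thesis .
      qed
      have w_inner: "cinner (w n) v = (cinner (bap (E n (z + h)) x) v - cinner (bap (E n z) x) v) / h
          - (cinner (bap (E n (z + k)) x) v - cinner (bap (E n z) x) v) / k" for v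
        by (simp add: w_def cinner_simps)
      have "(norm (w n))\<^sup>2 = cmod (cinner (w n) (w n))" by (simp add: cinner_self norm_power)
      also have "cinner (w n) (w n) = (g (z + h) - g z) / h - (g (z + k) - g z) / k"
        unfolding g_def by (rule w_inner)
      also have "\<dots> = ((g (z + h) - g z) / h - deriv g z) - ((g (z + k) - g z) / k - deriv g z)" by simp
      also have "cmod \<dots> \<le> K * (norm x * norm (w n)) * cmod h + K * (norm x * norm (w n)) * cmod k"
        by (rule order_trans[OF norm_triangle_ineq4]) (intro add_mono rem h k)
      also have "\<dots> = norm (w n) * (K * (cmod h + cmod k) * norm x)" by (simp add: algebra_simps)
      finally have "norm (w n) * norm (w n) \<le> norm (w n) * (K * (cmod h + cmod k) * norm x)"
        by (simp only: power2_eq_square)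
      thus ?thesis
        using K by (cases "w n = 0") (simp_all add: mult_le_cancel_left_pos)
    qed
    have "w \<longlonglongrightarrow> bap (D h - D k) x"
    proof -
      have "cmod h < d" "cmod k < d" "cmod 0 < d" using h k d by auto
      note * = this[THEN in_sector]
      have "\<bar>Im z\<bar> \<le> Re z" using z by simp
      thus ?thesis
        unfolding w_def bap_simps bap_D
        by (intro tendsto_diff tendsto_scaleC tendsto_const S_lim *)
    qed
    thus "norm (bap (D h - D k) x) \<le> K * (cmod h + cmod k) * norm x"
      by (rule LIMSEQ_le_const2[OF tendsto_norm]) (use wn in blast)
  qed (use K in \<open>auto simp: D_def\<close>)
  define s where "s n = complex_of_real (d / 4 * inverse (real (Suc n)))" for n :: nat
  have cmod_s: "cmod (s n) = d / 4 * inverse (real (Suc n))" for n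
    unfolding s_def norm_of_real using d(1) by (intro abs_of_nonneg mult_nonneg_nonneg) auto
  have s0: "s n \<noteq> 0" "cmod (s n) < d / 2" for n
  proof -
    have "0 < inverse (real (Suc n))" "inverse (real (Suc n)) \<le> 1" by (simp_all add: field_simps)
    hence "0 < d / 4 * inverse (real (Suc n))" "d / 4 * inverse (real (Suc n)) \<le> d / 4 * 1"
      using d(1) by (intro mult_pos_pos mult_left_mono; simp)+
    thus "s n \<noteq> 0" "cmod (s n) < d / 2" using d(1) unfolding cmod_s[symmetric] by auto
  qed
  have s_lim: "(\<lambda>n. cmod (s n)) \<longlonglongrightarrow> 0"
    unfolding cmod_s by (rule tendsto_mult_right_zero[OF LIMSEQ_inverse_real_of_nat])
  have "Cauchy (\<lambda>n. D (s n))"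
  proof (rule CauchyI)
    fix e :: real assume e: "e > 0"
    have "\<forall>\<^sub>F n in sequentially. cmod (s n) < e / (2 * K)"
      using s_lim e K by (intro order_tendstoD) auto
    then obtain N where N: "\<And>n. n \<ge> N \<Longrightarrow> cmod (s n) < e / (2 * K)"
      unfolding eventually_sequentially by blast
    have "norm (D (s m) - D (s n)) < e" if "m \<ge> N" "n \<ge> N" for m n
    proof -
      have "norm (D (s m) - D (s n)) \<le> K * (cmod (s m) + cmod (s n))" by (intro DD s0)
      also have "\<dots> < K * (e / (2 * K) + e / (2 * K))"
        using N[OF that(1)] N[OF that(2)] K by (intro mult_strict_left_mono add_strict_mono) auto
      also have "\<dots> = e" using K by simp
      finally show ?thesis .
    qed
    thus "\<exists>N. \<forall>m\<ge>N. \<forall>n\<ge>N. norm (D (s m) - D (s n)) < e" by blast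
  qed
  then obtain L where L: "(\<lambda>n. D (s n)) \<longlonglongrightarrow> L"
    using Cauchy_convergent_iff convergent_def by blast
  have DL: "norm (D h - L) \<le> K * cmod h" if h: "h \<noteq> 0" "cmod h < d / 2" for h
  proof (rule LIMSEQ_le)
    show "(\<lambda>n. norm (D h - D (s n))) \<longlonglongrightarrow> norm (D h - L)"
      by (intro tendsto_norm tendsto_diff tendsto_const L)
    have "(\<lambda>n. K * (cmod h + cmod (s n))) \<longlonglongrightarrow> K * (cmod h + 0)"
      by (intro tendsto_mult tendsto_add tendsto_const s_lim)
    thus "(\<lambda>n. K * (cmod h + cmod (s n))) \<longlonglongrightarrow> K * cmod h" by simp
    show "\<exists>N. \<forall>n\<ge>N. norm (D h - D (s n)) \<le> K * (cmod h + cmod (s n))"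
      using DD[OF h s0] by blast
  qed
  show ?thesis
  proof (rule that[of L K])
    have "\<forall>\<^sub>F h in at 0. h \<noteq> 0 \<and> cmod h < d / 2"
      unfolding eventually_at using d by (intro exI[of _ "d / 2"]) auto
    thus "\<forall>\<^sub>F h in at 0. \<forall>x. norm ((1 / h) *\<^sub>C (bap (S (z + h)) x - bap (S z) x) - bap L x) \<le> K * cmod h * norm x"
    proof eventually_elim
      case (elim h)
      have "norm (bap (D h - L) x) \<le> K * cmod h * norm x" for x
        using norm_bap[of "D h - L" x] mult_right_mono[OF DL norm_ge_zero, of h x] elim by linarith
      thus ?case by (simp add: bap_simps bap_D)
    qed
    show "((\<lambda>w. op_of (S w)) has_derivative (\<lambda>h. op_of (bop_scalar h * L))) (at z)"
    proof (rule has_derivativeI_sandwich[where H = "\<lambda>w. K * cmod (w - z)"])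
      show "d / 2 > 0" using d by simp
      show "bounded_linear (\<lambda>h. op_of (bop_scalar h * L))"
      proof (rule bounded_linear_intro[where K = "norm L"])
        show "norm (op_of (bop_scalar h * L)) \<le> norm h * norm L" for h
          using norm_op_of_scalar_times[of h L] by (simp add: mult.commute)
      qed (simp_all only: bop_scalar_add bop_scalar_scaleR distrib_right bop_coords(3,7) mult_scaleR_left)
      have "((\<lambda>w. K * cmod (w - z)) \<longlongrightarrow> K * cmod (z - z)) (at z)" by (intro tendsto_intros)
      thus "((\<lambda>w. K * cmod (w - z)) \<longlongrightarrow> 0) (at z)" by simp
      fix w assume w: "w \<noteq> z" "dist w z < d / 2"
      define h where "h = w - z"
      have h: "h \<noteq> 0" "cmod h < d / 2" and wz: "w = z + h" using w by (auto simp: h_def dist_norm)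
      have "op_of (S w) - op_of (S z) - op_of (bop_scalar (w - z) * L) = op_of (bop_scalar h * (D h - L))"
      proof (rule blinfun_eqI)
        fix x
        have "h *\<^sub>C bap (D h) x = bap (S w) x - bap (S z) x"
          using h by (simp add: wz bap_D scaleC_scaleC)
        thus "blinfun_apply (op_of (S w) - op_of (S z) - op_of (bop_scalar (w - z) * L)) x
            = blinfun_apply (op_of (bop_scalar h * (D h - L))) x"
          unfolding blinfun.diff_left bap_def[symmetric] h_def[symmetric]
          by (simp only: bap_simps bap_scalar scaleC_diff_right)
      qed
      also have "norm \<dots> \<le> norm (D h - L) * cmod h" by (rule norm_op_of_scalar_times)
      also have "\<dots> \<le> K * cmod h * cmod h" by (intro mult_right_mono DL h) simp
      finally show "norm (op_of (S w) - op_of (S z) - op_of (bop_scalar (w - z) * L)) / norm (w - z) \<le> K * cmod (w - z)"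
        using h by (simp add: h_def[symmetric] pos_divide_le_eq)
    qed
  qed
qed

text \<open>
  The right derivative of \<open>s \<mapsto> U s x\<close> at \<open>t > 0\<close> exists for all \<open>x\<close> and is also the derivative at 0 of
  the orbit of \<open>U t x\<close>, so that \<open>U t x\<close> lies in the domain of the generator.
\<close>

lemma S_smoothing:
  assumes t: "t > 0"
  obtains K where "K \<ge> 0" "\<And>x. U t x \<in> dom T"
    "\<And>x. norm (T \<cdot> U t x) \<le> K * norm x"
    "\<And>x. ((\<lambda>s. bap (S (of_real s)) x) has_vector_derivative - (T \<cdot> U t x)) (at t)"
proof -
  have tz: "\<bar>Im (of_real t)\<bar> < Re (of_real t)" using t by simp
  obtain L K where L: "((\<lambda>w. op_of (S w)) has_derivative (\<lambda>h. op_of (bop_scalar h * L))) (at (of_real t))"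
    and K: "\<forall>\<^sub>F h in at 0. \<forall>x. norm ((1 / h) *\<^sub>C (bap (S (of_real t + h)) x - U t x) - bap L x)
      \<le> K * cmod h * norm x"
    using S_differentiable[OF tz] by blast
  have gen: "U t x \<in> dom T \<and> T \<cdot> U t x = - bap L x" for x
  proof -
    have fl: "filterlim complex_of_real (at 0) (at_right 0)"
      unfolding filterlim_at
    proof
      show "\<forall>\<^sub>F h in at_right 0. complex_of_real h \<in> UNIV \<and> complex_of_real h \<noteq> 0"
        using eventually_at_right_less[of "0::real"] by (rule eventually_mono) simp
      have "(complex_of_real \<longlongrightarrow> complex_of_real 0) (at_right 0)"
        by (intro tendsto_of_real tendsto_ident_at)
      thus "(complex_of_real \<longlongrightarrow> 0) (at_right 0)" by simp
    qed
    have quot: "(1 / complex_of_real h) *\<^sub>C v = v /\<^sub>R h" for h and v :: 'a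
      by (simp only: scaleR_scaleC inverse_eq_divide of_real_divide of_real_1)
    have K': "\<forall>\<^sub>F h in at_right 0. \<forall>x. norm ((1 / of_real h) *\<^sub>C (bap (S (of_real t + of_real h)) x - U t x) - bap L x)
      \<le> K * cmod (of_real h) * norm x"
      by (rule eventually_compose_filterlim[OF K fl])
    have "\<forall>\<^sub>F h in at_right 0. norm ((U h (U t x) - U t x) /\<^sub>R h - bap L x) \<le> K * h * norm x"
      using K' eventually_at_right_less[of "0::real"]
    proof eventually_elim
      case (elim h)
      have "bap (S (of_real h + of_real t)) x = U h (U t x)"
        by (rule S_add) (use elim(2) t in simp_all)
      hence shift: "bap (S (of_real t + of_real h)) x = U h (U t x)"
        by (simp only: add.commute)
      have "cmod (of_real h) = h" using elim(2) by simp
      with elim(1)[rule_format, of x] show ?case by (simp only: quot shift)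
    qed
    moreover have "((\<lambda>h. K * h * norm x) \<longlongrightarrow> 0) (at_right 0)"
      by (intro tendsto_mult_left_zero tendsto_mult_right_zero tendsto_ident_at)
    ultimately have "((\<lambda>h. (U h (U t x) - U t x) /\<^sub>R h - bap L x) \<longlongrightarrow> 0) (at_right 0)"
      by (rule Lim_null_comparison)
    hence "((\<lambda>h. (U h (U t x) - U t x) /\<^sub>R h) \<longlongrightarrow> bap L x) (at_right 0)"
      by (rule LIM_zero_cancel)
    note G = G_I[OF this, unfolded G_eq dom_op_uminus]
    have "- (T \<cdot> U t x) = bap L x" using G(2) unfolding op_uminus_app[OF G(1)] .
    thus ?thesis using G(1) by (metis minus_minus)
  qed
  show ?thesis
  proof (rule that[of "norm L"])
    fix x
    show "U t x \<in> dom T" using gen by blast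
    have "norm (T \<cdot> U t x) = norm (bap L x)" using gen[of x] by (metis norm_minus_cancel)
    thus "norm (T \<cdot> U t x) \<le> norm L * norm x" using norm_bap[of L x] by (simp only:)
    have "((\<lambda>s. op_of (S (of_real s))) has_derivative (\<lambda>h. op_of (bop_scalar (of_real h) * L))) (at t)"
      by (rule has_derivative_compose[OF bounded_linear.has_derivative[OF bounded_linear_of_real has_derivative_ident] L])
    from bounded_linear.has_derivative[OF blinfun.bounded_linear_left[of x] this]
    have "((\<lambda>s. blinfun_apply (op_of (S (of_real s))) x) has_derivative (\<lambda>h. blinfun_apply (op_of (bop_scalar (of_real h) * L)) x)) (at t)" .
    moreover have "blinfun_apply (op_of (bop_scalar (of_real h) * L)) x = h *\<^sub>R bap L x" for h
      unfolding bap_def[symmetric] bap_simps bap_scalar scaleR_scaleC ..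
    ultimately have "((\<lambda>s. bap (S (of_real s)) x) has_vector_derivative bap L x) (at t)"
      unfolding has_vector_derivative_def by (simp only: bap_def)
    moreover have "- (T \<cdot> U t x) = bap L x" using gen by simp
    ultimately show "((\<lambda>s. bap (S (of_real s)) x) has_vector_derivative - (T \<cdot> U t x)) (at t)"
      by (simp only:)
  qed simp
qed

lemma S_commute:
  assumes t: "t \<ge> 0" and x: "x \<in> dom T"
  shows "U t x \<in> dom T" "T \<cdot> U t x = U t (T \<cdot> x)"
proof -
  have "((\<lambda>h. U t ((U h x - x) /\<^sub>R h)) \<longlongrightarrow> U t (- (T \<cdot> x))) (at_right 0)"
    by (intro tendsto_bap tendsto_const S_derivative_0 x)
  moreover have "\<forall>\<^sub>F h in at_right 0. U t ((U h x - x) /\<^sub>R h)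
      = (U h (U t x) - U t x) /\<^sub>R h"
    using eventually_at_right_less[of "0::real"]
  proof eventually_elim
    case (elim h)
    have "U t (U h x) = U h (U t x)"
      using S_add[of "of_real t" "of_real h" x] S_add[of "of_real h" "of_real t" x] elim t
      by (simp add: add.commute)
    thus ?case by (simp add: bap_right)
  qed
  ultimately have "((\<lambda>h. (U h (U t x) - U t x) /\<^sub>R h)
      \<longlongrightarrow> - U t (T \<cdot> x)) (at_right 0)"
    unfolding bap_right(4) by (rule Lim_transform_eventually)
  note G = G_I[OF this, unfolded G_eq dom_op_uminus]
  show "U t x \<in> dom T" by (rule G(1))
  show "T \<cdot> U t x = U t (T \<cdot> x)"
    using G(2) unfolding op_uminus_app[OF G(1)] by simp
qed

theorem generates: "generates_holomorphic_c0_semigroup (op_uminus T) (pi / 4) (\<lambda>z. op_of (S z))"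
proof -
  have "op_of (S 0) = id_blinfun"
    by (rule blinfun_eqI) (simp add: S_0 flip: bap_def)
  moreover have "op_of (S (of_real (s + t))) = op_of (S (of_real s)) o\<^sub>L op_of (S (of_real t))"
    if "s \<ge> 0" "t \<ge> 0" for s t
    using S_add[of "of_real s" "of_real t"] that
    by (intro blinfun_eqI) (simp add: bap_def)
  ultimately have "c0_semigroup (\<lambda>t. op_of (S (of_real t)))"
    using S_at_0 by (simp add: c0_semigroup_def op_of_homogeneous bap_def)
  moreover have "op_holomorphic_on (\<lambda>z. op_of (S z)) (sector (pi / 4))"
    unfolding op_holomorphic_on_def
  proof
    fix z assume "z \<in> sector (pi / 4)"
    then obtain L where "((\<lambda>w. op_of (S w)) has_derivative (\<lambda>h. op_of (bop_scalar h * L))) (at z)"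
      using S_differentiable[OF sector_pi4] by blast
    thus "\<exists>T'. ((\<lambda>z. op_of (S z)) has_derivative T') (at z) \<and>
        (\<forall>h x. blinfun_apply (T' h) x = h *\<^sub>C blinfun_apply (T' 1) x)"
      by (intro exI conjI allI) (assumption, simp add: bap_simps flip: bap_def)
  qed
  ultimately show ?thesis
    using G_eq by (simp add: generates_holomorphic_c0_semigroup_def holomorphic_c0_semigroup_def
        op_of_homogeneous G_def)
qed

end

section \<open>Lower bounds for mixed quadratic forms\<close>

text \<open>
  Along \<open>u t = exp (- t A) x\<close> the derivative of \<open>Re \<langle>A u, G u\<rangle>\<close> is
  \<open>- Re \<langle>A\<^sup>2 u, G u\<rangle> - Re \<langle>A u, G A u\<rangle>\<close>. The second term has a sign by accretivity of \<open>G\<close> and the first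
  is at most \<open>c \<bar>x\<bar>\<^sup>2\<close>, so the form at \<open>x\<close> is at least its value at time 1 minus \<open>c \<bar>x\<bar>\<^sup>2\<close>. There the
  smoothing of the holomorphic semigroup bounds \<open>A u\<close> and \<open>A\<^sup>2 u\<close>, and with it \<open>G u\<close>, by a multiple
  of \<open>\<bar>x\<bar>\<close>.
\<close>

lemma mixed_form_lower_bound:
  fixes A G :: "'a::complex_hilbert \<rightharpoonup> 'a"
  assumes A: "m_angle_accretive (pi / 4) A" and A2: "m_accretive (A \<circ>\<^sub>m A)"
    and G: "accretive G" and dom: "dom (A \<circ>\<^sub>m A) \<subseteq> dom G" and c: "c \<ge> 0"
    and low: "\<And>x. x \<in> dom (A \<circ>\<^sub>m A) \<Longrightarrow> - c * (norm x)\<^sup>2 \<le> Re (cinner (A \<cdot> A \<cdot> x) (G \<cdot> x))"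
  obtains K where "K \<ge> 0" "\<And>x. x \<in> dom (A \<circ>\<^sub>m A) \<Longrightarrow> - K * (norm x)\<^sup>2 \<le> Re (cinner (A \<cdot> x) (G \<cdot> x))"
proof -
  interpret sg: sectorial_operator A by unfold_locales (rule A)
  define U where "U t = sg.U t" for t :: real
  note lA = sg.linear and lG = accretive_linear[OF G]
  have U_norm: "norm (U t x) \<le> norm x" if "t \<ge> 0" for t x
    unfolding U_def using that by (intro sg.norm_S) simp
  have U_A: "U t x \<in> dom A" "A \<cdot> U t x = U t (A \<cdot> x)" if "t \<ge> 0" "x \<in> dom A" for t x
    unfolding U_def using sg.S_commute[OF that] by auto
  have U_smooth: "U t x \<in> dom A" "((\<lambda>s. U s x) has_vector_derivative - (A \<cdot> U t x)) (at t)" if "t > 0" for t x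
    unfolding U_def using sg.S_smoothing[OF that] by metis+
  have U_bound: "\<exists>K\<ge>0. \<forall>x. norm (A \<cdot> U t x) \<le> K * norm x" if "t > 0" for t
    unfolding U_def using sg.S_smoothing[OF that] by metis
  have U_0: "((\<lambda>t. U t x) \<longlongrightarrow> x) (at_right 0)" for x
    unfolding U_def by (rule sg.S_at_0)
  have sq: "x \<in> dom (A \<circ>\<^sub>m A) \<longleftrightarrow> x \<in> dom A \<and> A \<cdot> x \<in> dom A" for x by (simp add: dom_square)
  have sq_app: "(A \<circ>\<^sub>m A) \<cdot> x = A \<cdot> A \<cdot> x" if "x \<in> dom (A \<circ>\<^sub>m A)" for x
    using that by (intro square_app) (simp add: sq)
  have dG: "x \<in> dom G" if "x \<in> dom (A \<circ>\<^sub>m A)" for x using that dom by blast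
  obtain M where M: "M > 0" "\<And>x. x \<in> dom (A \<circ>\<^sub>m A) \<Longrightarrow> norm (G \<cdot> x) \<le> M * (norm (A \<cdot> A \<cdot> x) + norm x)"
    using accretive_relatively_bounded[OF A2 G dom] sq_app by metis
  note a2 = m_accretive_accretive[OF A2]
  have s: "shift_onto (A \<circ>\<^sub>m A) 1" using m_accretive_shift_onto[OF A2, of 1] by simp
  define R where "R = resolvent (A \<circ>\<^sub>m A) 1"
  interpret R: bounded_linear R unfolding R_def by (rule bounded_linear_resolvent[OF a2 s]) simp
  have R_dom: "R f \<in> dom (A \<circ>\<^sub>m A)" for f unfolding R_def by (rule resolvent_dom[OF s])
  \<comment> \<open>\<open>N = G (A\<^sup>2 + 1)\<^sup>-\<^sup>1\<close> is bounded and makes \<open>t \<mapsto> G (U t x)\<close> differentiable.\<close>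
  define N where "N f = G \<cdot> R f" for f
  have N: "bounded_linear N"
  proof (rule bounded_linear_intro[where K = "M * 3"])
    show "N (f + g) = N f + N g" for f g by (simp add: N_def R.add linear_op_add[OF lG] dG R_dom)
    show "N (r *\<^sub>R f) = r *\<^sub>R N f" for r f by (simp add: N_def R.scaleR linear_op_scaleR[OF lG] dG R_dom)
    fix f
    have 1: "norm (R f) \<le> norm f" unfolding R_def using resolvent_norm[OF a2 s, of f] by simp
    have "A \<cdot> A \<cdot> R f = f - R f"
      using resolvent_app[OF s, of f] sq_app[OF R_dom] by (simp add: R_def)
    hence "norm (A \<cdot> A \<cdot> R f) \<le> norm f + norm (R f)" by (simp add: norm_triangle_ineq4)
    hence "norm (A \<cdot> A \<cdot> R f) + norm (R f) \<le> 3 * norm f" using 1 by linarith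
    hence "M * (norm (A \<cdot> A \<cdot> R f) + norm (R f)) \<le> M * (3 * norm f)"
      using M(1) by (intro mult_left_mono) auto
    thus "norm (N f) \<le> norm f * (M * 3)" using M(2)[OF R_dom, of f] by (simp add: N_def mult_ac)
  qed
  have G_N: "G \<cdot> x = N (A \<cdot> A \<cdot> x + x)" if "x \<in> dom (A \<circ>\<^sub>m A)" for x
    unfolding N_def R_def using resolvent_unique[OF a2 s _ that] sq_app[OF that] by simp
  obtain K1 where K1: "K1 \<ge> 0" "\<And>x. norm (A \<cdot> U 1 x) \<le> K1 * norm x" using U_bound[of 1] by auto
  obtain K2 where K2: "K2 \<ge> 0" "\<And>x. norm (A \<cdot> U (1/2) x) \<le> K2 * norm x" using U_bound[of "1/2"] by auto
  show ?thesis
  proof (rule that[of "K1 * (M * (K2 * K2 + 1)) + c"])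
    show "K1 * (M * (K2 * K2 + 1)) + c \<ge> 0" using K1 K2 M(1) c by simp
    fix x assume x: "x \<in> dom (A \<circ>\<^sub>m A)"
    define y where "y = A \<cdot> A \<cdot> x + x"
    define \<phi> where "\<phi> t = Re (cinner (U t (A \<cdot> x)) (N (U t y)))" for t
    have xA: "x \<in> dom A" "A \<cdot> x \<in> dom A" using x sq by auto
    have u: "U t x \<in> dom (A \<circ>\<^sub>m A)" "A \<cdot> U t x = U t (A \<cdot> x)" "A \<cdot> A \<cdot> U t x + U t x = U t y" if "t \<ge> 0" for t
    proof -
      have *: "A \<cdot> U t x = U t (A \<cdot> x)" "A \<cdot> U t (A \<cdot> x) = U t (A \<cdot> A \<cdot> x)" using U_A[OF that] xA by blast+
      show "A \<cdot> U t x = U t (A \<cdot> x)" by (rule *(1))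
      show "U t x \<in> dom (A \<circ>\<^sub>m A)" unfolding sq * using U_A[OF that] xA by blast
      show "A \<cdot> A \<cdot> U t x + U t x = U t y" unfolding * y_def by (simp add: U_def bap_right)
    qed
    have GU: "G \<cdot> U t x = N (U t y)" if "t \<ge> 0" for t
      by (simp only: G_N[OF u(1)[OF that]] u(3)[OF that])
    have \<phi>: "\<phi> t = Re (cinner (A \<cdot> U t x) (G \<cdot> U t x))" if "t \<ge> 0" for t
      unfolding \<phi>_def GU[OF that] u(2)[OF that] ..
    have deriv: "\<exists>d. (\<phi> has_real_derivative d) (at t) \<and> d \<le> c * (norm x)\<^sup>2" if t: "t > 0" for t
    proof (intro exI conjI)
      let ?u = "U t x"
      have t0: "t \<ge> 0" using t by simp
      have uA: "?u \<in> dom A" "A \<cdot> ?u \<in> dom A" using u(1)[OF t0] sq by auto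
      have A2u: "A \<cdot> A \<cdot> ?u = U t y - ?u" using u(3)[OF t0] by (simp add: eq_diff_eq)
      have A2u_dom: "A \<cdot> A \<cdot> ?u \<in> dom A" unfolding A2u by (intro linear_op_intros[OF lA] uA U_smooth(1)[OF t])
      have Au: "A \<cdot> ?u \<in> dom (A \<circ>\<^sub>m A)" using uA A2u_dom sq by auto
      have AUy: "A \<cdot> U t y = A \<cdot> A \<cdot> (A \<cdot> ?u) + A \<cdot> ?u"
        unfolding u(3)[OF t0, symmetric] by (rule linear_op_add(2)[OF lA A2u_dom uA(1)])
      have NAUy: "N (A \<cdot> U t y) = G \<cdot> (A \<cdot> ?u)" unfolding AUy by (rule G_N[OF Au, symmetric])
      let ?d = "cinner (U t (A \<cdot> x)) (N (- (A \<cdot> U t y))) + cinner (- (A \<cdot> U t (A \<cdot> x))) (N (U t y))"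
      have "((\<lambda>t. cinner (U t (A \<cdot> x)) (N (U t y))) has_vector_derivative ?d) (at t)"
        by (intro bounded_bilinear.has_vector_derivative[OF bounded_bilinear_cinner]
            bounded_linear.has_vector_derivative[OF N] U_smooth(2) t)
      hence "((\<lambda>t. Re (cinner (U t (A \<cdot> x)) (N (U t y)))) has_vector_derivative Re ?d) (at t)"
        by (rule bounded_linear.has_vector_derivative[OF bounded_linear_Re])
      thus "(\<phi> has_real_derivative Re ?d) (at t)"
        unfolding \<phi>_def has_real_derivative_iff_has_vector_derivative .
      have "?d = - cinner (A \<cdot> ?u) (G \<cdot> (A \<cdot> ?u)) - cinner (A \<cdot> A \<cdot> ?u) (G \<cdot> ?u)"
        by (simp only: linear_neg[OF bounded_linear.linear[OF N]] NAUy GU[OF t0, symmetric]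
            u(2)[OF t0, symmetric] cinner_minus_left cinner_minus_right uminus_add_conv_diff
            add_uminus_conv_diff)
      moreover have "0 \<le> Re (cinner (A \<cdot> ?u) (G \<cdot> (A \<cdot> ?u)))"
        using accretiveD[OF G dG[OF Au]] by (simp add: Re_cinner_commute)
      moreover have "- c * (norm ?u)\<^sup>2 \<le> Re (cinner (A \<cdot> A \<cdot> ?u) (G \<cdot> ?u))" by (rule low[OF u(1)[OF t0]])
      moreover have "c * (norm ?u)\<^sup>2 \<le> c * (norm x)\<^sup>2"
        using U_norm[OF t0, of x] c by (intro mult_left_mono power_mono) auto
      ultimately show "Re ?d \<le> c * (norm x)\<^sup>2" by simp
    qed
    have decay: "\<phi> 1 - c * (norm x)\<^sup>2 \<le> \<phi> t" if t: "0 < t" "t < 1" for t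
    proof -
      define \<psi> where "\<psi> t = \<phi> t - c * (norm x)\<^sup>2 * t" for t
      have "\<psi> 1 \<le> \<psi> t"
      proof (rule DERIV_nonpos_imp_nonincreasing[of t 1 \<psi>])
        fix r assume "t \<le> r" "r \<le> 1"
        hence "r > 0" using t by simp
        then obtain d where d: "(\<phi> has_real_derivative d) (at r)" "d \<le> c * (norm x)\<^sup>2" using deriv by blast
        have "(\<psi> has_real_derivative d - c * (norm x)\<^sup>2 * 1) (at r)"
          unfolding \<psi>_def by (intro DERIV_diff DERIV_cmult DERIV_ident d(1))
        thus "\<exists>z. (\<psi> has_real_derivative z) (at r) \<and> z \<le> 0" using d(2) by fastforce
      qed (use t in simp)
      moreover have "c * (norm x)\<^sup>2 * t \<ge> 0" using c t by simp
      ultimately show ?thesis by (simp add: \<psi>_def)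
    qed
    have "((\<lambda>t. \<phi> t) \<longlongrightarrow> Re (cinner (A \<cdot> x) (N y))) (at_right 0)"
      unfolding \<phi>_def by (intro tendsto_Re tendsto_cinner bounded_linear.tendsto[OF N] U_0)
    moreover have "\<forall>\<^sub>F t in at_right 0. \<phi> 1 - c * (norm x)\<^sup>2 \<le> \<phi> t"
      unfolding eventually_at_right_field using decay by (intro exI[of _ 1]) auto
    ultimately have "\<phi> 1 - c * (norm x)\<^sup>2 \<le> Re (cinner (A \<cdot> x) (N y))"
      by (rule tendsto_lowerbound) simp
    also have "N y = G \<cdot> x" unfolding y_def by (rule G_N[OF x, symmetric])
    finally have main: "\<phi> 1 - c * (norm x)\<^sup>2 \<le> Re (cinner (A \<cdot> x) (G \<cdot> x))" .
    \<comment> \<open>At time 1 both \<open>A u\<close> and \<open>A\<^sup>2 u\<close> are controlled by \<open>x\<close>.\<close>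
    have "norm (A \<cdot> A \<cdot> U 1 x) \<le> K2 * (K2 * norm x)"
    proof -
      have "U 1 x = U (1/2) (U (1/2) x)"
        unfolding U_def using sg.S_add[of "of_real (1/2)" "of_real (1/2)" x] by (simp flip: of_real_add)
      hence "A \<cdot> A \<cdot> U 1 x = A \<cdot> U (1/2) (A \<cdot> U (1/2) x)"
        using U_A(2)[of "1/2" "U (1/2) x"] U_smooth(1)[of "1/2" x] by simp
      also have "norm \<dots> \<le> K2 * norm (A \<cdot> U (1/2) x)" by (rule K2)
      also have "\<dots> \<le> K2 * (K2 * norm x)" by (intro mult_left_mono K2)
      finally show ?thesis .
    qed
    hence "norm (A \<cdot> A \<cdot> U 1 x) + norm (U 1 x) \<le> (K2 * K2 + 1) * norm x"
      using U_norm[of 1 x] by (simp add: algebra_simps)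
    hence "M * (norm (A \<cdot> A \<cdot> U 1 x) + norm (U 1 x)) \<le> M * ((K2 * K2 + 1) * norm x)"
      using M(1) by (intro mult_left_mono) auto
    hence Gb: "norm (G \<cdot> U 1 x) \<le> M * (K2 * K2 + 1) * norm x"
      using M(2)[OF u(1), of 1] by (simp add: mult.assoc)
    have "- \<phi> 1 \<le> norm (A \<cdot> U 1 x) * norm (G \<cdot> U 1 x)"
      using \<phi>[of 1] Re_cinner_ge[of "A \<cdot> U 1 x" "G \<cdot> U 1 x"] by simp
    also have "\<dots> \<le> (K1 * norm x) * (M * (K2 * K2 + 1) * norm x)"
      using K1 K2 M(1) by (intro mult_mono Gb) auto
    also have "\<dots> = K1 * (M * (K2 * K2 + 1)) * (norm x)\<^sup>2" by (simp add: power2_eq_square)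
    finally have "- \<phi> 1 \<le> K1 * (M * (K2 * K2 + 1)) * (norm x)\<^sup>2" .
    moreover have "- (k + c) * n = - (k * n) - c * n" for k n :: real by (simp add: algebra_simps)
    ultimately show "- (K1 * (M * (K2 * K2 + 1)) + c) * (norm x)\<^sup>2 \<le> Re (cinner (A \<cdot> x) (G \<cdot> x))"
      using main by simp
  qed
qed

text \<open>
  The lemma above, applied to the root \<open>A\<close> and the form of \<open>B\<^sup>2\<close> and then to the root \<open>B\<close> and the
  form of \<open>A\<close>, turns the bound for \<open>Re \<langle>A\<^sup>2 x, B\<^sup>2 x\<rangle>\<close> into one for \<open>Re \<langle>A x, B x\<rangle>\<close>, to which the
  perturbation theorem applies.
\<close>

theorem m_angle_accretive_sum_of_roots:
  fixes A B :: "'a::complex_hilbert \<rightharpoonup> 'a"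
  assumes A: "m_angle_accretive (pi / 4) A" "m_accretive (A \<circ>\<^sub>m A)"
    and B: "m_angle_accretive (pi / 4) B" "m_accretive (B \<circ>\<^sub>m B)"
    and dom2: "dom (A \<circ>\<^sub>m A) = dom (B \<circ>\<^sub>m B)" and dom: "dom A \<subseteq> dom B" and c: "c \<ge> 0"
    and low: "\<And>x. x \<in> dom (A \<circ>\<^sub>m A) \<Longrightarrow> - c * (norm x)\<^sup>2 \<le> Re (cinner (A \<cdot> A \<cdot> x) (B \<cdot> B \<cdot> x))"
  shows "m_angle_accretive (pi / 4) (op_add B A)"
proof -
  interpret sg: sectorial_operator A by unfold_locales (rule A)
  have mA: "m_accretive A" and mB: "m_accretive B" using A B by (auto simp: m_angle_accretive_def)
  note aA = m_accretive_accretive[OF mA] and aB = m_accretive_accretive[OF mB]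
  have dA2: "dom (A \<circ>\<^sub>m A) \<subseteq> dom A" by (auto simp: dom_square)
  have B2: "(B \<circ>\<^sub>m B) \<cdot> x = B \<cdot> B \<cdot> x" if "x \<in> dom (A \<circ>\<^sub>m A)" for x
    using that unfolding dom2 by (intro square_app) (auto simp: dom_square)
  obtain K1 where K1: "K1 \<ge> 0" "\<And>x. x \<in> dom (A \<circ>\<^sub>m A) \<Longrightarrow> - K1 * (norm x)\<^sup>2 \<le> Re (cinner (A \<cdot> x) ((B \<circ>\<^sub>m B) \<cdot> x))"
  proof (rule mixed_form_lower_bound[OF A m_accretive_accretive[OF B(2)] _ c])
    show "dom (A \<circ>\<^sub>m A) \<subseteq> dom (B \<circ>\<^sub>m B)" by (simp add: dom2)
    show "- c * (norm x)\<^sup>2 \<le> Re (cinner (A \<cdot> A \<cdot> x) ((B \<circ>\<^sub>m B) \<cdot> x))" if "x \<in> dom (A \<circ>\<^sub>m A)" for x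
      unfolding B2[OF that] by (rule low[OF that])
  qed blast
  obtain K2 where K2: "K2 \<ge> 0" "\<And>x. x \<in> dom (B \<circ>\<^sub>m B) \<Longrightarrow> - K2 * (norm x)\<^sup>2 \<le> Re (cinner (B \<cdot> x) (A \<cdot> x))"
  proof (rule mixed_form_lower_bound[OF B aA _ K1(1)])
    show "dom (B \<circ>\<^sub>m B) \<subseteq> dom A" using dA2 by (simp add: dom2)
    show "- K1 * (norm x)\<^sup>2 \<le> Re (cinner (B \<cdot> B \<cdot> x) (A \<cdot> x))" if "x \<in> dom (B \<circ>\<^sub>m B)" for x
      using K1(2)[of x] B2[of x] that by (simp add: dom2 Re_cinner_commute[of "B \<cdot> B \<cdot> x"])
  qed blast
  obtain K where K: "K > 0" "\<And>x. x \<in> dom A \<Longrightarrow> norm (B \<cdot> x) \<le> K * (norm (A \<cdot> x) + norm x)"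
    using accretive_relatively_bounded[OF mA aB dom] by blast
  \<comment> \<open>The semigroup generated by \<open>- A\<close> regularises \<open>x\<close> into the domain of \<open>A\<^sup>2\<close>.\<close>
  have AB: "- K2 * (norm x)\<^sup>2 \<le> Re (cinner (A \<cdot> x) (B \<cdot> x))" if x: "x \<in> dom A" for x
  proof -
    define u where "u t = sg.U t x" for t :: real
    have u: "u t \<in> dom (A \<circ>\<^sub>m A)" "u t \<in> dom A" "A \<cdot> u t = sg.U t (A \<cdot> x)" if t: "t > 0" for t
    proof -
      show *: "u t \<in> dom A" "A \<cdot> u t = sg.U t (A \<cdot> x)"
        unfolding u_def using sg.S_commute[OF _ x, of t] t by auto
      have "A \<cdot> u t \<in> dom A" unfolding *(2) using sg.S_smoothing[OF t] by metis
      thus "u t \<in> dom (A \<circ>\<^sub>m A)" using * by (simp add: dom_square)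
    qed
    have pos: "\<forall>\<^sub>F t in at_right 0. (0::real) < t" by (rule eventually_at_right_less)
    have u0: "(u \<longlongrightarrow> x) (at_right 0)" unfolding u_def by (rule sg.S_at_0)
    have Au0: "((\<lambda>t. A \<cdot> u t) \<longlongrightarrow> A \<cdot> x) (at_right 0)"
      by (rule Lim_transform_eventually[OF sg.S_at_0[of "A \<cdot> x"]], rule eventually_mono[OF pos]) (simp add: u(3))
    have Bu0: "((\<lambda>t. B \<cdot> u t) \<longlongrightarrow> B \<cdot> x) (at_right 0)"
    proof (rule LIM_zero_cancel, rule Lim_null_comparison)
      have "((\<lambda>t. K * (norm (A \<cdot> u t - A \<cdot> x) + norm (u t - x))) \<longlongrightarrow> K * (norm (A \<cdot> x - A \<cdot> x) + norm (x - x))) (at_right 0)"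
        by (intro tendsto_intros Au0 u0)
      thus "((\<lambda>t. K * (norm (A \<cdot> u t - A \<cdot> x) + norm (u t - x))) \<longlongrightarrow> 0) (at_right 0)" by simp
      show "\<forall>\<^sub>F t in at_right 0. norm (B \<cdot> u t - B \<cdot> x) \<le> K * (norm (A \<cdot> u t - A \<cdot> x) + norm (u t - x))"
        using pos
      proof eventually_elim
        case (elim t)
        have d: "u t - x \<in> dom A" "A \<cdot> (u t - x) = A \<cdot> u t - A \<cdot> x" "B \<cdot> (u t - x) = B \<cdot> u t - B \<cdot> x"
          using linear_op_diff[OF accretive_linear[OF aA] u(2)[OF elim] x]
            linear_op_diff(2)[OF accretive_linear[OF aB]] u(2)[OF elim] x dom by auto
        show ?case using K(2)[OF d(1)] unfolding d .
      qed
    qed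
    have l1: "((\<lambda>t. - K2 * (norm (u t))\<^sup>2) \<longlongrightarrow> - K2 * (norm x)\<^sup>2) (at_right 0)"
      by (intro tendsto_intros u0)
    have l2: "((\<lambda>t. Re (cinner (B \<cdot> u t) (A \<cdot> u t))) \<longlongrightarrow> Re (cinner (B \<cdot> x) (A \<cdot> x))) (at_right 0)"
      by (intro tendsto_Re tendsto_cinner Au0 Bu0)
    have "- K2 * (norm x)\<^sup>2 \<le> Re (cinner (B \<cdot> x) (A \<cdot> x))"
    proof (rule tendsto_le[OF _ l2 l1])
      show "\<forall>\<^sub>F t in at_right 0. - K2 * (norm (u t))\<^sup>2 \<le> Re (cinner (B \<cdot> u t) (A \<cdot> u t))"
        using pos by (rule eventually_mono) (rule K2(2), simp add: dom2[symmetric] u(1))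
    qed simp
    thus ?thesis by (simp only: Re_cinner_commute)
  qed
  have "m_accretive (op_add A B)"
    by (rule m_accretive_perturbation[OF mA aB dom K2(1), of 0 0]) (use AB in simp_all)
  moreover have "op_add A B = op_add B A"
    by (rule op_eqI) (auto simp: op_add_app add.commute)
  moreover have "angle_accretive (pi / 4) (op_add B A)"
    unfolding angle_accretive_pi4
  proof (intro conjI ballI)
    show "linear_op (op_add B A)" by (intro linear_op_op_add accretive_linear aA aB)
    fix x assume "x \<in> dom (op_add B A)"
    hence x: "x \<in> dom B" "x \<in> dom A" by auto
    have "\<bar>Im (cinner (A \<cdot> x) x)\<bar> \<le> Re (cinner (A \<cdot> x) x)" "\<bar>Im (cinner (B \<cdot> x) x)\<bar> \<le> Re (cinner (B \<cdot> x) x)"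
      using A(1) B(1) x by (auto simp: m_angle_accretive_def angle_accretive_pi4)
    thus "\<bar>Im (cinner (op_add B A \<cdot> x) x)\<bar> \<le> Re (cinner (op_add B A \<cdot> x) x)"
      using abs_triangle_ineq[of "Im (cinner (B \<cdot> x) x)" "Im (cinner (A \<cdot> x) x)"]
      by (simp add: op_add_app x cinner_add_left)
  qed
  ultimately show ?thesis by (simp add: m_angle_accretive_def)
qed

section \<open>The sum of an accretive operator and the root of a perturbed square\<close>

theorem proposition3p8:
  fixes B C \<Lambda> Z\<^sub>1 :: "'a::complex_hilbert \<rightharpoonup> 'a"
    and \<alpha> \<beta> \<delta> :: real
  assumes "linear_op B"
    and "linear_op C"
    and "m_accretive (B \<circ>\<^sub>m B)"
    and "accretive C"
    and "dom (B \<circ>\<^sub>m B) \<subseteq> dom C"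
    and "\<alpha> \<ge> 0" and "0 \<le> \<beta>" and "\<beta> < 1" and "\<delta> \<ge> 0"
    and "\<And>x. x \<in> dom (B \<circ>\<^sub>m B) \<Longrightarrow>
      Re (cinner ((B \<circ>\<^sub>m B) \<cdot> x) (C \<cdot> x)) \<ge>
        - \<alpha> * (norm x)\<^sup>2 - \<beta> * (norm ((B \<circ>\<^sub>m B) \<cdot> x))\<^sup>2 - \<delta> * norm ((B \<circ>\<^sub>m B) \<cdot> x) * norm x"
    and "\<Lambda> = op_add (B \<circ>\<^sub>m B) C"
    and "Z\<^sub>1 = op_add B (op_sqrt \<Lambda>)"
    and "dom (op_sqrt \<Lambda>) \<subseteq> dom B"
    and "accretive B"
  shows "m_angle_accretive (pi / 4) Z\<^sub>1 \<and>
    (\<exists>T\<^sub>1. generates_holomorphic_c0_semigroup (op_uminus Z\<^sub>1) (pi / 4) T\<^sub>1) \<and>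
    (\<forall>\<theta>. 0 \<le> \<theta> \<longrightarrow> \<theta> < pi / 2 \<longrightarrow> angle_accretive \<theta> B \<longrightarrow>
      null_space Z\<^sub>1 = null_space B \<inter> null_space (op_sqrt \<Lambda>))"
proof -
  note B2 = assms(3) and C = assms(4) and domC = assms(5) and const = assms(6-9) and lower = assms(10)
  note \<Lambda> = assms(11) and Z = assms(12) and domA = assms(13)
  define A where "A = op_sqrt \<Lambda>"
  have m\<Lambda>: "m_accretive \<Lambda>"
    unfolding \<Lambda> by (rule m_accretive_perturbation[OF B2 C domC const lower])
  have A: "m_angle_accretive (pi / 4) A" and AA: "A \<circ>\<^sub>m A = \<Lambda>"
    unfolding A_def by (rule m_angle_accretive_op_sqrt[OF m\<Lambda>], rule op_sqrt_square[OF m\<Lambda>])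
  have "B = op_sqrt (B \<circ>\<^sub>m B)" by (rule op_sqrt_unique[OF B2 assms(14) refl])
  hence B: "m_angle_accretive (pi / 4) B" using m_angle_accretive_op_sqrt[OF B2] by simp
  have dom\<Lambda>: "dom \<Lambda> = dom (B \<circ>\<^sub>m B)" using domC by (auto simp: \<Lambda>)
  define c where "c = \<alpha> + \<delta>\<^sup>2 / (4 * (1 - \<beta>))"
  have "m_angle_accretive (pi / 4) (op_add B A)"
  proof (rule m_angle_accretive_sum_of_roots[OF A _ B B2])
    show "m_accretive (A \<circ>\<^sub>m A)" "dom (A \<circ>\<^sub>m A) = dom (B \<circ>\<^sub>m B)" using m\<Lambda> dom\<Lambda> by (simp_all add: AA)
    show "dom A \<subseteq> dom B" using domA by (simp add: A_def)
    show "c \<ge> 0" using const by (simp add: c_def)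
    fix x assume x: "x \<in> dom (A \<circ>\<^sub>m A)"
    hence x2: "x \<in> dom (B \<circ>\<^sub>m B)" and xC: "x \<in> dom C" using dom\<Lambda> domC by (auto simp: AA)
    have xA: "x \<in> dom A" and xB: "x \<in> dom B" using x x2 by (auto simp: dom_square)
    let ?b = "(B \<circ>\<^sub>m B) \<cdot> x"
    have bb: "B \<cdot> B \<cdot> x = ?b" by (rule square_app[OF xB, symmetric])
    have aa: "A \<cdot> A \<cdot> x = ?b + C \<cdot> x"
      using square_app[OF xA] op_add_app[OF x2 xC] by (simp add: AA \<Lambda>)
    have "\<beta> < 1" by (rule const)
    \<comment> \<open>The constant \<open>c\<close> comes from completing the square in the norm of \<open>B\<^sup>2 x\<close>.\<close>
    have "0 \<le> (1 - \<beta>) * (norm ?b - \<delta> * norm x / (2 * (1 - \<beta>)))\<^sup>2" using const by simp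
    also have "\<dots> = (1 - \<beta>) * (norm ?b)\<^sup>2 - \<delta> * norm ?b * norm x + \<delta>\<^sup>2 / (4 * (1 - \<beta>)) * (norm x)\<^sup>2"
    proof -
      have "e * (s - d * n / (2 * e))\<^sup>2 = e * s\<^sup>2 - d * s * n + d\<^sup>2 / (4 * e) * n\<^sup>2" if "e > 0" for e s d n :: real
        using that by (simp add: power2_eq_square field_simps)
      from this[of "1 - \<beta>" "norm ?b" "\<delta>" "norm x"] show ?thesis using \<open>\<beta> < 1\<close> by simp
    qed
    finally have sq: "0 \<le> (1 - \<beta>) * (norm ?b)\<^sup>2 - \<delta> * norm ?b * norm x + \<delta>\<^sup>2 / (4 * (1 - \<beta>)) * (norm x)\<^sup>2" .
    have "Re (cinner (?b + C \<cdot> x) ?b) = (norm ?b)\<^sup>2 + Re (cinner ?b (C \<cdot> x))"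
      by (simp add: cinner_add_left Re_cinner_self Re_cinner_commute[of "C \<cdot> x"])
    thus "- c * (norm x)\<^sup>2 \<le> Re (cinner (A \<cdot> A \<cdot> x) (B \<cdot> B \<cdot> x))"
      using lower[OF x2] sq unfolding aa bb c_def by (simp add: algebra_simps)
  qed
  hence Z1: "m_angle_accretive (pi / 4) Z\<^sub>1" by (simp add: Z A_def)
  interpret sg: sectorial_operator Z\<^sub>1 by unfold_locales (rule Z1)
  have "null_space Z\<^sub>1 = null_space B \<inter> null_space A"
  proof (intro subset_antisym subsetI)
    fix x assume "x \<in> null_space Z\<^sub>1"
    hence x: "x \<in> dom B" "x \<in> dom A" and 0: "B \<cdot> x + A \<cdot> x = 0"
      by (auto simp: null_space_def Z A_def[symmetric] op_add_app)
    have acc: "angle_accretive (pi / 4) A" "angle_accretive (pi / 4) B" "closure (dom A) = UNIV" "closure (dom B) = UNIV"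
      using A B by (auto simp: m_angle_accretive_def m_accretive_def)
    have "Re (cinner (B \<cdot> x) x) + Re (cinner (A \<cdot> x) x) = 0"
      using arg_cong[OF 0, of "\<lambda>v. Re (cinner v x)"] by (simp add: cinner_add_left)
    hence "Re (cinner (B \<cdot> x) x) = 0" "Re (cinner (A \<cdot> x) x) = 0"
      using accretiveD[OF angle_accretive_pi4_accretive[OF acc(1)] x(2)]
        accretiveD[OF angle_accretive_pi4_accretive[OF acc(2)] x(1)] by auto
    thus "x \<in> null_space B \<inter> null_space A"
      using sectorial_form_eq_0[OF acc(1,3) x(2)] sectorial_form_eq_0[OF acc(2,4) x(1)] x
      by (simp add: null_space_def)
  next
    fix x assume "x \<in> null_space B \<inter> null_space A"
    thus "x \<in> null_space Z\<^sub>1" by (auto simp: null_space_def Z A_def[symmetric] op_add_app)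
  qed
  thus ?thesis using Z1 sg.generates by (auto simp: A_def)
qed

end
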